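(* Let $v\in\mathbb{N}^{\ell+t+1}$ and $i\in\{n,n-1,\dots,3\}$. There exists $D_{v,n}\in\mathbb{N}$ such that for any complete intersection $I\subseteq R$ of minimal type $v$ with $\alpha(I)\ge D_{v,n}$, there exist linear forms $f_n,f_{n-1},\dots,f_{i+1}$ for which the WLP holds for $I+(f_n,\dots,f_{i+1})$ in degrees $\le\alpha(I)+t-1$. (When $i=n$, $(f_n,\dots,f_{i+1})$ means the zero ideal.)
   Context: $\mathbb{N}=\{0,1,2,\dots\}$. $K$ is a field of characteristic $0$, $n\ge 3$, $R=K[x_1,\dots,x_n]$ is standard graded, and all ideals are homogeneous. $\alpha(I)$ is the smallest degree of a minimal generator of $I$. A complete intersection is an ideal generated by a regular sequence of forms. Type: let $\ell\ge1$, $t\ge 0$ be integers. $I$ is of type $v=(a_1,\dots,a_\ell,b_0,\dots,b_t)\in\mathbb{N}^{\ell+t+1}$ if there is a regular sequence of forms $h_1,\dots,h_\ell\in I$ with $\deg h_i=\alpha(I)+a_i$ and $\deg h_i\le\deg h_{i+1}$, and for all $j\in\{0,\dots,t\}$, $I$ has exactly $b_j$ minimal generators in degree $\alpha(I)+j$. For $d\in\mathbb{N}$, $\gamma_I(d)$ is the largest $i\in\{1,\dots,\ell\}$ with $\alpha(I)+a_i\le d$, and $0$ if $d<\alpha(I)+a_1$ (here $\alpha(I)+a_1\ge2$). Minimal type: $\rho_I(i)$ is the smallest degree $d$ such that $I_d$ contains a regular sequence of length $i$, and $\lambda_I(d)$ is the longest length of a regular sequence contained in $I_d$. $I$ is of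 minimal type $v$ if $I$ is of type $v$, witnessed by a regular sequence $h_1,\dots,h_\ell$ which is part of a minimal generating set of $I$, with $\rho_I(i)=\deg h_i$ for all $i\in\{1,\dots,\ell\}$ and $\lambda_I(d)=\gamma_I(d)$ for all $d\in\mathbb{N}$. WLP: for a homogeneous ideal $Q$, $A=R/Q$, a linear form $f$ is a weak Lefschetz element (WLE) on $A$ in degree $d$ if multiplication $\times f:A_d\to A_{d+1}$ is injective or surjective. The WLP (weak Lefschetz property) holds for $Q$ in a given range of degrees if there is a linear form that is a WLE on $R/Q$ in every degree of that range. *)

theory Defs
  imports Complex_Main "HOL-Library.Cardinality" "HOL-Library.Poly_Mapping" "HOL-Library.Set_Algebras"
begin

text \<open>
  The polynomial ring over \<open>'k\<close> in the finitely many variables \<open>'n\<close>: exponent vectors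
  have type \<open>'n \<Rightarrow>\<^sub>0 nat\<close>, and the number of variables is \<open>CARD('n)\<close>.
\<close>

type_synonym ('n, 'k) mpoly = "('n \<Rightarrow>\<^sub>0 nat) \<Rightarrow>\<^sub>0 'k"

global_interpretation ideal: module "(*) :: 'a::comm_ring_1 \<Rightarrow> 'a \<Rightarrow> 'a"
  defines ideal_gen = ideal.span
  by standard (simp_all add: algebra_simps)

definition poly_scale :: "'k::field \<Rightarrow> ('n, 'k) mpoly \<Rightarrow> ('n, 'k) mpoly" where
  "poly_scale c p = Poly_Mapping.single 0 c * p"

global_interpretation poly_vs: vector_space "poly_scale :: 'k::field \<Rightarrow> ('n, 'k) mpoly \<Rightarrow> _"
  defines poly_dependent = poly_vs.dependent
  by standard
    (simp_all add: poly_scale_def distrib_left distrib_right single_add mult_single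
      flip: mult.assoc)

definition forms :: "nat \<Rightarrow> ('n::finite, 'k::field) mpoly set" where
  "forms d = {p. \<forall>m \<in> Poly_Mapping.keys p. (\<Sum>x\<in>UNIV. Poly_Mapping.lookup m x) = d}"

text \<open>
  The zero polynomial lies in \<open>forms d\<close> for every \<open>d\<close>. Members of regular sequences and of
  minimal generating sets are nonzero, so for them membership in \<open>forms d\<close> says that the
  degree is \<open>d\<close>.
\<close>

definition regular_seq :: "'a::comm_ring_1 list \<Rightarrow> bool" where
  "regular_seq hs \<longleftrightarrow>
     (\<forall>k < length hs. \<forall>g. hs ! k * g \<in> ideal_gen (set (take k hs))
                          \<longrightarrow> g \<in> ideal_gen (set (take k hs))) \<and>
     ideal_gen (set hs) \<noteq> UNIV"

definition complete_intersection :: "('n::finite, 'k::field) mpoly set \<Rightarrow> bool" where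
  "complete_intersection I \<longleftrightarrow>
     (\<exists>hs. regular_seq hs \<and> set hs \<subseteq> (\<Union>d. forms d) \<and> I = ideal_gen (set hs))"

definition minimal_generating_set ::
    "('n::finite, 'k::field) mpoly set \<Rightarrow> ('n, 'k) mpoly set \<Rightarrow> bool" where
  "minimal_generating_set I G \<longleftrightarrow>
     finite G \<and> G \<subseteq> (\<Union>d. forms d) \<and> ideal_gen G = I \<and> (\<forall>H. H \<subset> G \<longrightarrow> ideal_gen H \<noteq> I)"

definition alpha :: "('n::finite, 'k::field) mpoly set \<Rightarrow> nat" where
  "alpha I = (LEAST d. \<exists>G. minimal_generating_set I G \<and> G \<inter> forms d \<noteq> {})"

text \<open>
  The number of minimal generators of degree \<open>d\<close> does not depend on the minimal generating
  set (graded Nakayama lemma), so it is read off from any one of them.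
\<close>

definition has_minimal_generators :: "('n::finite, 'k::field) mpoly set \<Rightarrow> nat \<Rightarrow> nat \<Rightarrow> bool" where
  "has_minimal_generators I d c \<longleftrightarrow>
     (\<exists>G. minimal_generating_set I G \<and> card (G \<inter> forms d) = c)"

text \<open>
  The type vector \<open>(a\<^sub>1, \<dots>, a\<^sub>\<ell>, b\<^sub>0, \<dots>, b\<^sub>t)\<close> is given by two lists: \<open>a ! (i - 1)\<close> is
  \<open>a\<^sub>i\<close> and \<open>b ! j\<close> is \<open>b\<^sub>j\<close>, so \<open>length a = \<ell>\<close> and \<open>length b = t + 1\<close>.
\<close>

definition type_witness ::
    "('n::finite, 'k::field) mpoly set \<Rightarrow> nat list \<Rightarrow> nat list \<Rightarrow> ('n, 'k) mpoly list \<Rightarrow> bool" where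
  "type_witness I a b hs \<longleftrightarrow>
     length hs = length a \<and> regular_seq hs \<and>
     (\<forall>k < length a. hs ! k \<in> I \<inter> forms (alpha I + a ! k)) \<and>
     sorted (map (\<lambda>c. alpha I + c) a) \<and>
     (\<forall>j < length b. has_minimal_generators I (alpha I + j) (b ! j))"

definition type_gamma :: "('n::finite, 'k::field) mpoly set \<Rightarrow> nat list \<Rightarrow> nat \<Rightarrow> nat" where
  "type_gamma I a d =
     (if d < alpha I + a ! 0 then 0
      else Max {i \<in> {1..length a}. alpha I + a ! (i - 1) \<le> d})"

definition rho :: "('n::finite, 'k::field) mpoly set \<Rightarrow> nat \<Rightarrow> nat" where
  "rho I i = (LEAST d. \<exists>hs. regular_seq hs \<and> length hs = i \<and> set hs \<subseteq> I \<inter> forms d)"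

definition lambda_len :: "('n::finite, 'k::field) mpoly set \<Rightarrow> nat \<Rightarrow> nat" where
  "lambda_len I d = Max {length hs | hs. regular_seq hs \<and> set hs \<subseteq> I \<inter> forms d}"

definition of_minimal_type ::
    "('n::finite, 'k::field) mpoly set \<Rightarrow> nat list \<Rightarrow> nat list \<Rightarrow> bool" where
  "of_minimal_type I a b \<longleftrightarrow>
     (\<exists>hs. type_witness I a b hs \<and>
           (\<exists>G. minimal_generating_set I G \<and> set hs \<subseteq> G) \<and>
           (\<forall>i \<in> {1..length a}. rho I i = alpha I + a ! (i - 1)) \<and>
           (\<forall>d. lambda_len I d = type_gamma I a d))"

definition residue_class :: "'a::comm_ring_1 set \<Rightarrow> 'a \<Rightarrow> 'a set" where
  "residue_class Q p = {q. q - p \<in> Q}"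

definition quotient_part :: "('n::finite, 'k::field) mpoly set \<Rightarrow> nat \<Rightarrow> ('n, 'k) mpoly set set" where
  "quotient_part Q d = residue_class Q ` forms d"

text \<open>
  Multiplication by \<open>f\<close> on residue classes; on the class of \<open>p\<close> the union is the single
  class of \<open>f * p\<close>.
\<close>

definition quotient_mult :: "'a::comm_ring_1 set \<Rightarrow> 'a \<Rightarrow> 'a set \<Rightarrow> 'a set" where
  "quotient_mult Q f X = (\<Union>p\<in>X. residue_class Q (f * p))"

definition weak_lefschetz_element ::
    "('n::finite, 'k::field) mpoly set \<Rightarrow> ('n, 'k) mpoly \<Rightarrow> nat \<Rightarrow> bool" where
  "weak_lefschetz_element Q f d \<longleftrightarrow>
     inj_on (quotient_mult Q f) (quotient_part Q d) \<or>
     quotient_mult Q f ` quotient_part Q d = quotient_part Q (d + 1)"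

definition WLP_in_degrees :: "('n::finite, 'k::field) mpoly set \<Rightarrow> nat set \<Rightarrow> bool" where
  "WLP_in_degrees Q S \<longleftrightarrow> (\<exists>f \<in> forms 1. \<forall>d \<in> S. weak_lefschetz_element Q f d)"

end

theory Submission
  imports Defs "HOL-Computational_Algebra.Polynomial" "HOL-Library.FuncSet"
begin

text \<open>
  The theorem holds because multiplication by a suitable linear form is injective in every
  degree below \<open>\<alpha>(I) + t\<close>. The number of generators of \<open>I\<close> of degree at most \<open>\<alpha>(I) + t\<close> is at
  most the sum of the \<open>b\<^sub>j\<close>, and generators of higher degree do not reach these degrees. Since the
  generators form a regular sequence, the coefficients of a relation between them lie in \<open>I\<close>.
  So the relevant generators \<open>h\<^sub>1, \<dots>, h\<^sub>r\<close> have no nonzero syzygy of total degree below \<open>\<alpha>(I)\<close>,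
  while the syzygies that could disturb injectivity have degree at most \<open>t\<close>. The question is
  whether a gap of this kind survives restriction to linear subspaces.

  The answer is the lemma \<open>ex_syzygy_free_line\<close>: for all \<open>l\<close> and \<open>m\<close> there is a \<open>D\<close> such that
  any \<open>l\<close> polynomials in \<open>n\<close> variables without nonzero syzygies of total degree at most \<open>D\<close>
  restrict to some affine line without nonzero syzygies of degree below \<open>m\<close>. Independent
  linear forms that vanish on the plane through the origin containing such a line serve as
  \<open>f\<^sub>n, \<dots>, f\<^sub>3\<close>, and \<open>f\<^sub>i\<close> is the weak Lefschetz element. Being free of
  syzygies of bounded degree is an open condition on the line, so every linear subspace that
  contains this plane inherits it (\<open>syzygy_free_on_subspace\<close>). If now \<open>f\<^sub>i g\<close> lies in
  \<open>I + (f\<^sub>n, \<dots>, f\<^sub>i\<^sub>+\<^sub>1)\<close>, then its coefficients with respect to the \<open>h\<^sub>k\<close> have degree at most \<open>t\<close>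
  and form a syzygy on the subspace \<open>f\<^sub>n = \<dots> = f\<^sub>i = 0\<close>. They vanish there, so \<open>f\<^sub>i\<close> can be
  cancelled (\<open>multiplication_injective\<close>).

  The lemma is proved by induction on \<open>l\<close>. Suppose that the restrictions of \<open>h\<^sub>0, \<dots>, h\<^sub>l\<close> to every
  line have a nonzero syzygy of degree below \<open>m\<close>, with \<open>m\<close> minimal. On a general line \<open>h\<^sub>0, \<dots>, h\<^sub>l\<^sub>-\<^sub>1\<close>
  have no syzygies of small degree, by induction, so that any two syzygies of small degree of
  \<open>h\<^sub>0, \<dots>, h\<^sub>l\<close> are proportional: eliminating \<open>h\<^sub>l\<close> from both leaves nothing.
  Now rotate a line about one of its points \<open>p\<close>, and differentiate its syzygy. The derivative
  fails to be a syzygy only by a term that is also produced by translating the line, up to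
  the factor \<open>s\<close>, the parameter on the line that is zero at \<open>p\<close>. The difference is a syzygy, so it
  is proportional to the original one; at \<open>s = 0\<close> this says that the value of the syzygy at \<open>p\<close>
  is proportional to its derivative along the rotation. In characteristic \<open>0\<close> its direction is
  therefore the same for all general lines through \<open>p\<close> (\<open>direction_independent_of_line\<close>).

  This gives a direction at every general point, which along every general line is that of a
  polynomial vector of degree below \<open>m\<close>. Linear algebra yields polynomials \<open>P\<^sub>0, \<dots>, P\<^sub>l\<close>, not all zero, of
  degree at most \<open>M\<close> in each of the \<open>n\<close> variables, that have this direction at the points of a grid
  of side \<open>M + m\<close>: there are \<open>(l + 1) (M + 1)\<^sup>n\<close> coefficients and \<open>l (M + m)\<^sup>n\<close> conditions, and \<open>M\<close>
  can be taken large in terms of \<open>l\<close>, \<open>m\<close> and \<open>n\<close>. On a coordinate line through grid points, the minors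
  of \<open>P\<close> and the syzygy of the line have degree below \<open>M + m\<close> and \<open>M + m\<close> zeros, so \<open>P\<close> has the right
  direction on the whole line; one coordinate at a time, this spreads to general points of the
  space (\<open>par_at_mixed_points\<close>). Hence \<open>P\<close> is a nonzero syzygy of the \<open>h\<^sub>i\<close> of total degree at most
  \<open>n M\<close>, which is impossible when \<open>D \<ge> n M\<close> (\<open>not_mpoly_syzygy_free\<close>).
\<close>

section \<open>Substitution into polynomials in finitely many variables\<close>

definition rhom :: "('a::comm_ring_1 \<Rightarrow> 'b::comm_ring_1) \<Rightarrow> bool" where
  "rhom f \<longleftrightarrow> f 1 = 1 \<and> (\<forall>a b. f (a + b) = f a + f b) \<and> (\<forall>a b. f (a * b) = f a * f b)"

lemma rhomI:
  assumes "f 1 = 1" "\<And>a b. f (a + b) = f a + f b" "\<And>a b. f (a * b) = f a * f b"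
  shows "rhom f"
  using assms by (simp add: rhom_def)

lemma rhom_one: "rhom f \<Longrightarrow> f 1 = 1"
  and rhom_add: "rhom f \<Longrightarrow> f (a + b) = f a + f b"
  and rhom_mult: "rhom f \<Longrightarrow> f (a * b) = f a * f b"
  by (simp_all add: rhom_def)

lemma rhom_zero: "rhom f \<Longrightarrow> f 0 = 0"
  using rhom_add[of f 0 0] by simp

lemma rhom_minus: "rhom f \<Longrightarrow> f (a - b) = f a - f b"
  using rhom_add[of f "a - b" b] by (simp add: algebra_simps)

lemma rhom_sum: "rhom f \<Longrightarrow> f (sum g A) = (\<Sum>x\<in>A. f (g x))"
  by (induction A rule: infinite_finite_induct) (simp_all add: rhom_zero rhom_add)

lemma rhom_prod: "rhom f \<Longrightarrow> f (prod g A) = (\<Prod>x\<in>A. f (g x))"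
  by (induction A rule: infinite_finite_induct) (simp_all add: rhom_one rhom_mult)

lemma rhom_power: "rhom f \<Longrightarrow> f (a ^ k) = f a ^ k"
  by (induction k) (simp_all add: rhom_one rhom_mult)

lemmas rhom_simps = rhom_zero rhom_one rhom_add rhom_mult rhom_minus rhom_sum rhom_prod rhom_power

lemma rhom_comp: "rhom f \<Longrightarrow> rhom g \<Longrightarrow> rhom (\<lambda>x. f (g x))"
  by (simp add: rhom_def)

definition cst :: "'k::field \<Rightarrow> ('n::finite, 'k) mpoly" where
  "cst c = Poly_Mapping.single 0 c"

definition X :: "'n \<Rightarrow> ('n::finite, 'k::field) mpoly" where
  "X j = Poly_Mapping.single (Poly_Mapping.single j 1) 1"

lemma rhom_cst: "rhom cst"
  by (rule rhomI) (simp_all add: cst_def single_add mult_single)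

lemma X_power: "X j ^ k = Poly_Mapping.single (Poly_Mapping.single j k) 1"
  by (induction k) (simp_all add: X_def mult_single flip: single_add)

lemma prod_X_power:
  "finite A \<Longrightarrow> (\<Prod>j\<in>A. X j ^ e j) = Poly_Mapping.single (\<Sum>j\<in>A. Poly_Mapping.single j (e j)) 1"
  by (induction A rule: finite_induct) (simp_all add: X_power mult_single)

lemma single_eq_monomial:
  "Poly_Mapping.single m c = cst c * (\<Prod>j\<in>UNIV. X j ^ Poly_Mapping.lookup m j)"
proof -
  have "(\<Sum>j\<in>UNIV. Poly_Mapping.single j (Poly_Mapping.lookup m j)) = m"
    by (rule poly_mapping_eqI) (simp add: lookup_sum lookup_single when_def)
  then show ?thesis by (simp add: prod_X_power cst_def mult_single)
qed

lemma sum_singles: "p = (\<Sum>m\<in>Poly_Mapping.keys p. Poly_Mapping.single m (Poly_Mapping.lookup p m))"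
  by (rule poly_mapping_eqI) (simp add: lookup_sum lookup_single when_def in_keys_iff)

text \<open>
  Identities between ring homomorphisms, or between derivations, need to be checked on constants
  and variables only; this rule makes that precise.
\<close>

lemma mpoly_induct [case_names cst X add mult]:
  fixes P :: "('n::finite, 'k::field) mpoly \<Rightarrow> bool"
  assumes "\<And>c. P (cst c)" "\<And>j. P (X j)" "\<And>p q. P p \<Longrightarrow> P q \<Longrightarrow> P (p + q)"
    "\<And>p q. P p \<Longrightarrow> P q \<Longrightarrow> P (p * q)"
  shows "P p"
proof -
  have zero: "P 0" and one: "P 1"
    using assms(1)[of 0] assms(1)[of 1] by (simp_all add: rhom_simps[OF rhom_cst])
  have pow: "P (X j ^ k)" for j k
    by (induction k) (use one assms in auto)
  have prd: "P (\<Prod>j\<in>A. X j ^ e j)" if "finite A" for A e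
    using that by (induction A rule: finite_induct) (use one pow assms in auto)
  have sm: "P (\<Sum>m\<in>A. f m)" if "finite A" "\<And>m. P (f m)" for A and f :: "_ \<Rightarrow> ('n, 'k) mpoly"
    using that by (induction A rule: finite_induct) (use zero assms in auto)
  have "P (Poly_Mapping.single m c)" for m c
    unfolding single_eq_monomial[of m c] using prd assms by auto
  then show ?thesis by (subst sum_singles) (rule sm, simp_all)
qed

text \<open>
  The one construction behind evaluation, restriction to a line, families of lines and linear
  changes of coordinates; they differ in the target ring and in the map \<open>\<kappa>\<close> on constants.
\<close>

definition psubst :: "('k::field \<Rightarrow> 'b::comm_ring_1) \<Rightarrow> ('n::finite \<Rightarrow> 'b) \<Rightarrow> ('n, 'k) mpoly \<Rightarrow> 'b" where
  "psubst \<kappa> \<phi> p = (\<Sum>m\<in>Poly_Mapping.keys p.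
     \<kappa> (Poly_Mapping.lookup p m) * (\<Prod>j\<in>UNIV. \<phi> j ^ Poly_Mapping.lookup m j))"

lemma psubst_superset:
  assumes "rhom \<kappa>" "finite S" "Poly_Mapping.keys p \<subseteq> S"
  shows "psubst \<kappa> \<phi> p = (\<Sum>m\<in>S. \<kappa> (Poly_Mapping.lookup p m) * (\<Prod>j\<in>UNIV. \<phi> j ^ Poly_Mapping.lookup m j))"
  unfolding psubst_def using assms
  by (intro sum.mono_neutral_left) (auto simp: in_keys_iff rhom_zero)

lemma psubst_single:
  "rhom \<kappa> \<Longrightarrow> psubst \<kappa> \<phi> (Poly_Mapping.single m c) = \<kappa> c * (\<Prod>j\<in>UNIV. \<phi> j ^ Poly_Mapping.lookup m j)"
  by (simp add: psubst_def rhom_zero)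

lemma psubst_add:
  assumes "rhom \<kappa>" shows "psubst \<kappa> \<phi> (p + q) = psubst \<kappa> \<phi> p + psubst \<kappa> \<phi> q"
proof -
  let ?S = "Poly_Mapping.keys p \<union> Poly_Mapping.keys q"
  show ?thesis
    using assms keys_add[of p q]
    by (simp add: psubst_superset[of \<kappa> ?S] lookup_add rhom_add distrib_right sum.distrib)
qed

lemma psubst_sum:
  assumes "rhom \<kappa>" shows "psubst \<kappa> \<phi> (sum f A) = (\<Sum>x\<in>A. psubst \<kappa> \<phi> (f x))"
  by (induction A rule: infinite_finite_induct) (simp_all add: psubst_add assms, simp_all add: psubst_def)

lemma rhom_psubst:
  assumes "rhom \<kappa>" shows "rhom (psubst \<kappa> \<phi>)"
proof (rule rhomI)
  show "psubst \<kappa> \<phi> 1 = 1"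
    using psubst_single[OF assms, of \<phi> 0 1] by (simp add: rhom_one assms)
  show "psubst \<kappa> \<phi> (p + q) = psubst \<kappa> \<phi> p + psubst \<kappa> \<phi> q" for p q
    by (rule psubst_add[OF assms])
  have sing: "psubst \<kappa> \<phi> (Poly_Mapping.single m a * Poly_Mapping.single m' b)
      = psubst \<kappa> \<phi> (Poly_Mapping.single m a) * psubst \<kappa> \<phi> (Poly_Mapping.single m' b)" for m m' a b
  proof -
    have "(\<Prod>j\<in>UNIV. \<phi> j ^ Poly_Mapping.lookup (m + m') j)
        = (\<Prod>j\<in>UNIV. \<phi> j ^ Poly_Mapping.lookup m j) * (\<Prod>j\<in>UNIV. \<phi> j ^ Poly_Mapping.lookup m' j)"
      by (simp add: lookup_add power_add prod.distrib)
    then show ?thesis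
      unfolding mult_single psubst_single[OF assms] rhom_mult[OF assms] by (simp only: mult_ac)
  qed
  show "psubst \<kappa> \<phi> (p * q) = psubst \<kappa> \<phi> p * psubst \<kappa> \<phi> q" for p q
  proof -
    have "psubst \<kappa> \<phi> (sum f A * sum g B) = psubst \<kappa> \<phi> (sum f A) * psubst \<kappa> \<phi> (sum g B)"
      if "\<And>a b. psubst \<kappa> \<phi> (f a * g b) = psubst \<kappa> \<phi> (f a) * psubst \<kappa> \<phi> (g b)" for f g A B
      by (simp only: sum_product psubst_sum[OF assms] that)
    from this[of "\<lambda>m. Poly_Mapping.single m (Poly_Mapping.lookup p m)"
        "\<lambda>m. Poly_Mapping.single m (Poly_Mapping.lookup q m)"
        "Poly_Mapping.keys p" "Poly_Mapping.keys q", OF sing]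
    show ?thesis unfolding sum_singles[symmetric] .
  qed
qed

lemma psubst_cst: "rhom \<kappa> \<Longrightarrow> psubst \<kappa> \<phi> (cst c) = \<kappa> c"
  by (simp add: cst_def psubst_single)

lemma psubst_X:
  fixes j :: "'n::finite"
  assumes "rhom \<kappa>" shows "psubst \<kappa> \<phi> (X j) = \<phi> j"
proof -
  have "(\<Prod>i\<in>UNIV. \<phi> i ^ Poly_Mapping.lookup (Poly_Mapping.single j 1) i) = (\<Prod>i\<in>UNIV. if i = j then \<phi> i else 1)"
    by (rule prod.cong) (auto simp: lookup_single when_def)
  then show ?thesis by (simp add: X_def psubst_single assms rhom_one)
qed

lemma rhom_eqI:
  assumes "rhom f" "rhom g" "\<And>c. f (cst c) = g (cst c)" "\<And>j. f (X j) = g (X j)"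
  shows "f p = g p"
  by (induction p rule: mpoly_induct) (simp_all add: assms rhom_simps)

lemma rhom_id: "rhom (\<lambda>c. c)"
  by (rule rhomI) simp_all

definition ev :: "('n::finite \<Rightarrow> 'k::field) \<Rightarrow> ('n, 'k) mpoly \<Rightarrow> 'k" where
  "ev x = psubst (\<lambda>c. c) x"

lemma rhom_ev: "rhom (ev x)"
  unfolding ev_def by (rule rhom_psubst[OF rhom_id])

lemma ev_cst [simp]: "ev x (cst c) = c"
  and ev_X [simp]: "ev x (X j) = x j"
  by (simp_all add: ev_def psubst_cst psubst_X rhom_id)

lemmas ev_simps [simp] = rhom_simps[OF rhom_ev]

subsection \<open>Polynomials as functions\<close>

text \<open>
  Only the exponents at the variables in \<open>A\<close> matter, which is what the induction on \<open>A\<close> needs: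
  fixing all variables but one leaves a polynomial in one variable with infinitely many zeros, so its
  coefficients, which are sums over fewer variables, vanish.
\<close>

lemma monomial_functions_independent:
  fixes u :: "('n \<Rightarrow> nat) \<Rightarrow> 'k::field_char_0"
  assumes "finite A" "finite S" "\<And>m m'. m \<in> S \<Longrightarrow> m' \<in> S \<Longrightarrow> \<forall>j\<in>A. m j = m' j \<Longrightarrow> m = m'"
    and "\<And>x. (\<Sum>m\<in>S. u m * (\<Prod>j\<in>A. x j ^ m j)) = 0" and "m \<in> S"
  shows "u m = 0"
  using assms
proof (induction A arbitrary: S m rule: finite_induct)
  case empty
  then have "S = {m}" by auto
  with empty show ?case by simp
next
  case (insert i A)
  define Si where "Si = {m' \<in> S. m' i = m i}"
  show ?case
  proof (rule insert.IH)
    show "finite Si" "m \<in> Si" using insert by (auto simp: Si_def)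
    show "m1 = m2" if "m1 \<in> Si" "m2 \<in> Si" "\<forall>j\<in>A. m1 j = m2 j" for m1 m2
      using that by (intro insert.prems) (auto simp: Si_def)
    show "(\<Sum>m\<in>Si. u m * (\<Prod>j\<in>A. x j ^ m j)) = 0" for x
    proof -
      define P where "P = (\<Sum>m\<in>S. monom (u m * (\<Prod>j\<in>A. x j ^ m j)) (m i))"
      have "poly P z = 0" for z
      proof -
        have "u m * (\<Prod>j\<in>A. x j ^ m j) * z ^ m i = u m * (\<Prod>j\<in>insert i A. (x(i := z)) j ^ m j)" for m
        proof -
          have "(\<Prod>j\<in>A. (x(i := z)) j ^ m j) = (\<Prod>j\<in>A. x j ^ m j)"
            using insert.hyps by (intro prod.cong) auto
          then show ?thesis by (simp only: prod.insert[OF insert.hyps] fun_upd_same mult_ac)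
        qed
        then have "poly P z = (\<Sum>m\<in>S. u m * (\<Prod>j\<in>insert i A. (x(i := z)) j ^ m j))"
          by (simp only: P_def poly_sum poly_monom)
        then show ?thesis by (simp only: insert.prems(3))
      qed
      then have "P = 0" using poly_all_0_iff_0 by blast
      then have "coeff P (m i) = 0" by simp
      then have "(\<Sum>m'\<in>S. if m' i = m i then u m' * (\<Prod>j\<in>A. x j ^ m' j) else 0) = 0"
        by (simp add: P_def coeff_sum)
      then show ?thesis
        using insert.prems by (simp add: Si_def sum.inter_filter)
    qed
  qed
qed

lemma ev_eq_0_imp_eq_0:
  fixes p :: "('n::finite, 'k::field_char_0) mpoly"
  assumes "\<And>x. ev x p = 0" shows "p = 0"
proof -
  let ?K = "Poly_Mapping.keys p"
  have inj: "inj_on Poly_Mapping.lookup ?K" by (simp add: inj_on_def)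
  have "Poly_Mapping.lookup p m = 0" if "m \<in> ?K" for m
  proof -
    have "Poly_Mapping.lookup p (Poly_Mapping.Abs_poly_mapping (Poly_Mapping.lookup m)) = 0"
    proof (rule monomial_functions_independent[where A = UNIV and S = "Poly_Mapping.lookup ` ?K"
          and u = "\<lambda>e. Poly_Mapping.lookup p (Poly_Mapping.Abs_poly_mapping e)"])
      show "(\<Sum>e\<in>Poly_Mapping.lookup ` ?K. Poly_Mapping.lookup p (Poly_Mapping.Abs_poly_mapping e) *
          (\<Prod>j\<in>UNIV. x j ^ e j)) = 0" for x
        using assms[of x] by (simp add: sum.reindex[OF inj] ev_def psubst_def lookup_inverse)
    qed (use that in \<open>auto simp: fun_eq_iff\<close>)
    then show ?thesis by (simp add: lookup_inverse)
  qed
  then show ?thesis by (intro poly_mapping_eqI) (auto simp: in_keys_iff)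
qed

section \<open>Syzygies of bounded degree of univariate polynomials\<close>

text \<open>
  Degree less than \<open>m\<close>. Unlike a condition on \<open>degree\<close>, this is a condition on coefficients, it admits
  \<open>0\<close> for every \<open>m\<close>, and for \<open>m = 0\<close> it admits nothing else.
\<close>

definition low :: "nat \<Rightarrow> 'a::zero poly \<Rightarrow> bool" where
  "low m c \<longleftrightarrow> (\<forall>k\<ge>m. coeff c k = 0)"

lemma low_mono: "low m c \<Longrightarrow> m \<le> m' \<Longrightarrow> low m' c"
  by (simp add: low_def)

lemma low_0 [simp]: "low m 0"
  by (simp add: low_def)

lemma low_0_iff: "low 0 c \<longleftrightarrow> c = 0"
  by (auto simp: low_def poly_eq_iff)

lemma low_diff:
  fixes f g :: "'a::comm_ring_1 poly"
  shows "low m f \<Longrightarrow> low m g \<Longrightarrow> low m (f - g)"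
  by (simp add: low_def)

lemma low_mult:
  fixes f g :: "'a::comm_ring_1 poly"
  assumes "low (Suc m) f" "low m' g" shows "low (m + m') (f * g)"
  unfolding low_def
proof (intro allI impI)
  fix k assume "m + m' \<le> k"
  then have "coeff f i * coeff g (k - i) = 0" if "i \<le> k" for i
    using assms that by (cases "Suc m \<le> i") (auto simp: low_def)
  then show "coeff (f * g) k = 0" by (simp add: coeff_mult)
qed

lemma low_degree: "low (Suc (degree c)) c"
  by (simp add: low_def coeff_eq_0)

lemma degree_less_if_low:
  assumes "low m c" "c \<noteq> 0" shows "degree c < m"
proof (rule ccontr)
  assume "\<not> degree c < m"
  then have "lead_coeff c = 0" using assms(1) by (simp add: low_def)
  with assms(2) show False by simp
qed

lemma low_iff_degree: "low (Suc d) c \<longleftrightarrow> degree c \<le> d"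
proof
  assume "low (Suc d) c"
  then show "degree c \<le> d" using degree_less_if_low[of "Suc d" c] by (cases "c = 0") auto
next
  assume "degree c \<le> d"
  then show "low (Suc d) c" using low_mono[OF low_degree] by blast
qed

lemma low_sum_monom:
  assumes "low m c" shows "c = (\<Sum>k<m. monom (coeff c k) k)"
proof (rule poly_eqI)
  fix k
  show "coeff c k = coeff (\<Sum>k<m. monom (coeff c k) k) k"
    using assms by (cases "k < m") (simp_all add: coeff_sum low_def)
qed

definition syzygy :: "nat \<Rightarrow> nat \<Rightarrow> (nat \<Rightarrow> 'a::comm_ring_1 poly) \<Rightarrow> (nat \<Rightarrow> 'a poly) \<Rightarrow> bool" where
  "syzygy l m H c \<longleftrightarrow> (\<forall>i<l. low m (c i)) \<and> (\<Sum>i<l. c i * H i) = 0"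

definition syzygy_free :: "nat \<Rightarrow> nat \<Rightarrow> (nat \<Rightarrow> 'a::comm_ring_1 poly) \<Rightarrow> bool" where
  "syzygy_free l m H \<longleftrightarrow> (\<forall>c. syzygy l m H c \<longrightarrow> (\<forall>i<l. c i = 0))"

lemma syzygy_freeD: "syzygy_free l m H \<Longrightarrow> syzygy l m H c \<Longrightarrow> i < l \<Longrightarrow> c i = 0"
  by (auto simp: syzygy_free_def)

lemma syzygy_free_mono: "syzygy_free l m H \<Longrightarrow> m' \<le> m \<Longrightarrow> syzygy_free l m' H"
  unfolding syzygy_free_def syzygy_def using low_mono by blast

subsection \<open>Families of polynomials depending polynomially on a parameter\<close>

text \<open>
  In \<open>'k poly poly\<close> the outer variable is the parameter \<open>s\<close> on a line, and the inner variable \<open>T\<close>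
  moves the line.
\<close>

definition specialize :: "'k::field \<Rightarrow> 'k poly poly \<Rightarrow> 'k poly" where
  "specialize T = map_poly (\<lambda>r. poly r T)"

lemma coeff_specialize [simp]: "coeff (specialize T f) k = poly (coeff f k) T"
  by (simp add: specialize_def coeff_map_poly)

lemma rhom_specialize: "rhom (specialize T)"
  by (rule rhomI) (simp_all add: poly_eq_iff coeff_mult poly_sum when_def)

lemma low_specialize: "low m c \<Longrightarrow> low m (specialize T c)"
  by (simp add: low_def)

text \<open>
  Vectors of polynomials in \<open>T\<close> that are linearly dependent for infinitely many values of \<open>T\<close> are
  dependent over the polynomials in \<open>T\<close>. This is Gaussian elimination: a nonzero entry \<open>F i x\<^sub>0\<close> is
  used as a pivot without division, and only its finitely many roots are lost.
\<close>

lemma poly_family_dependent: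
  fixes F :: "'j \<Rightarrow> 'x \<Rightarrow> 'k::field poly"
  assumes "finite J"
    and "infinite {T. \<exists>a. (\<exists>j\<in>J. a j \<noteq> 0) \<and> (\<forall>x. (\<Sum>j\<in>J. a j * poly (F j x) T) = 0)}"
  shows "\<exists>r. (\<exists>j\<in>J. r j \<noteq> 0) \<and> (\<forall>x. (\<Sum>j\<in>J. r j * F j x) = 0)"
  using assms
proof (induction J arbitrary: F rule: finite_induct)
  case empty
  then show ?case by simp
next
  case (insert i J)
  show ?case
  proof (cases "\<forall>x. F i x = 0")
    case True
    have "(\<Sum>j\<in>insert i J. (if j = i then 1 else 0) * F j x) = 0" for x
      using True by (intro sum.neutral) auto
    then show ?thesis by (intro exI[of _ "\<lambda>j. if j = i then 1 else 0"]) auto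
  next
    case False
    then obtain x0 where x0: "F i x0 \<noteq> 0" by blast
    define F' where "F' j x = F i x0 * F j x - F j x0 * F i x" for j x
    let ?B = "\<lambda>F J. {T. \<exists>a. (\<exists>j\<in>J. a j \<noteq> 0) \<and> (\<forall>x. (\<Sum>j\<in>J. a j * poly (F j x) T) = 0)}"
    have sub: "?B F (insert i J) - {T. poly (F i x0) T = 0} \<subseteq> ?B F' J"
    proof
      fix T assume T: "T \<in> ?B F (insert i J) - {T. poly (F i x0) T = 0}"
      then obtain a where a: "\<exists>j\<in>insert i J. a j \<noteq> 0"
        and a0: "\<And>x. (\<Sum>j\<in>insert i J. a j * poly (F j x) T) = 0" by auto
      have rel: "(\<Sum>j\<in>J. a j * poly (F j x) T) = - a i * poly (F i x) T" for x
      proof -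
        have "a i * poly (F i x) T + (\<Sum>j\<in>J. a j * poly (F j x) T) = 0"
          using a0[of x] unfolding sum.insert[OF insert.hyps] .
        then show ?thesis by (metis add.commute eq_neg_iff_add_eq_0 mult_minus_left)
      qed
      have "\<exists>j\<in>J. a j \<noteq> 0"
      proof (rule ccontr)
        assume "\<not> ?thesis"
        then show False using a rel[of x0] T by auto
      qed
      moreover have "(\<Sum>j\<in>J. a j * poly (F' j x) T) = 0" for x
      proof -
        have "a j * poly (F' j x) T = poly (F i x0) T * (a j * poly (F j x) T)
            - poly (F i x) T * (a j * poly (F j x0) T)" for j
          unfolding F'_def poly_diff poly_mult by (simp only: right_diff_distrib mult_ac)
        then have "(\<Sum>j\<in>J. a j * poly (F' j x) T) = poly (F i x0) T * (\<Sum>j\<in>J. a j * poly (F j x) T)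
            - poly (F i x) T * (\<Sum>j\<in>J. a j * poly (F j x0) T)"
          by (simp only: sum_subtractf sum_distrib_left)
        moreover have "u * (- b * v) - v * (- b * u) = 0" for u v b :: 'k by simp
        ultimately show ?thesis unfolding rel by (rule trans)
      qed
      ultimately show "T \<in> ?B F' J" by (intro CollectI exI[of _ a]) simp
    qed
    have "infinite (?B F (insert i J) - {T. poly (F i x0) T = 0})"
      by (rule Diff_infinite_finite[OF poly_roots_finite[OF x0] insert.prems])
    then have "infinite (?B F' J)" by (rule infinite_super[OF sub])
    from insert.IH[OF this] obtain r where r: "\<exists>j\<in>J. r j \<noteq> 0"
      and r0: "\<And>x. (\<Sum>j\<in>J. r j * F' j x) = 0" by (elim exE conjE) simp
    define r' where "r' j = (if j = i then - (\<Sum>j\<in>J. r j * F j x0) else r j * F i x0)" for j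
    have "(\<Sum>j\<in>insert i J. r' j * F j x) = 0" for x
    proof -
      have 1: "(\<Sum>j\<in>J. r' j * F j x) = (\<Sum>j\<in>J. r j * F i x0 * F j x)"
        using insert.hyps by (intro sum.cong) (auto simp: r'_def)
      have 2: "r' i = - (\<Sum>j\<in>J. r j * F j x0)" by (simp only: r'_def simp_thms if_True)
      have "(\<Sum>j\<in>insert i J. r' j * F j x) = (\<Sum>j\<in>J. r j * F i x0 * F j x) - F i x * (\<Sum>j\<in>J. r j * F j x0)"
        unfolding sum.insert[OF insert.hyps] 1 2 by (simp only: mult_minus_left uminus_add_conv_diff
            mult.commute[of "F i x" "\<Sum>j\<in>J. r j * F j x0"])
      also have "\<dots> = (\<Sum>j\<in>J. r j * F' j x)"
      proof -
        have "r j * F' j x = r j * F i x0 * F j x - F i x * (r j * F j x0)" for j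
          unfolding F'_def by (simp only: right_diff_distrib mult_ac)
        then show ?thesis by (simp only: sum_subtractf sum_distrib_left)
      qed
      finally show ?thesis by (simp add: r0)
    qed
    moreover have "\<exists>j\<in>insert i J. r' j \<noteq> 0"
      using r x0 insert.hyps by (auto simp: r'_def)
    ultimately show ?thesis by (intro exI[of _ r']) simp
  qed
qed

text \<open>
  A relation that vanishes at \<open>T\<close> can be divided by the linear factor with root \<open>T\<close>, so a relation
  of minimal degree vanishes nowhere.
\<close>

lemma nowhere_vanishing_relation:
  fixes F :: "'j \<Rightarrow> 'x \<Rightarrow> 'k::field poly"
  assumes "finite J" and "\<exists>j\<in>J. r j \<noteq> 0" and "\<forall>x. (\<Sum>j\<in>J. r j * F j x) = 0"
  shows "\<exists>r. (\<forall>T. \<exists>j\<in>J. poly (r j) T \<noteq> 0) \<and> (\<forall>x. (\<Sum>j\<in>J. r j * F j x) = 0)"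
  using assms
proof (induction "\<Sum>j\<in>J. degree (r j)" arbitrary: r rule: less_induct)
  case less
  show ?case
  proof (cases "\<forall>T. \<exists>j\<in>J. poly (r j) T \<noteq> 0")
    case True
    then show ?thesis using less.prems by blast
  next
    case False
    then obtain T where T: "\<forall>j\<in>J. poly (r j) T = 0" by blast
    define q where "q j = r j div [:-T, 1:]" for j
    have rq: "r j = [:-T, 1:] * q j" if "j \<in> J" for j
      using T that by (simp add: q_def poly_eq_0_iff_dvd del: mult_pCons_left)
    have deg: "degree (r j) = Suc (degree (q j))" if "j \<in> J" "r j \<noteq> 0" for j
    proof -
      have "q j \<noteq> 0" using rq[OF that(1)] that(2) by auto
      then show ?thesis using rq[OF that(1)] by (simp del: mult_pCons_left add: degree_mult_eq)
    qed
    obtain j0 where j0: "j0 \<in> J" "r j0 \<noteq> 0" using less.prems by blast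
    show ?thesis
    proof (rule less.hyps)
      show "(\<Sum>j\<in>J. degree (q j)) < (\<Sum>j\<in>J. degree (r j))"
      proof (rule sum_strict_mono_ex1)
        show "\<forall>j\<in>J. degree (q j) \<le> degree (r j)"
          using deg by (metis div_0 le_SucI order_refl q_def)
        show "\<exists>j\<in>J. degree (q j) < degree (r j)" using deg[OF j0] j0(1) by (metis lessI)
      qed (rule less.prems)
      show "\<exists>j\<in>J. q j \<noteq> 0" using rq j0 by force
      show "\<forall>x. (\<Sum>j\<in>J. q j * F j x) = 0"
      proof
        fix x
        have "[:-T, 1:] * (\<Sum>j\<in>J. q j * F j x) = (\<Sum>j\<in>J. r j * F j x)"
          unfolding sum_distrib_left by (intro sum.cong refl) (simp only: rq mult.assoc)
        also have "\<dots> = 0" using less.prems(3) by (rule allE)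
        finally show "(\<Sum>j\<in>J. q j * F j x) = 0"
          unfolding mult_eq_0_iff by (metis pCons_eq_0_iff one_neq_zero)
      qed
    qed (rule less.prems)
  qed
qed

text \<open>
  The syzygies of bounded degree are the linear relations between the shifts \<open>s\<^sup>k H\<^sub>i\<close>, so the two
  lemmas above give a syzygy that depends polynomially on \<open>T\<close> and is nonzero for every \<open>T\<close>.
\<close>

lemma syzygy_of_family:
  fixes H :: "nat \<Rightarrow> 'k::field poly poly"
  assumes "infinite {T. \<not> syzygy_free l m (\<lambda>i. specialize T (H i))}"
  obtains c where "syzygy l m H c" "\<And>T. \<exists>i<l. specialize T (c i) \<noteq> 0"
proof -
  define J where "J = {..<l} \<times> {..<m}"
  define F where "F = (\<lambda>(i, k) x. coeff (monom 1 k * H i) x)"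
  have fin: "finite J" by (simp add: J_def)
  have expand: "(\<Sum>i<l. c i * G i) = (\<Sum>i<l. \<Sum>k<m. monom (coeff (c i) k) k * G i)"
    if "\<forall>i<l. low m (c i)" for c G :: "nat \<Rightarrow> 'a::comm_ring_1 poly"
  proof (intro sum.cong refl)
    fix i assume "i \<in> {..<l}"
    then have "c i = (\<Sum>k<m. monom (coeff (c i) k) k)" using that low_sum_monom by blast
    from arg_cong[OF this, of "\<lambda>z. z * G i"]
    show "c i * G i = (\<Sum>k<m. monom (coeff (c i) k) k * G i)" by (simp only: sum_distrib_right)
  qed
  have "{T. \<not> syzygy_free l m (\<lambda>i. specialize T (H i))}
      \<subseteq> {T. \<exists>a. (\<exists>j\<in>J. a j \<noteq> 0) \<and> (\<forall>x. (\<Sum>j\<in>J. a j * poly (F j x) T) = 0)}"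
  proof
    fix T assume "T \<in> {T. \<not> syzygy_free l m (\<lambda>i. specialize T (H i))}"
    then obtain c i where c: "\<forall>i<l. low m (c i)" "(\<Sum>i<l. c i * specialize T (H i)) = 0" "i < l" "c i \<noteq> 0"
      by (auto simp: syzygy_free_def syzygy_def)
    define a where "a = (\<lambda>(i, k). coeff (c i) k)"
    have "\<exists>k<m. coeff (c i) k \<noteq> 0"
      using c by (metis low_def not_less poly_eq_iff coeff_0)
    then have "\<exists>j\<in>J. a j \<noteq> 0" using c by (auto simp: J_def a_def)
    moreover have "(\<Sum>j\<in>J. a j * poly (F j x) T) = 0" for x
    proof -
      have "(\<Sum>j\<in>J. a j * poly (F j x) T)
          = (\<Sum>i<l. \<Sum>k<m. coeff (monom (coeff (c i) k) k * specialize T (H i)) x)"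
        unfolding J_def sum.cartesian_product
        by (rule sum.cong) (auto simp: a_def F_def coeff_monom_mult)
      also have "\<dots> = coeff (\<Sum>i<l. c i * specialize T (H i)) x"
        by (simp add: expand[OF c(1)] coeff_sum)
      finally show ?thesis by (simp add: c)
    qed
    ultimately show "T \<in> {T. \<exists>a. (\<exists>j\<in>J. a j \<noteq> 0) \<and> (\<forall>x. (\<Sum>j\<in>J. a j * poly (F j x) T) = 0)}"
      by blast
  qed
  then have "infinite {T. \<exists>a. (\<exists>j\<in>J. a j \<noteq> 0) \<and> (\<forall>x. (\<Sum>j\<in>J. a j * poly (F j x) T) = 0)}"
    using assms infinite_super by blast
  from poly_family_dependent[OF fin this] nowhere_vanishing_relation[OF fin, of _ F]
  obtain r where nz: "\<And>T. \<exists>j\<in>J. poly (r j) T \<noteq> 0" and rel: "\<And>x. (\<Sum>j\<in>J. r j * F j x) = 0"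
    by blast
  define c where "c i = (\<Sum>k<m. monom (r (i, k)) k)" for i
  have coeff_c: "coeff (c i) k = (if k < m then r (i, k) else 0)" for i k
    by (auto simp: c_def coeff_sum)
  show thesis
  proof
    show "syzygy l m H c"
      unfolding syzygy_def
    proof (intro conjI allI impI)
      show "low m (c i)" for i by (simp add: low_def coeff_c)
      show "(\<Sum>i<l. c i * H i) = 0"
      proof (rule poly_eqI)
        fix x
        have "coeff (\<Sum>i<l. c i * H i) x = (\<Sum>i<l. \<Sum>k<m. coeff (monom (r (i, k)) k * H i) x)"
          by (simp add: c_def sum_distrib_right coeff_sum)
        also have "\<dots> = (\<Sum>j\<in>J. r j * F j x)"
          unfolding J_def sum.cartesian_product
          by (rule sum.cong) (auto simp: F_def coeff_monom_mult)
        finally show "coeff (\<Sum>i<l. c i * H i) x = coeff 0 x" by (simp add: rel)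
      qed
    qed
    show "\<exists>i<l. specialize T (c i) \<noteq> 0" for T
    proof -
      obtain i k where "i < l" "k < m" "poly (r (i, k)) T \<noteq> 0" using nz[of T] by (auto simp: J_def)
      then have "coeff (specialize T (c i)) k \<noteq> 0" by (simp add: coeff_c)
      with \<open>i < l\<close> show ?thesis by (metis coeff_0)
    qed
  qed
qed

lemma syzygy_specialize:
  assumes "syzygy l m H c" shows "syzygy l m (\<lambda>i. specialize T (H i)) (\<lambda>i. specialize T (c i))"
proof -
  have "specialize T (\<Sum>i<l. c i * H i) = 0"
    using assms by (simp add: syzygy_def rhom_zero[OF rhom_specialize])
  then show ?thesis
    using assms by (simp add: syzygy_def low_specialize rhom_simps[OF rhom_specialize])
qed

text \<open>
  Openness, as a statement on families with one parameter: one member without syzygies forces all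
  but finitely many members to have none. Several such conditions, each holding for some line, are
  combined by joining these lines by families.
\<close>

lemma syzygy_free_open:
  assumes "syzygy_free l m (\<lambda>i. specialize T0 (H i))"
  shows "finite {T. \<not> syzygy_free l m (\<lambda>i. specialize T (H i))}"
proof (rule ccontr)
  assume "\<not> ?thesis"
  then obtain c where c: "syzygy l m H c" "\<And>T. \<exists>i<l. specialize T (c i) \<noteq> 0"
    using syzygy_of_family by blast
  show False using syzygy_freeD[OF assms syzygy_specialize[OF c(1)]] c(2)[of T0] by blast
qed

section \<open>Restriction to lines\<close>

lemma rhom_pCons: "rhom (\<lambda>c. [:c:])"
  by (rule rhomI) (simp_all add: one_pCons)

lemma rhom_pCons2: "rhom (\<lambda>c. [:[:c:]:])"
  using rhom_comp[OF rhom_pCons rhom_pCons] .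

text \<open>
  The polynomial \<open>h(p + s q)\<close> in \<open>s\<close>.
\<close>

definition on_line :: "('n::finite \<Rightarrow> 'k::field) \<Rightarrow> ('n \<Rightarrow> 'k) \<Rightarrow> ('n, 'k) mpoly \<Rightarrow> 'k poly" where
  "on_line p q = psubst (\<lambda>c. [:c:]) (\<lambda>j. [:p j, q j:])"

lemma rhom_on_line: "rhom (on_line p q)"
  unfolding on_line_def by (rule rhom_psubst[OF rhom_pCons])

lemma on_line_cst [simp]: "on_line p q (cst c) = [:c:]"
  and on_line_X [simp]: "on_line p q (X j) = [:p j, q j:]"
  by (simp_all add: on_line_def psubst_cst psubst_X rhom_pCons)

lemma poly_on_line: "poly (on_line p q h) s = ev (\<lambda>j. p j + s * q j) h"
proof -
  have "rhom (\<lambda>h. poly (on_line p q h) s)"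
    by (rule rhomI) (simp_all add: rhom_simps[OF rhom_on_line])
  then show ?thesis by (rule rhom_eqI[OF _ rhom_ev]) simp_all
qed

lemma coeff_0_on_line: "coeff (on_line p q h) 0 = ev p h"
  using poly_on_line[of p q h 0] by (simp add: poly_0_coeff_0)

lemma on_line_translate:
  "on_line (\<lambda>j. p j + s * q j) q h = pcompose (on_line p q h) [:s, 1:]"
proof -
  have "rhom (\<lambda>h. pcompose (on_line p q h) [:s, 1:])"
    by (rule rhomI) (simp_all add: rhom_simps[OF rhom_on_line] pcompose_add pcompose_mult pcompose_1)
  then show ?thesis
    by (rule rhom_eqI[OF rhom_on_line]) (simp_all add: pcompose_pCons)
qed

lemma low_pcompose_linear: "low m c \<Longrightarrow> low m (pcompose c [:s, 1:])" for c :: "'k::field poly"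
  by (cases m) (simp_all add: low_0_iff low_iff_degree degree_pcompose)

lemma pcompose_linear_eq_0: "pcompose c [:s, 1:] = 0 \<longleftrightarrow> c = 0" for c :: "'k::field poly"
  by (rule pcompose_eq_0_iff) simp

lemma syzygy_translate:
  fixes h :: "nat \<Rightarrow> ('n::finite, 'k::field) mpoly"
  assumes "syzygy l m (\<lambda>i. on_line p q (h i)) c"
  shows "syzygy l m (\<lambda>i. on_line (\<lambda>j. p j + s * q j) q (h i)) (\<lambda>i. pcompose (c i) [:s, 1:])"
proof -
  have "pcompose (\<Sum>i<l. c i * on_line p q (h i)) [:s, 1:] = 0"
    using assms by (simp add: syzygy_def)
  then show ?thesis
    using assms
    by (simp add: syzygy_def low_pcompose_linear on_line_translate pcompose_sum pcompose_mult)
qed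

lemma syzygy_free_translate:
  fixes h :: "nat \<Rightarrow> ('n::finite, 'k::field) mpoly"
  assumes "syzygy_free l m (\<lambda>i. on_line p q (h i))"
  shows "syzygy_free l m (\<lambda>i. on_line (\<lambda>j. p j + s * q j) q (h i))"
  unfolding syzygy_free_def
proof (intro allI impI)
  fix c i assume c: "syzygy l m (\<lambda>i. on_line (\<lambda>j. p j + s * q j) q (h i)) c" and i: "i < l"
  from syzygy_translate[OF c, of "-s"]
  have "syzygy l m (\<lambda>i. on_line p q (h i)) (\<lambda>i. pcompose (c i) [:-s, 1:])"
    by (simp add: algebra_simps)
  from syzygy_freeD[OF assms this i] show "c i = 0" by (simp add: pcompose_linear_eq_0)
qed

text \<open>
  The polynomial \<open>h((p + T a) + s (q + T b))\<close> in \<open>s\<close> and \<open>T\<close>.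
\<close>

definition moving_line :: "('n::finite \<Rightarrow> 'k::field) \<Rightarrow> ('n \<Rightarrow> 'k) \<Rightarrow> ('n \<Rightarrow> 'k) \<Rightarrow> ('n \<Rightarrow> 'k)
    \<Rightarrow> ('n, 'k) mpoly \<Rightarrow> 'k poly poly" where
  "moving_line p a q b = psubst (\<lambda>c. [:[:c:]:]) (\<lambda>j. [:[:p j, a j:], [:q j, b j:]:])"

lemma rhom_moving_line: "rhom (moving_line p a q b)"
  unfolding moving_line_def by (rule rhom_psubst[OF rhom_pCons2])

lemma moving_line_cst [simp]: "moving_line p a q b (cst c) = [:[:c:]:]"
  and moving_line_X [simp]: "moving_line p a q b (X j) = [:[:p j, a j:], [:q j, b j:]:]"
  by (simp_all add: moving_line_def psubst_cst psubst_X rhom_pCons2)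

lemma specialize_pCons [simp]: "specialize T (pCons a f) = pCons (poly a T) (specialize T f)"
  by (rule poly_eqI) (simp add: coeff_pCons split: nat.split)

lemma specialize_0 [simp]: "specialize T 0 = 0"
  by (rule rhom_zero[OF rhom_specialize])

lemma specialize_moving_line:
  "specialize T (moving_line p a q b h) = on_line (\<lambda>j. p j + T * a j) (\<lambda>j. q j + T * b j) h"
  by (rule rhom_eqI[OF rhom_comp[OF rhom_specialize rhom_moving_line] rhom_on_line]) simp_all

lemma syzygy_free_line_open:
  fixes h :: "nat \<Rightarrow> ('n::finite, 'k::field) mpoly"
  assumes "syzygy_free l m (\<lambda>i. on_line (\<lambda>j. p j + T0 * a j) (\<lambda>j. q j + T0 * b j) (h i))"
  shows "finite {T. \<not> syzygy_free l m (\<lambda>i. on_line (\<lambda>j. p j + T * a j) (\<lambda>j. q j + T * b j) (h i))}"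
  using syzygy_free_open[of l m T0 "\<lambda>i. moving_line p a q b (h i)"] assms
  by (simp add: specialize_moving_line)

subsection \<open>First order deformations of lines\<close>

text \<open>
  The derivative with respect to \<open>T\<close>, taken at one value of \<open>T\<close>.
\<close>

definition der :: "'k::field \<Rightarrow> 'k poly poly \<Rightarrow> 'k poly" where
  "der T = map_poly (\<lambda>r. poly (pderiv r) T)"

lemma coeff_der [simp]: "coeff (der T f) k = poly (pderiv (coeff f k)) T"
  by (simp add: der_def coeff_map_poly)

lemma der_add: "der T (f + g) = der T f + der T g"
  by (rule poly_eqI) (simp add: pderiv_add)

lemma der_0 [simp]: "der T 0 = 0"
  by (rule poly_eqI) simp

lemma der_sum: "der T (sum f A) = (\<Sum>x\<in>A. der T (f x))"
  by (induction A rule: infinite_finite_induct) (simp_all add: der_add)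

lemma der_mult: "der T (f * g) = der T f * specialize T g + specialize T f * der T g"
proof (rule poly_eqI)
  fix k
  have "poly (pderiv (coeff f i * coeff g (k - i))) T
      = coeff (der T f) i * coeff (specialize T g) (k - i) + coeff (specialize T f) i * coeff (der T g) (k - i)" for i
    by (simp add: pderiv_mult)
  moreover have "coeff (der T (f * g)) k = (\<Sum>i\<le>k. poly (pderiv (coeff f i * coeff g (k - i))) T)"
    by (simp add: coeff_mult higher_pderiv_sum[of 1, simplified] poly_sum)
  ultimately show "coeff (der T (f * g)) k = coeff (der T f * specialize T g + specialize T f * der T g) k"
    by (simp add: coeff_mult sum.distrib)
qed

lemma low_der: "low m c \<Longrightarrow> low m (der T c)"
  by (simp add: low_def)

text \<open>
  Rotating the line about the point with \<open>s = 0\<close> moves the point with parameter \<open>s\<close> with velocity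
  \<open>s v\<close>, whereas a translation moves it with velocity \<open>v\<close>. Both sides are derivations along the same
  restriction map, so comparing them on variables is enough.
\<close>

lemma der_rotation_eq:
  "der T (moving_line p (\<lambda>_. 0) q v h)
     = [:0, 1:] * der 0 (moving_line p v (\<lambda>j. q j + T * v j) (\<lambda>_. 0) h)"
proof (induction h rule: mpoly_induct)
  case (cst c)
  then show ?case by (auto simp: poly_eq_iff coeff_pCons split: nat.split)
next
  case (X j)
  then show ?case by (auto simp: poly_eq_iff coeff_pCons pderiv_pCons split: nat.split)
next
  case (add h1 h2)
  then show ?case by (simp only: rhom_add[OF rhom_moving_line] der_add distrib_left)
next
  case (mult h1 h2)
  then show ?case
    by (simp only: rhom_mult[OF rhom_moving_line] der_mult specialize_moving_line)
      (simp add: algebra_simps)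
qed

section \<open>The syzygy direction at a point\<close>

text \<open>
  Proportionality of two vectors with entries \<open>0, \<dots>, l\<close>, by the vanishing of all \<open>2 \<times> 2\<close> minors. The
  zero vector is proportional to everything, hence the nonvanishing condition in \<open>par_trans\<close>.
\<close>

definition par :: "nat \<Rightarrow> (nat \<Rightarrow> 'a::comm_ring_1) \<Rightarrow> (nat \<Rightarrow> 'a) \<Rightarrow> bool" where
  "par l u v \<longleftrightarrow> (\<forall>i\<le>l. \<forall>j\<le>l. u i * v j = u j * v i)"

lemma parD: "par l u v \<Longrightarrow> i \<le> l \<Longrightarrow> j \<le> l \<Longrightarrow> u i * v j = u j * v i"
  by (simp add: par_def)

lemma par_sym: "par l u v \<Longrightarrow> par l v u"
  by (simp add: par_def mult.commute)

lemma par_trans: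
  fixes u v w :: "nat \<Rightarrow> 'a::idom"
  assumes "par l u v" "par l v w" "k \<le> l" "v k \<noteq> 0"
  shows "par l u w"
  unfolding par_def
proof (intro allI impI)
  fix i j assume ij: "i \<le> l" "j \<le> l"
  have "v k * v k * (u i * w j) = (u i * v k) * (v k * w j)" by (simp only: mult_ac)
  also have "\<dots> = (u k * v i) * (v j * w k)"
    using parD[OF assms(1) ij(1) assms(3)] parD[OF assms(2) assms(3) ij(2)] by (simp only:)
  also have "\<dots> = (u k * v j) * (v i * w k)" by (simp only: mult_ac)
  also have "\<dots> = (u j * v k) * (v k * w i)"
    using parD[OF assms(1) ij(2) assms(3)] parD[OF assms(2) assms(3) ij(1)] by (simp only:)
  also have "\<dots> = v k * v k * (u j * w i)" by (simp only: mult_ac)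
  finally show "u i * w j = u j * w i" using assms(4) by (simp only: mult_cancel_left mult_eq_0_iff) simp
qed

text \<open>
  If both polynomials are nonzero, comparing leading coefficients shows that they have equal degrees
  (here the characteristic must be \<open>0\<close>). The combination \<open>\<psi>\<close> that cancels the leading terms has zero
  Wronskian with \<open>g\<close> as well but a smaller degree, so it is zero.
\<close>

lemma proportional_if_wronskian_0:
  fixes f g :: "'k::field_char_0 poly"
  assumes "f * pderiv g = g * pderiv f"
  shows "poly f a * poly g b = poly g a * poly f b"
proof (cases "f = 0 \<or> g = 0")
  case True
  then show ?thesis by auto
next
  case False
  have eq_deg: "degree \<psi> = degree g"
    if "\<psi> * pderiv g = g * pderiv \<psi>" "\<psi> \<noteq> 0" for \<psi> :: "'k poly"
  proof -
    have lead: "coeff (u * pderiv v) (degree u + (degree v - 1)) = of_nat (degree v) * lead_coeff u * lead_coeff v"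
      for u v :: "'k poly"
    proof (cases "degree v = 0")
      case True
      then have "pderiv v = 0" by (simp add: pderiv_eq_0_iff)
      then show ?thesis using True by simp
    next
      case False
      have "coeff (u * pderiv v) (degree u + degree (pderiv v)) = lead_coeff u * lead_coeff (pderiv v)"
        by (rule coeff_mult_degree_sum)
      then show ?thesis using False by (simp add: degree_pderiv coeff_pderiv)
    qed
    show ?thesis
    proof (cases "degree \<psi> = 0 \<or> degree g = 0")
      case True
      then have "pderiv \<psi> = 0 \<or> pderiv g = 0" by (auto simp: pderiv_eq_0_iff)
      then have "pderiv \<psi> = 0 \<and> pderiv g = 0" using that False by auto
      then show ?thesis by (simp add: pderiv_eq_0_iff)
    next
      case nz: False
      then have "degree \<psi> + (degree g - 1) = degree g + (degree \<psi> - 1)" by auto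
      then have "of_nat (degree g) * lead_coeff \<psi> * lead_coeff g
          = of_nat (degree \<psi>) * lead_coeff g * lead_coeff \<psi>"
        using lead[of \<psi> g] lead[of g \<psi>] that(1) by simp
      then have "of_nat (degree g) * (lead_coeff \<psi> * lead_coeff g)
          = of_nat (degree \<psi>) * (lead_coeff \<psi> * lead_coeff g)"
        by (simp only: mult_ac)
      moreover have "lead_coeff \<psi> * lead_coeff g \<noteq> 0"
        using False that(2) by simp
      ultimately have "(of_nat (degree g) :: 'k) = of_nat (degree \<psi>)"
        by (simp only: mult_cancel_right) simp
      then show ?thesis by simp
    qed
  qed
  define \<psi> where "\<psi> = smult (lead_coeff g) f - smult (lead_coeff f) g"
  have "\<psi> = 0"
  proof (rule ccontr)
    assume nz: "\<psi> \<noteq> 0"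
    have "\<psi> * pderiv g = g * pderiv \<psi>"
      using assms by (simp add: \<psi>_def pderiv_diff pderiv_smult algebra_simps)
    then have deg: "degree \<psi> = degree g" using eq_deg nz by blast
    moreover have "degree f = degree g" using eq_deg[OF assms] False by blast
    ultimately have "lead_coeff \<psi> = 0" by (simp add: \<psi>_def)
    with nz show False by simp
  qed
  then have "lead_coeff g * poly f x = lead_coeff f * poly g x" for x
    by (simp add: \<psi>_def flip: poly_smult)
  then have eq: "poly f x = lead_coeff f / lead_coeff g * poly g x" for x
    using False by (simp add: field_simps)
  show ?thesis unfolding eq by (simp only: mult_ac)
qed

text \<open>
  The situation to be refuted: \<open>m\<close> is the least bound for which no line is free of syzygies of
  \<open>h\<^sub>0, \<dots>, h\<^sub>l\<close>, and the induction hypothesis provides a line for \<open>h\<^sub>0, \<dots>, h\<^sub>l\<^sub>-\<^sub>1\<close>. The bound \<open>3 m\<close>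
  is what the elimination of \<open>h\<^sub>l\<close> from syzygies of degrees below \<open>m\<close> and below \<open>2 m\<close> requires.
\<close>

locale every_line_has_syzygy =
  fixes h :: "nat \<Rightarrow> ('n::finite, 'k::field_char_0) mpoly" and l m :: nat
  assumes m_pos: "0 < m"
    and not_free: "\<not> syzygy_free (Suc l) m (\<lambda>i. on_line p q (h i))"
    and ex_minimal: "\<exists>p q. syzygy_free (Suc l) (m - 1) (\<lambda>i. on_line p q (h i))"
    and ex_free: "\<exists>p q. syzygy_free l (3 * m) (\<lambda>i. on_line p q (h i))"
begin

definition good :: "('n \<Rightarrow> 'k) \<Rightarrow> ('n \<Rightarrow> 'k) \<Rightarrow> bool" where
  "good p q \<longleftrightarrow> syzygy_free (Suc l) (m - 1) (\<lambda>i. on_line p q (h i)) \<and>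
     syzygy_free l (3 * m) (\<lambda>i. on_line p q (h i))"

definition line_syzygy :: "('n \<Rightarrow> 'k) \<Rightarrow> ('n \<Rightarrow> 'k) \<Rightarrow> (nat \<Rightarrow> 'k poly) \<Rightarrow> bool" where
  "line_syzygy p q c \<longleftrightarrow> syzygy (Suc l) m (\<lambda>i. on_line p q (h i)) c \<and> (\<exists>i\<le>l. c i \<noteq> 0)"

lemma ex_line_syzygy: "\<exists>c. line_syzygy p q c"
  using not_free[of p q] by (auto simp: syzygy_free_def line_syzygy_def less_Suc_eq_le)

lemma good_open:
  assumes "good (\<lambda>j. p j + T0 * a j) (\<lambda>j. q j + T0 * b j)"
  shows "finite {T. \<not> good (\<lambda>j. p j + T * a j) (\<lambda>j. q j + T * b j)}"
proof -
  have "finite ({T. \<not> syzygy_free (Suc l) (m - 1) (\<lambda>i. on_line (\<lambda>j. p j + T * a j) (\<lambda>j. q j + T * b j) (h i))}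
      \<union> {T. \<not> syzygy_free l (3 * m) (\<lambda>i. on_line (\<lambda>j. p j + T * a j) (\<lambda>j. q j + T * b j) (h i))})"
    using assms unfolding good_def by (intro finite_UnI syzygy_free_line_open[of _ _ _ T0]) simp_all
  then show ?thesis by (rule rev_finite_subset) (auto simp: good_def)
qed

text \<open>
  Each of the two conditions holds on some line; on the straight path from one of these lines to
  the other, each fails only finitely often.
\<close>

lemma ex_good: "\<exists>p q. good p q"
proof -
  obtain p q where 1: "syzygy_free (Suc l) (m - 1) (\<lambda>i. on_line p q (h i))" using ex_minimal by blast
  obtain p' q' where 2: "syzygy_free l (3 * m) (\<lambda>i. on_line p' q' (h i))" using ex_free by blast
  define a b where "a j = p' j - p j" and "b j = q' j - q j" for j
  have "finite {T. \<not> syzygy_free (Suc l) (m - 1) (\<lambda>i. on_line (\<lambda>j. p j + T * a j) (\<lambda>j. q j + T * b j) (h i))}"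
    by (rule syzygy_free_line_open[of _ _ _ 0]) (use 1 in simp)
  moreover have "finite {T. \<not> syzygy_free l (3 * m) (\<lambda>i. on_line (\<lambda>j. p j + T * a j) (\<lambda>j. q j + T * b j) (h i))}"
    by (rule syzygy_free_line_open[of _ _ _ 1]) (use 2 in \<open>simp add: a_def b_def\<close>)
  ultimately have "finite {T. \<not> good (\<lambda>j. p j + T * a j) (\<lambda>j. q j + T * b j)}"
    by (rule rev_finite_subset[OF finite_UnI]) (auto simp: good_def)
  then have "{T. \<not> good (\<lambda>j. p j + T * a j) (\<lambda>j. q j + T * b j)} \<noteq> UNIV"
    using infinite_UNIV_char_0 by metis
  then show ?thesis by blast
qed

lemma good_translate: "good p q \<Longrightarrow> good (\<lambda>j. p j + s * q j) q"
  by (simp add: good_def syzygy_free_translate)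

lemma line_syzygy_translate:
  "line_syzygy p q c \<Longrightarrow> line_syzygy (\<lambda>j. p j + s * q j) q (\<lambda>i. pcompose (c i) [:s, 1:])"
  by (auto simp: line_syzygy_def syzygy_translate pcompose_linear_eq_0)

text \<open>
  Eliminating \<open>h\<^sub>l\<close> from the two syzygies gives a syzygy of \<open>h\<^sub>0, \<dots>, h\<^sub>l\<^sub>-\<^sub>1\<close> of degree below \<open>3 m\<close>.
\<close>

lemma syzygies_parallel:
  assumes "good p q" "line_syzygy p q c" "syzygy (Suc l) (2 * m) (\<lambda>i. on_line p q (h i)) x"
  shows "par l c x"
proof -
  let ?H = "\<lambda>i. on_line p q (h i)"
  have free: "syzygy_free l (3 * m) ?H" using assms(1) by (simp add: good_def)
  have c_low: "low m (c i)" if "i \<le> l" for i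
    using that assms(2) by (simp add: line_syzygy_def syzygy_def)
  have x_low: "low (2 * m) (x i)" if "i \<le> l" for i
    using that assms(3) by (simp add: syzygy_def)
  have c_rel: "(\<Sum>i<l. c i * ?H i) = - (c l * ?H l)"
    using assms(2) by (simp add: line_syzygy_def syzygy_def eq_neg_iff_add_eq_0)
  have x_rel: "(\<Sum>i<l. x i * ?H i) = - (x l * ?H l)"
    using assms(3) by (simp add: syzygy_def eq_neg_iff_add_eq_0)
  have "c l \<noteq> 0"
  proof
    assume "c l = 0"
    then have "syzygy l (3 * m) ?H c"
      using c_rel low_mono[OF c_low] by (simp add: syzygy_def)
    from syzygy_freeD[OF free this] have "\<forall>i\<le>l. c i = 0" using \<open>c l = 0\<close> by (metis le_neq_implies_less)
    then show False using assms(2) by (auto simp: line_syzygy_def)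
  qed
  have "syzygy l (3 * m) ?H (\<lambda>i. c l * x i - x l * c i)"
    unfolding syzygy_def
  proof (intro conjI allI impI)
    fix i assume "i < l"
    have "low (m - 1 + 2 * m) (c l * x i)"
      using c_low[of l] x_low[of i] \<open>i < l\<close> m_pos by (intro low_mult) simp_all
    moreover have "low (2 * m - 1 + m) (x l * c i)"
      using x_low[of l] c_low[of i] \<open>i < l\<close> m_pos by (intro low_mult) simp_all
    ultimately show "low (3 * m) (c l * x i - x l * c i)"
      by (intro low_diff) (auto elim: low_mono)
  next
    have "(\<Sum>i<l. (c l * x i - x l * c i) * ?H i)
        = c l * (\<Sum>i<l. x i * ?H i) - x l * (\<Sum>i<l. c i * ?H i)"
      by (simp only: left_diff_distrib sum_subtractf sum_distrib_left mult.assoc)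
    also have "\<dots> = 0" unfolding c_rel x_rel by (simp only: mult_minus_right mult.left_commute diff_self)
    finally show "(\<Sum>i<l. (c l * x i - x l * c i) * ?H i) = 0" .
  qed
  from syzygy_freeD[OF free this]
  have eq: "c l * x i = x l * c i" if "i \<le> l" for i
    using that by (cases "i = l") auto
  show ?thesis
    unfolding par_def
  proof (intro allI impI)
    fix i j assume ij: "i \<le> l" "j \<le> l"
    have "c l * (c i * x j) = c i * (c l * x j)" by (simp only: mult_ac)
    also have "\<dots> = c j * (x l * c i)" unfolding eq[OF ij(2)] by (simp only: mult_ac)
    also have "\<dots> = c l * (c j * x i)" unfolding eq[OF ij(1), symmetric] by (simp only: mult_ac)
    finally show "c i * x j = c j * x i" using \<open>c l \<noteq> 0\<close> by (simp only: mult_cancel_left) simp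
  qed
qed

text \<open>
  Otherwise the syzygy could be divided by \<open>s\<close>, against the minimality of \<open>m\<close>.
\<close>

lemma line_syzygy_nonvanishing:
  assumes "good p q" "line_syzygy p q c"
  shows "\<exists>k\<le>l. coeff (c k) 0 \<noteq> 0"
proof (rule ccontr)
  let ?H = "\<lambda>i. on_line p q (h i)"
  assume not: "\<not> ?thesis"
  define d where "d i = c i div [:0, 1:]" for i
  have cd: "c i = [:0, 1:] * d i" if "i \<le> l" for i
  proof -
    have "poly (c i) 0 = 0" using not that by (simp add: poly_0_coeff_0)
    then have "[:0, 1:] dvd c i" using poly_eq_0_iff_dvd[of "c i" 0] by simp
    then show ?thesis unfolding d_def by (rule dvd_mult_div_cancel[symmetric])
  qed
  have "syzygy (Suc l) (m - 1) ?H d"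
    unfolding syzygy_def
  proof (intro conjI allI impI)
    fix i assume i: "i < Suc l"
    have "coeff (d i) k = coeff (c i) (Suc k)" for k using cd[of i] i by simp
    moreover have "low m (c i)" using assms(2) i by (simp add: line_syzygy_def syzygy_def)
    ultimately show "low (m - 1) (d i)" by (simp add: low_def)
  next
    have "[:0, 1:] * (\<Sum>i<Suc l. d i * ?H i) = (\<Sum>i<Suc l. c i * ?H i)"
      unfolding sum_distrib_left using cd by (intro sum.cong) (simp_all only: mult.assoc lessThan_iff less_Suc_eq_le)
    also have "\<dots> = 0" using assms(2) by (simp add: line_syzygy_def syzygy_def)
    finally show "(\<Sum>i<Suc l. d i * ?H i) = 0"
      unfolding mult_eq_0_iff by (metis pCons_eq_0_iff one_neq_zero)
  qed
  moreover have "syzygy_free (Suc l) (m - 1) ?H" using assms(1) by (simp add: good_def)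
  ultimately have "\<forall>i\<le>l. d i = 0"
    using syzygy_freeD[of "Suc l" "m - 1" ?H d] by (simp add: less_Suc_eq_le)
  then show False using assms(2) cd by (auto simp: line_syzygy_def)
qed

lemma syzygies_parallel_at_0:
  assumes "good p q" "line_syzygy p q c" "line_syzygy p q c'"
  shows "par l (\<lambda>i. coeff (c i) 0) (\<lambda>i. coeff (c' i) 0)"
proof -
  have "syzygy (Suc l) (2 * m) (\<lambda>i. on_line p q (h i)) c'"
    using assms(3) low_mono by (fastforce simp: line_syzygy_def syzygy_def)
  from syzygies_parallel[OF assms(1,2) this] show ?thesis
    unfolding par_def by (metis coeff_mult_0)
qed

text \<open>
  The heart of the argument. Here \<open>A\<close> is a syzygy for the rotating line and \<open>B\<close> one for the line
  translated in the direction \<open>v\<close>, with values \<open>a\<close>, \<open>b\<close> and derivatives \<open>a'\<close>, \<open>b'\<close> at the line in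
  question. Differentiating the two relations produces the error terms \<open>s a\<^sub>i G\<^sub>i\<close> and \<open>b\<^sub>i G\<^sub>i\<close>.
  Since \<open>a\<close> and \<open>b\<close> are proportional, they cancel in \<open>x = b\<^sub>k a' - s a\<^sub>k b'\<close>, which is therefore a
  syzygy, and so proportional to \<open>a\<close>. At \<open>s = 0\<close> only \<open>b\<^sub>k a'\<close> remains of \<open>x\<close>.
\<close>

lemma pencil_derivative:
  assumes good: "good p (\<lambda>j. q j + T * v j)"
    and A: "syzygy (Suc l) m (\<lambda>i. moving_line p (\<lambda>_. 0) q v (h i)) A" "\<exists>i<Suc l. specialize T (A i) \<noteq> 0"
    and ij: "i \<le> l" "j \<le> l"
  shows "poly (coeff (A i) 0 * pderiv (coeff (A j) 0)) T = poly (coeff (A j) 0 * pderiv (coeff (A i) 0)) T"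
proof -
  define q' where "q' j = q j + T * v j" for j
  define H where "H i = on_line p q' (h i)" for i
  define G where "G i = der 0 (moving_line p v q' (\<lambda>_. 0) (h i))" for i
  have "infinite {T. \<not> syzygy_free (Suc l) m (\<lambda>i. specialize T (moving_line p v q' (\<lambda>_. 0) (h i)))}"
    by (simp add: specialize_moving_line not_free infinite_UNIV_char_0)
  then obtain B where B: "syzygy (Suc l) m (\<lambda>i. moving_line p v q' (\<lambda>_. 0) (h i)) B"
      "\<exists>i<Suc l. specialize 0 (B i) \<noteq> 0"
    using syzygy_of_family by metis
  define a b where "a i = specialize T (A i)" and "b i = specialize 0 (B i)" for i
  define a' b' where "a' i = der T (A i)" and "b' i = der 0 (B i)" for i
  have good': "good p q'" using good by (simp add: q'_def[abs_def])
  have a: "line_syzygy p q' a"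
    using syzygy_specialize[OF A(1), of T] A(2)
    by (simp add: line_syzygy_def a_def[abs_def] specialize_moving_line q'_def[abs_def] less_Suc_eq_le)
  have b: "line_syzygy p q' b"
    using syzygy_specialize[OF B(1), of 0] B(2)
    by (simp add: line_syzygy_def b_def[abs_def] specialize_moving_line less_Suc_eq_le)
  have low_a: "low m (a i)" "low m (a' i)" and low_b: "low m (b i)" "low m (b' i)" if "i \<le> l" for i
    using A(1) B(1) that
    by (simp_all add: a_def a'_def b_def b'_def syzygy_def low_specialize low_der less_Suc_eq_le)
  have relA: "(\<Sum>i<Suc l. a' i * H i + a i * ([:0, 1:] * G i)) = 0"
  proof -
    have "der T (\<Sum>i<Suc l. A i * moving_line p (\<lambda>_. 0) q v (h i)) = 0"
      using A(1) by (simp only: syzygy_def der_0)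
    then show ?thesis
      unfolding der_sum der_mult der_rotation_eq specialize_moving_line
      by (simp add: a_def a'_def H_def G_def q'_def[abs_def])
  qed
  have relB: "(\<Sum>i<Suc l. b' i * H i + b i * G i) = 0"
  proof -
    have "der 0 (\<Sum>i<Suc l. B i * moving_line p v q' (\<lambda>_. 0) (h i)) = 0"
      using B(1) by (simp only: syzygy_def der_0)
    then show ?thesis
      unfolding der_sum der_mult specialize_moving_line
      by (simp add: b_def b'_def H_def G_def)
  qed
  have ab: "par l a b"
    using syzygies_parallel[OF good' a, of b] b low_mono
    by (fastforce simp: line_syzygy_def syzygy_def)
  obtain k where k: "k \<le> l" "coeff (b k) 0 \<noteq> 0"
    using line_syzygy_nonvanishing[OF good' b] by blast
  define x where "x i = b k * a' i - [:0, 1:] * a k * b' i" for i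
  have "syzygy (Suc l) (2 * m) (\<lambda>i. on_line p q' (h i)) x"
    unfolding syzygy_def
  proof (intro conjI allI impI)
    fix i assume "i < Suc l"
    then have i: "i \<le> l" by simp
    have "low (m - 1 + m) (b k * a' i)"
      using low_a[OF i] low_b[OF k(1)] m_pos by (intro low_mult) simp_all
    moreover have "low (1 + m) ([:0, 1:] * a k)"
      using low_a[OF k(1)] by (intro low_mult) (simp_all add: low_iff_degree)
    then have "low (m + m) ([:0, 1:] * a k * b' i)"
      using low_b[OF i] by (intro low_mult) simp_all
    ultimately show "low (2 * m) (x i)"
      unfolding x_def by (intro low_diff) (auto elim: low_mono)
  next
    have term_eq: "x i * H i = b k * (a' i * H i + a i * ([:0, 1:] * G i))
        - [:0, 1:] * a k * (b' i * H i + b i * G i)" if "i \<le> l" for i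
    proof -
      have "b k * (a i * ([:0, 1:] * G i)) = [:0, 1:] * (a i * b k) * G i"
        by (simp only: mult_ac)
      also have "\<dots> = [:0, 1:] * a k * (b i * G i)"
        unfolding parD[OF ab that k(1)] by (simp only: mult_ac)
      finally show ?thesis by (simp only: x_def left_diff_distrib distrib_left mult.assoc) simp
    qed
    have "(\<Sum>i<Suc l. x i * H i) = (\<Sum>i<Suc l. b k * (a' i * H i + a i * ([:0, 1:] * G i))
        - [:0, 1:] * a k * (b' i * H i + b i * G i))"
      using term_eq by (intro sum.cong) (simp_all only: lessThan_iff less_Suc_eq_le)
    also have "\<dots> = b k * (\<Sum>i<Suc l. a' i * H i + a i * ([:0, 1:] * G i))
        - [:0, 1:] * a k * (\<Sum>i<Suc l. b' i * H i + b i * G i)"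
      by (simp only: sum_subtractf sum_distrib_left)
    also have "\<dots> = 0" by (simp only: relA relB mult_zero_right diff_self)
    finally show "(\<Sum>i<Suc l. x i * on_line p q' (h i)) = 0" by (simp only: H_def)
  qed
  from syzygies_parallel[OF good' a this]
  have "coeff (a i * x j) 0 = coeff (a j * x i) 0" using ij by (simp add: par_def)
  moreover have "coeff (x i) 0 = coeff (b k) 0 * coeff (a' i) 0" for i
    by (simp add: x_def coeff_mult_0)
  ultimately have "coeff (b k) 0 * (coeff (a i) 0 * coeff (a' j) 0) = coeff (b k) 0 * (coeff (a j) 0 * coeff (a' i) 0)"
    by (simp only: coeff_mult_0 mult.left_commute)
  then have "coeff (a i) 0 * coeff (a' j) 0 = coeff (a j) 0 * coeff (a' i) 0"
    using k(2) by (simp only: mult_cancel_left) simp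
  then show ?thesis by (simp add: a_def a'_def)
qed

text \<open>
  Join the two lines by a pencil of lines through \<open>p\<close>. The value at \<open>p\<close> of a syzygy that depends
  polynomially on the pencil parameter has zero Wronskians, first at the good members of the pencil
  and hence identically, so its direction is constant. It is not zero at the two given lines.
\<close>

lemma direction_independent_of_line:
  assumes "good p q" "good p q'" "line_syzygy p q c" "line_syzygy p q' c'"
  shows "par l (\<lambda>i. coeff (c i) 0) (\<lambda>i. coeff (c' i) 0)"
proof -
  define v where "v j = q' j - q j" for j
  have at: "(\<lambda>j. q j + 0 * v j) = q" "(\<lambda>j. q j + 1 * v j) = q'" by (auto simp: v_def)
  have fin: "finite {T. \<not> good p (\<lambda>j. q j + T * v j)}"
    using good_open[of p 0 "\<lambda>_. 0" q v] assms(1) by simp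
  have "infinite {T. \<not> syzygy_free (Suc l) m (\<lambda>i. specialize T (moving_line p (\<lambda>_. 0) q v (h i)))}"
    by (simp add: specialize_moving_line not_free infinite_UNIV_char_0)
  then obtain A where A: "syzygy (Suc l) m (\<lambda>i. moving_line p (\<lambda>_. 0) q v (h i)) A"
      "\<And>T. \<exists>i<Suc l. specialize T (A i) \<noteq> 0"
    using syzygy_of_family by metis
  have A_line: "line_syzygy p (\<lambda>j. q j + T * v j) (\<lambda>i. specialize T (A i))" for T
    using syzygy_specialize[OF A(1), of T] A(2)[of T]
    by (simp add: line_syzygy_def specialize_moving_line less_Suc_eq_le)
  define \<gamma> where "\<gamma> i = coeff (A i) 0" for i
  have ends: "poly (\<gamma> i) 0 * poly (\<gamma> j) 1 = poly (\<gamma> j) 0 * poly (\<gamma> i) 1" if "i \<le> l" "j \<le> l" for i j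
  proof (rule proportional_if_wronskian_0)
    have "poly (\<gamma> i * pderiv (\<gamma> j) - \<gamma> j * pderiv (\<gamma> i)) T = 0" if "good p (\<lambda>j. q j + T * v j)" for T
      using pencil_derivative[OF that A(1) A(2) \<open>i \<le> l\<close> \<open>j \<le> l\<close>] by (simp add: \<gamma>_def)
    then have "- {T. \<not> good p (\<lambda>j. q j + T * v j)}
        \<subseteq> {T. poly (\<gamma> i * pderiv (\<gamma> j) - \<gamma> j * pderiv (\<gamma> i)) T = 0}" by blast
    moreover have "infinite (- {T. \<not> good p (\<lambda>j. q j + T * v j)})"
      unfolding Compl_eq_Diff_UNIV by (rule Diff_infinite_finite[OF fin infinite_UNIV_char_0])
    ultimately have "\<gamma> i * pderiv (\<gamma> j) - \<gamma> j * pderiv (\<gamma> i) = 0"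
      using poly_roots_finite finite_subset by blast
    then show "\<gamma> i * pderiv (\<gamma> j) = \<gamma> j * pderiv (\<gamma> i)" by simp
  qed
  let ?u0 = "\<lambda>i. coeff (specialize 0 (A i)) 0" and ?u1 = "\<lambda>i. coeff (specialize 1 (A i)) 0"
  have A0: "line_syzygy p q (\<lambda>i. specialize 0 (A i))" using A_line[of 0] unfolding at .
  have A1: "line_syzygy p q' (\<lambda>i. specialize 1 (A i))" using A_line[of 1] unfolding at .
  have 1: "par l (\<lambda>i. coeff (c i) 0) ?u0"
    by (rule syzygies_parallel_at_0[OF assms(1,3) A0])
  have 2: "par l ?u0 ?u1"
    unfolding par_def using ends by (simp add: \<gamma>_def)
  have 3: "par l ?u1 (\<lambda>i. coeff (c' i) 0)"
    by (rule syzygies_parallel_at_0[OF assms(2) A1 assms(4)])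
  obtain k0 where k0: "k0 \<le> l" "?u0 k0 \<noteq> 0"
    using line_syzygy_nonvanishing[OF assms(1) A0] by blast
  obtain k1 where k1: "k1 \<le> l" "?u1 k1 \<noteq> 0"
    using line_syzygy_nonvanishing[OF assms(2) A1] by blast
  show ?thesis by (rule par_trans[OF par_trans[OF 1 2 k0] 3 k1])
qed

end

section \<open>Total degree and linear systems\<close>

definition tdeg_le :: "nat \<Rightarrow> ('n::finite, 'k::field) mpoly \<Rightarrow> bool" where
  "tdeg_le d p \<longleftrightarrow> (\<forall>e\<in>Poly_Mapping.keys p. (\<Sum>x\<in>UNIV. Poly_Mapping.lookup e x) \<le> d)"

lemma tdeg_le_mono: "tdeg_le d p \<Longrightarrow> d \<le> d' \<Longrightarrow> tdeg_le d' p"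
  unfolding tdeg_le_def using le_trans by blast

lemma tdeg_le_0 [simp]: "tdeg_le d 0"
  by (simp add: tdeg_le_def)

lemma tdeg_le_cst [simp]: "tdeg_le d (cst c)"
  by (simp add: tdeg_le_def cst_def)

lemma tdeg_le_X: "tdeg_le 1 (X j)"
  by (simp add: tdeg_le_def X_def lookup_single when_def)

lemma tdeg_le_add: "tdeg_le d p \<Longrightarrow> tdeg_le d q \<Longrightarrow> tdeg_le d (p + q)"
  unfolding tdeg_le_def using keys_add[of p q] by blast

lemma tdeg_le_sum: "(\<And>x. x \<in> A \<Longrightarrow> tdeg_le d (f x)) \<Longrightarrow> tdeg_le d (sum f A)"
  by (induction A rule: infinite_finite_induct) (simp_all add: tdeg_le_add)

lemma tdeg_le_mult:
  assumes "tdeg_le d p" "tdeg_le d' q" shows "tdeg_le (d + d') (p * q)"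
  unfolding tdeg_le_def
proof
  fix e assume "e \<in> Poly_Mapping.keys (p * q)"
  then obtain u v where "e = u + v" "u \<in> Poly_Mapping.keys p" "v \<in> Poly_Mapping.keys q"
    using keys_mult[of p q] by blast
  with assms show "(\<Sum>x\<in>UNIV. Poly_Mapping.lookup e x) \<le> d + d'"
    by (simp add: tdeg_le_def lookup_add sum.distrib add_mono)
qed

lemma tdeg_le_one: "tdeg_le d 1"
  using tdeg_le_cst[of d 1] by (simp add: rhom_one[OF rhom_cst])

lemma tdeg_le_power: "tdeg_le d p \<Longrightarrow> tdeg_le (k * d) (p ^ k)"
  by (induction k) (simp_all add: tdeg_le_mult tdeg_le_one)

lemma tdeg_le_prod: "(\<And>x. x \<in> A \<Longrightarrow> tdeg_le (d x) (f x)) \<Longrightarrow> tdeg_le (sum d A) (prod f A)"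
  by (induction A rule: infinite_finite_induct) (simp_all add: tdeg_le_mult tdeg_le_one)

lemma tdeg_le_psubst:
  assumes "tdeg_le d p" "\<And>j. tdeg_le 1 (\<phi> j)" shows "tdeg_le d (psubst cst \<phi> p)"
  unfolding psubst_def
proof (rule tdeg_le_sum)
  fix e assume e: "e \<in> Poly_Mapping.keys p"
  have "tdeg_le (0 + (\<Sum>x\<in>UNIV. Poly_Mapping.lookup e x * 1))
      (cst (Poly_Mapping.lookup p e) * (\<Prod>j\<in>UNIV. \<phi> j ^ Poly_Mapping.lookup e j))"
    by (intro tdeg_le_mult tdeg_le_prod tdeg_le_power assms tdeg_le_cst)
  then show "tdeg_le d (cst (Poly_Mapping.lookup p e) * (\<Prod>j\<in>UNIV. \<phi> j ^ Poly_Mapping.lookup e j))"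
    by (rule tdeg_le_mono) (use assms(1) e in \<open>simp add: tdeg_le_def\<close>)
qed

lemma degree_prod_pow_le:
  fixes f :: "'i \<Rightarrow> 'k::field poly"
  assumes "finite A" shows "degree (\<Prod>j\<in>A. f j ^ e j) \<le> (\<Sum>j\<in>A. degree (f j) * e j)"
  by (rule order_trans[OF degree_prod_sum_le[OF assms]]) (auto intro!: sum_mono degree_power_le)

lemma low_on_line:
  assumes "tdeg_le d p" shows "low (Suc d) (on_line u v p)"
  unfolding low_iff_degree on_line_def psubst_def
proof (rule degree_sum_le)
  fix e assume e: "e \<in> Poly_Mapping.keys p"
  have "degree ([:Poly_Mapping.lookup p e:] * (\<Prod>j\<in>UNIV. [:u j, v j:] ^ Poly_Mapping.lookup e j))
      \<le> degree (\<Prod>j\<in>UNIV. [:u j, v j:] ^ Poly_Mapping.lookup e j)"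
    by simp
  also have "\<dots> \<le> (\<Sum>j\<in>UNIV. degree [:u j, v j:] * Poly_Mapping.lookup e j)"
    by (rule degree_prod_pow_le) simp
  also have "\<dots> \<le> (\<Sum>j\<in>UNIV. Poly_Mapping.lookup e j)"
    by (rule sum_mono) simp
  finally show "degree ([:Poly_Mapping.lookup p e:] * (\<Prod>j\<in>UNIV. [:u j, v j:] ^ Poly_Mapping.lookup e j)) \<le> d"
    using assms e by (fastforce simp: tdeg_le_def)
qed simp

text \<open>
  Fewer homogeneous linear equations than unknowns, by eliminating one unknown per equation.
\<close>

lemma underdetermined_system:
  fixes A :: "'e \<Rightarrow> 'j \<Rightarrow> 'k::field"
  assumes "finite E" "finite J" "card E < card J"
  shows "\<exists>a. (\<exists>j\<in>J. a j \<noteq> 0) \<and> (\<forall>e\<in>E. (\<Sum>j\<in>J. a j * A e j) = 0)"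
  using assms
proof (induction E arbitrary: J A rule: finite_induct)
  case empty
  then obtain j where "j \<in> J" by fastforce
  then show ?case by (intro exI[of _ "\<lambda>_. 1"]) auto
next
  case (insert e E)
  show ?case
  proof (cases "\<forall>j\<in>J. A e j = 0")
    case True
    have "card E < card J" using insert by simp
    from insert.IH[OF insert.prems(1) this, of A] obtain a where a: "\<exists>j\<in>J. a j \<noteq> 0"
      "\<forall>e\<in>E. (\<Sum>j\<in>J. a j * A e j) = 0" by blast
    moreover have "(\<Sum>j\<in>J. a j * A e j) = 0" using True by (intro sum.neutral) simp
    ultimately show ?thesis by blast
  next
    case False
    then obtain j0 where j0: "j0 \<in> J" "A e j0 \<noteq> 0" by blast
    define J' where "J' = J - {j0}"
    have J': "finite J'" "J = insert j0 J'" "j0 \<notin> J'" "card E < card J'"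
      using insert j0 by (auto simp: J'_def)
    define A' where "A' e' j = A e' j - A e' j0 / A e j0 * A e j" for e' j
    from insert.IH[OF J'(1,4), of A'] obtain a where a: "\<exists>j\<in>J'. a j \<noteq> 0"
      and a0: "\<forall>e'\<in>E. (\<Sum>j\<in>J'. a j * A' e' j) = 0" by blast
    define S where "S = (\<Sum>j\<in>J'. a j * A e j)"
    define b where "b j = (if j = j0 then - S / A e j0 else a j)" for j
    have sum_b: "(\<Sum>j\<in>J. b j * A e' j) = - S / A e j0 * A e' j0 + (\<Sum>j\<in>J'. a j * A e' j)" for e'
    proof -
      have "(\<Sum>j\<in>J'. b j * A e' j) = (\<Sum>j\<in>J'. a j * A e' j)"
        using J'(3) by (intro sum.cong) (auto simp: b_def)
      moreover have "b j0 = - S / A e j0" by (simp add: b_def)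
      ultimately show ?thesis unfolding J'(2) sum.insert[OF J'(1,3)] by (simp only:)
    qed
    have "(\<Sum>j\<in>J. b j * A e' j) = 0" if "e' \<in> E" for e'
    proof -
      have "a j * A' e' j = a j * A e' j - A e' j0 / A e j0 * (a j * A e j)" for j
        by (simp only: A'_def right_diff_distrib mult.left_commute)
      then have "(\<Sum>j\<in>J'. a j * A' e' j) = (\<Sum>j\<in>J'. a j * A e' j) - A e' j0 / A e j0 * S"
        by (simp only: S_def sum_subtractf sum_distrib_left)
      then have "(\<Sum>j\<in>J'. a j * A e' j) = A e' j0 / A e j0 * S" using a0 that by simp
      moreover have "- s / x * y + y / x * s = 0" for s x y :: 'k by (simp add: mult.commute)
      ultimately show ?thesis unfolding sum_b by (simp only:)
    qed
    moreover have "(\<Sum>j\<in>J. b j * A e j) = 0" unfolding sum_b S_def[symmetric] using j0(2) by simp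
    moreover have "\<exists>j\<in>J. b j \<noteq> 0" using a J'(2,3) by (auto simp: b_def)
    ultimately show ?thesis by (intro exI[of _ b]) auto
  qed
qed

text \<open>
  Bernoulli's inequality for \<open>(a / (a + b))\<^sup>n\<close>: the ratio of the two powers tends to \<open>1\<close>.
\<close>

lemma more_coefficients_than_conditions:
  fixes a b l n :: nat
  assumes "n * b * Suc l < a + b" "0 < a"
  shows "l * (a + b) ^ n < Suc l * a ^ n"
proof -
  define N where "N = real (a + b)"
  define x where "x = real b / N"
  have pos: "0 < N" using assms by (simp add: N_def)
  have ab: "real a = N - real b" by (simp add: N_def)
  have x: "x \<le> 1" using pos ab by (simp add: x_def)
  have x': "1 - x = real a / N" using pos by (simp add: x_def ab diff_divide_distrib)
  have "real (n * b * Suc l) < N" unfolding N_def using assms(1) by (simp only: of_nat_less_iff)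
  then have "real n * real b * real (Suc l) < N" by (simp only: of_nat_mult)
  then have "real n * real b * real (Suc l) / N < 1" using pos by (simp only: divide_less_eq_1_pos)
  then have "real n * x * real (Suc l) < 1" by (simp only: x_def times_divide_eq_right times_divide_eq_left)
  then have "real l < real (Suc l) * (1 - real n * x)"
    by (simp only: right_diff_distrib mult_1_right of_nat_Suc mult.commute[of "1 + real l"]
        mult.commute[of "real l + 1"])
  also have "1 - real n * x \<le> (1 - x) ^ n"
    using Bernoulli_inequality[of "-x" n] x by simp
  then have "real (Suc l) * (1 - real n * x) \<le> real (Suc l) * (1 - x) ^ n"
    by (rule mult_left_mono) simp
  finally have "real l < real (Suc l) * (real a / N) ^ n" unfolding x' .
  then have "real l * N ^ n < real (Suc l) * (real a / N) ^ n * N ^ n"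
    using pos by (intro mult_strict_right_mono) simp_all
  also have "\<dots> = real (Suc l) * real a ^ n"
    using pos by (simp only: power_divide mult.assoc) simp
  finally have "real (l * (a + b) ^ n) < real (Suc l * a ^ n)"
    by (simp only: of_nat_mult of_nat_power N_def)
  then show ?thesis by (simp only: of_nat_less_iff)
qed

definition mpoly_syzygy_free :: "nat \<Rightarrow> nat \<Rightarrow> (nat \<Rightarrow> ('n::finite, 'k::field) mpoly) \<Rightarrow> bool" where
  "mpoly_syzygy_free l d h \<longleftrightarrow>
     (\<forall>c. (\<forall>i<l. tdeg_le d (c i)) \<and> (\<Sum>i<l. c i * h i) = 0 \<longrightarrow> (\<forall>i<l. c i = 0))"

section \<open>Interpolating the syzygy directions on a grid\<close>

lemma par_if_pivot:
  fixes u v :: "nat \<Rightarrow> 'a::idom"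
  assumes "v k \<noteq> 0" "\<And>i. i \<le> l \<Longrightarrow> u i * v k = u k * v i" shows "par l u v"
  unfolding par_def
proof (intro allI impI)
  fix i j assume ij: "i \<le> l" "j \<le> l"
  have "v k * (u i * v j) = v j * (u i * v k)" by (simp only: mult_ac)
  also have "\<dots> = v i * (u k * v j)" unfolding assms(2)[OF ij(1)] by (simp only: mult_ac)
  also have "\<dots> = v k * (u j * v i)" unfolding assms(2)[OF ij(2), symmetric] by (simp only: mult_ac)
  finally show "u i * v j = u j * v i" using assms(1) by (simp only: mult_cancel_left) simp
qed

context every_line_has_syzygy
begin

lemma syzygy_at_0:
  assumes "line_syzygy p q c" shows "(\<Sum>i\<le>l. coeff (c i) 0 * ev p (h i)) = 0"
proof -
  have "coeff (\<Sum>i<Suc l. c i * on_line p q (h i)) 0 = 0"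
    using assms by (simp add: line_syzygy_def syzygy_def)
  then show ?thesis by (simp add: coeff_sum coeff_mult_0 coeff_0_on_line lessThan_Suc_atMost)
qed

text \<open>
  The minors of \<open>P\<close> and of the syzygy \<open>c\<close> of the line have degree less than \<open>M + m\<close> and
  vanish at the points of \<open>S\<close>.
\<close>

lemma spread_along_coordinate_line:
  fixes P :: "nat \<Rightarrow> ('n, 'k) mpoly" and pt :: "('n \<Rightarrow> 'k) \<Rightarrow> 'n \<Rightarrow> 'k"
  assumes pt: "\<And>s. pt (\<lambda>i. t i + s * (if i = j then 1 else 0)) = (\<lambda>i. pt t i + s * v i)"
    and P_low: "\<And>i. i \<le> l \<Longrightarrow> low (Suc M) (on_line t (\<lambda>i. if i = j then 1 else 0) (P i))"
    and S: "finite S" "M + m \<le> card S"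
    and par_S: "\<And>s. s \<in> S \<Longrightarrow> \<exists>c. (\<exists>k\<le>l. coeff (c k) 0 \<noteq> 0) \<and> line_syzygy (\<lambda>i. pt t i + s * v i) v c \<and>
        par l (\<lambda>i. ev (\<lambda>i. t i + s * (if i = j then 1 else 0)) (P i)) (\<lambda>i. coeff (c i) 0)"
    and good_t: "good (pt t) v" and c: "line_syzygy (pt t) v c"
  shows "par l (\<lambda>i. ev t (P i)) (\<lambda>i. coeff (c i) 0)"
proof -
  let ?e = "\<lambda>i. if i = j then 1 else 0 :: 'k"
  define R where "R i = on_line t ?e (P i)" for i
  have c_low: "low m (c i)" if "i \<le> l" for i
    using that c by (simp add: line_syzygy_def syzygy_def)
  have par_s: "par l (\<lambda>i. poly (R i) s) (\<lambda>i. poly (c i) s)" if s: "s \<in> S" for s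
  proof -
    obtain c' where c': "\<exists>k\<le>l. coeff (c' k) 0 \<noteq> 0" "line_syzygy (\<lambda>i. pt t i + s * v i) v c'"
      "par l (\<lambda>i. ev (\<lambda>i. t i + s * ?e i) (P i)) (\<lambda>i. coeff (c' i) 0)"
      using par_S[OF s] by blast
    have coeff0: "coeff (pcompose (c i) [:s, 1:]) 0 = poly (c i) s" for i
      by (simp add: poly_pcompose flip: poly_0_coeff_0)
    have "par l (\<lambda>i. coeff (c' i) 0) (\<lambda>i. coeff (pcompose (c i) [:s, 1:]) 0)"
      by (rule syzygies_parallel_at_0[OF good_translate[OF good_t] c'(2) line_syzygy_translate[OF c]])
    with c'(1,3) show ?thesis
      unfolding R_def poly_on_line coeff0 using par_trans by blast
  qed
  have "par l R c"
    unfolding par_def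
  proof (intro allI impI)
    fix i k assume ik: "i \<le> l" "k \<le> l"
    define W where "W = R i * c k - R k * c i"
    have "low (M + m) W"
      unfolding W_def R_def using P_low c_low ik by (intro low_diff low_mult) auto
    moreover have "poly W s = 0" if "s \<in> S" for s
      using par_s[OF that] ik by (simp add: W_def par_def)
    then have "S \<subseteq> {s. poly W s = 0}" by blast
    ultimately have "W = 0"
    proof (rule_tac ccontr)
      assume W: "low (M + m) W" "S \<subseteq> {s. poly W s = 0}" "W \<noteq> 0"
      have "card S \<le> card {s. poly W s = 0}" using W(2) poly_roots_finite[OF W(3)] by (rule card_mono[rotated])
      also have "\<dots> \<le> degree W" by (rule card_poly_roots_bound[OF W(3)])
      also have "\<dots> < M + m" by (rule degree_less_if_low[OF W(1,3)])
      finally show False using S(2) by simp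
    qed
    then show "R i * c k = R k * c i" by (simp add: W_def)
  qed
  then have "par l (\<lambda>i. coeff (R i) 0) (\<lambda>i. coeff (c i) 0)"
    unfolding par_def by (metis coeff_mult_0)
  then show ?thesis by (simp add: R_def coeff_0_on_line)
qed

end

subsection \<open>Polynomials of bounded degree in every variable\<close>

definition box :: "nat \<Rightarrow> ('n::finite \<Rightarrow> nat) set" where
  "box M = PiE UNIV (\<lambda>_. {..<M})"

lemma mem_box: "\<mu> \<in> box M \<longleftrightarrow> (\<forall>j. \<mu> j < M)"
  by (auto simp: box_def)

lemma finite_box [simp]: "finite (box M :: ('n::finite \<Rightarrow> nat) set)"
  unfolding box_def by (rule finite_PiE) simp_all

lemma card_box: "card (box M :: ('n::finite \<Rightarrow> nat) set) = M ^ CARD('n)"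
  unfolding box_def by (subst card_PiE) simp_all

text \<open>
  The general polynomial of degree at most \<open>M\<close> in each variable. Bounding the degrees separately
  fits the grid: the restriction to a coordinate line has degree at most \<open>M\<close>.
\<close>

definition box_poly :: "nat \<Rightarrow> (('n \<Rightarrow> nat) \<Rightarrow> 'k::field) \<Rightarrow> ('n::finite, 'k) mpoly" where
  "box_poly M a = (\<Sum>\<mu>\<in>box (Suc M). cst (a \<mu>) * (\<Prod>j\<in>UNIV. X j ^ \<mu> j))"

lemma ev_box_poly: "ev t (box_poly M a) = (\<Sum>\<mu>\<in>box (Suc M). a \<mu> * (\<Prod>j\<in>UNIV. t j ^ \<mu> j))"
  by (simp add: box_poly_def)

lemma tdeg_box_poly: "tdeg_le (CARD('n) * M) (box_poly M a :: ('n::finite, 'k::field) mpoly)"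
  unfolding box_poly_def
proof (rule tdeg_le_sum)
  fix \<mu> :: "'n \<Rightarrow> nat" assume \<mu>: "\<mu> \<in> box (Suc M)"
  have "tdeg_le (0 + (\<Sum>j\<in>UNIV. \<mu> j * 1)) (cst (a \<mu>) * (\<Prod>j\<in>UNIV. X j ^ \<mu> j))"
    by (intro tdeg_le_mult tdeg_le_prod tdeg_le_power tdeg_le_cst tdeg_le_X)
  moreover have "(\<Sum>j\<in>UNIV. \<mu> j) \<le> CARD('n) * M"
    using sum_bounded_above[of UNIV \<mu> M] \<mu> by (simp add: mem_box less_Suc_eq_le)
  ultimately show "tdeg_le (CARD('n) * M) (cst (a \<mu>) * (\<Prod>j\<in>UNIV. X j ^ \<mu> j))"
    by (simp add: tdeg_le_mono)
qed

lemma low_box_poly: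
  fixes j :: "'n::finite"
  shows "low (Suc M) (on_line t (\<lambda>i. if i = j then 1 else 0) (box_poly M a))"
  unfolding low_iff_degree box_poly_def rhom_simps[OF rhom_on_line] on_line_cst on_line_X
proof (rule degree_sum_le)
  fix \<mu> :: "'n \<Rightarrow> nat" assume \<mu>: "\<mu> \<in> box (Suc M)"
  let ?f = "\<lambda>i. [:t i, if i = j then 1 else 0:]"
  have "degree ([:a \<mu>:] * (\<Prod>i\<in>UNIV. ?f i ^ \<mu> i)) \<le> degree (\<Prod>i\<in>UNIV. ?f i ^ \<mu> i)" by simp
  also have "\<dots> \<le> (\<Sum>i\<in>UNIV. degree (?f i) * \<mu> i)" by (rule degree_prod_pow_le) simp
  also have "\<dots> = (\<Sum>i\<in>UNIV. if i = j then \<mu> i else 0)" by (rule sum.cong) auto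
  also have "\<dots> \<le> M" using \<mu> by (simp add: mem_box less_Suc_eq_le)
  finally show "degree ([:a \<mu>:] * (\<Prod>i\<in>UNIV. ?f i ^ \<mu> i)) \<le> M" .
qed simp

lemma box_poly_eq_0:
  fixes a :: "('n::finite \<Rightarrow> nat) \<Rightarrow> 'k::field_char_0"
  assumes "\<And>t. ev t (box_poly M a) = 0" "\<mu> \<in> box (Suc M)" shows "a \<mu> = 0"
  by (rule monomial_functions_independent[where A = UNIV and S = "box (Suc M)"])
    (use assms in \<open>auto simp: ev_box_poly fun_eq_iff\<close>)

subsection \<open>Coordinates in good directions\<close>

text \<open>
  The coordinate directions need not be good, so they are replaced by \<open>q + w e\<^sub>j\<close> with a good \<open>q\<close> and
  a general \<open>w\<close>. The first two conditions on \<open>w\<close> say that these vectors form a basis, as their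
  determinant is \<open>w\<^sup>n\<^sup>-\<^sup>1 (w + \<Sum> q)\<close>.
\<close>

lemma (in every_line_has_syzygy) ex_good_frame:
  "\<exists>p q w. w \<noteq> 0 \<and> w + sum q UNIV \<noteq> 0 \<and> (\<forall>j. good p (\<lambda>i. q i + w * (if i = j then 1 else 0)))"
proof -
  obtain p q where pq: "good p q" using ex_good by blast
  have fin: "finite {w. \<not> good p (\<lambda>i. q i + w * (if i = j then 1 else 0))}" for j
    using good_open[of p 0 "\<lambda>_. 0" q "\<lambda>i. if i = j then 1 else 0"] pq by simp
  have "finite ((\<Union>j. {w. \<not> good p (\<lambda>i. q i + w * (if i = j then 1 else 0))}) \<union> {0, - sum q UNIV})"
    (is "finite ?B") by (intro finite_UnI finite_UN_I fin) simp_all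
  then obtain w where w: "w \<notin> ?B" using ex_new_if_finite[OF infinite_UNIV_char_0] by blast
  show ?thesis
  proof (intro exI conjI allI)
    show "w \<noteq> 0" using w by simp
    show "w + sum q UNIV \<noteq> 0" using w by (simp add: add_eq_0_iff2)
    show "good p (\<lambda>i. q i + w * (if i = j then 1 else 0))" for j using w by simp
  qed
qed

locale good_frame = every_line_has_syzygy h l m
  for h :: "nat \<Rightarrow> ('n::finite, 'k::field_char_0) mpoly" and l m +
  fixes p0 q0 :: "'n \<Rightarrow> 'k" and w :: 'k
  assumes w_nz: "w \<noteq> 0" and w_sum_nz: "w + sum q0 UNIV \<noteq> 0"
    and good_p0: "good p0 (\<lambda>i. q0 i + w * (if i = j then 1 else 0))"
begin

definition dir :: "'n \<Rightarrow> 'n \<Rightarrow> 'k" where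
  "dir j i = q0 i + w * (if i = j then 1 else 0)"

definition pt :: "('n \<Rightarrow> 'k) \<Rightarrow> 'n \<Rightarrow> 'k" where
  "pt t i = p0 i + (\<Sum>j\<in>UNIV. t j * dir j i)"

lemma pt_line: "pt (\<lambda>i. t i + s * d i) = (\<lambda>i. pt t i + s * (\<Sum>j\<in>UNIV. d j * dir j i))"
  by (rule ext) (simp only: pt_def distrib_right sum.distrib sum_distrib_left mult.assoc add.assoc)

lemma pt_coordinate_line: "pt (\<lambda>i. t i + s * (if i = j then 1 else 0)) = (\<lambda>i. pt t i + s * dir j i)"
proof -
  have "(if j' = j then 1 else 0) * dir j' i = (if j' = j then dir j' i else 0)" for j' i by simp
  then have "(\<Sum>j'\<in>UNIV. (if j' = j then 1 else 0) * dir j' i) = dir j i" for i by simp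
  then show ?thesis unfolding pt_line by (simp only:)
qed

text \<open>
  The inverse of the affine map \<open>pt\<close>, by the formula of Sherman and Morrison.
\<close>

definition coord :: "'n \<Rightarrow> ('n, 'k) mpoly" where
  "coord i = cst (1 / w) * ((X i + cst (- p0 i)) +
     cst (- q0 i / (w + sum q0 UNIV)) * (\<Sum>j\<in>UNIV. X j + cst (- p0 j)))"

lemma tdeg_coord: "tdeg_le 1 (coord i)"
proof -
  have sub: "tdeg_le 1 (X j + cst u)" for j :: 'n and u :: 'k
    by (intro tdeg_le_add tdeg_le_X tdeg_le_cst)
  have "tdeg_le (0 + 1) (cst u * (\<Sum>j\<in>UNIV. X j + cst (- p0 j)))" for u
    by (intro tdeg_le_mult tdeg_le_sum sub tdeg_le_cst)
  then have "tdeg_le (0 + 1) (coord i)"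
    unfolding coord_def by (intro tdeg_le_mult tdeg_le_add sub tdeg_le_cst) simp
  then show ?thesis by simp
qed

lemma pt_eq: "pt t i = p0 i + (sum t UNIV * q0 i + w * t i)"
proof -
  have "t j * dir j i = t j * q0 i + (if j = i then w * t j else 0)" for j
    by (simp add: dir_def distrib_left)
  then have "(\<Sum>j\<in>UNIV. t j * dir j i) = sum t UNIV * q0 i + w * t i"
    by (simp add: sum.distrib sum_distrib_right)
  then show ?thesis by (simp only: pt_def)
qed

lemma sum_pt: "(\<Sum>j\<in>UNIV. pt t j - p0 j) = (w + sum q0 UNIV) * sum t UNIV"
proof -
  have "(\<Sum>j\<in>UNIV. pt t j - p0 j) = (\<Sum>j\<in>UNIV. sum t UNIV * q0 j + w * t j)"
    by (simp add: pt_eq)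
  also have "\<dots> = sum t UNIV * sum q0 UNIV + w * sum t UNIV"
    by (simp only: sum.distrib sum_distrib_left)
  also have "\<dots> = (w + sum q0 UNIV) * sum t UNIV"
    unfolding distrib_right mult.commute[of "sum q0 UNIV"] by (rule add.commute)
  finally show ?thesis .
qed

lemma coord_pt: "ev (pt t) (coord i) = t i"
proof -
  have "ev (pt t) (coord i) = 1 / w * (pt t i - p0 i
      - q0 i / (w + sum q0 UNIV) * (\<Sum>j\<in>UNIV. pt t j - p0 j))"
    by (simp add: coord_def)
  also have "\<dots> = t i"
    unfolding sum_pt unfolding pt_eq using w_nz w_sum_nz by simp
  finally show ?thesis .
qed

lemma pt_coord: "pt (\<lambda>i. ev x (coord i)) = x"
proof
  fix i
  define s Y where "s = w + sum q0 UNIV" and "Y = (\<Sum>j\<in>UNIV. x j - p0 j)"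
  have ev_coord: "ev x (coord i) = 1 / w * (x i - p0 i - Y / s * q0 i)" for i
    by (simp add: coord_def Y_def s_def)
  have "(\<Sum>i\<in>UNIV. ev x (coord i)) = 1 / w * (Y - Y / s * sum q0 UNIV)"
    unfolding ev_coord by (simp only: Y_def sum_subtractf sum_distrib_left[symmetric])
  also have "sum q0 UNIV = s - w" by (simp add: s_def)
  also have "Y - Y / s * (s - w) = w * (Y / s)"
    using w_sum_nz by (simp add: s_def[symmetric] right_diff_distrib)
  finally have "(\<Sum>i\<in>UNIV. ev x (coord i)) = Y / s" using w_nz by simp
  then show "pt (\<lambda>i. ev x (coord i)) i = x i"
    unfolding pt_eq ev_coord using w_nz by simp
qed

text \<open>
  The directions \<open>dir j\<close> are kept fixed, so this is a condition on the point alone.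
\<close>

definition regular :: "('n \<Rightarrow> 'k) \<Rightarrow> bool" where
  "regular t \<longleftrightarrow> (\<forall>j. good (pt t) (dir j))"

lemma regular_0: "regular (\<lambda>_. 0)"
proof -
  have "pt (\<lambda>_. 0) = p0" by (rule ext) (simp add: pt_def)
  moreover have "dir j = (\<lambda>i. q0 i + w * (if i = j then 1 else 0))" for j by (rule ext) (simp only: dir_def)
  ultimately show ?thesis unfolding regular_def using good_p0 by (simp only:) blast
qed

lemma regular_open:
  assumes "regular (\<lambda>j. u j + T0 * d j)"
  shows "finite {T. \<not> regular (\<lambda>j. u j + T * d j)}"
proof -
  have "finite {T. \<not> good (pt (\<lambda>j. u j + T * d j)) (dir j)}" for j
    using assms good_open[of "pt u" T0 "\<lambda>i. \<Sum>j\<in>UNIV. d j * dir j i" "dir j" "\<lambda>_. 0"]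
    by (simp add: regular_def pt_line)
  then have "finite (\<Union>j. {T. \<not> good (pt (\<lambda>j. u j + T * d j)) (dir j)})" by simp
  then show ?thesis by (rule rev_finite_subset) (auto simp: regular_def)
qed

text \<open>
  Up to scalars, the value at \<open>pt t\<close> of the syzygy on any good line through this point. The choice of
  the line and of its syzygy is immaterial by \<open>direction_independent_of_line\<close>.
\<close>

definition direction :: "('n \<Rightarrow> 'k) \<Rightarrow> nat \<Rightarrow> 'k" where
  "direction t i = coeff ((SOME c. line_syzygy (pt t) (dir undefined) c) i) 0"

lemma direction_par:
  assumes "regular t" "line_syzygy (pt t) (dir j) c"
  shows "par l (\<lambda>i. coeff (c i) 0) (direction t)"
proof -
  have "line_syzygy (pt t) (dir undefined) (SOME c. line_syzygy (pt t) (dir undefined) c)"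
    by (rule someI_ex[OF ex_line_syzygy])
  from direction_independent_of_line[OF _ _ assms(2) this] assms(1) show ?thesis
    unfolding direction_def[abs_def] regular_def by blast
qed

lemma direction_nz: "regular t \<Longrightarrow> \<exists>k\<le>l. direction t k \<noteq> 0"
  and direction_syzygy: "(\<Sum>i\<le>l. direction t i * ev (pt t) (h i)) = 0"
proof -
  have c: "line_syzygy (pt t) (dir undefined) (SOME c. line_syzygy (pt t) (dir undefined) c)"
    by (rule someI_ex[OF ex_line_syzygy])
  show "\<exists>k\<le>l. direction t k \<noteq> 0" if "regular t"
    using line_syzygy_nonvanishing[OF _ c] that unfolding direction_def regular_def by blast
  show "(\<Sum>i\<le>l. direction t i * ev (pt t) (h i)) = 0"
    using syzygy_at_0[OF c] unfolding direction_def .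
qed

text \<open>
  The points that occur while the coordinates of a grid point are replaced one by one by those of
  \<open>t\<close>; the grid has mesh \<open>\<epsilon>\<close>.
\<close>

definition mix :: "'n set \<Rightarrow> ('n \<Rightarrow> 'k) \<Rightarrow> 'k \<Rightarrow> ('n \<Rightarrow> nat) \<Rightarrow> 'n \<Rightarrow> 'k" where
  "mix A t \<epsilon> \<gamma> j = (if j \<in> A then t j else \<epsilon> * of_nat (\<gamma> j))"

text \<open>
  Freeing the coordinate \<open>j\<close> means moving along a coordinate line, on which the \<open>g \<ge> M + m\<close> points
  with \<open>j\<close>-th coordinate in the grid are covered by the induction hypothesis.
\<close>

lemma par_at_mixed_points:
  fixes P :: "nat \<Rightarrow> ('n, 'k) mpoly"
  assumes \<epsilon>: "\<epsilon> \<noteq> 0" and g: "M + m \<le> g"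
    and P_low: "\<And>i t j. i \<le> l \<Longrightarrow> low (Suc M) (on_line t (\<lambda>i. if i = j then 1 else 0) (P i))"
    and par_grid: "\<And>\<gamma>. \<gamma> \<in> box g \<Longrightarrow> par l (\<lambda>i. ev (\<lambda>j. \<epsilon> * of_nat (\<gamma> j)) (P i)) (direction (\<lambda>j. \<epsilon> * of_nat (\<gamma> j)))"
    and reg: "\<And>A \<gamma>. \<gamma> \<in> box g \<Longrightarrow> regular (mix A t \<epsilon> \<gamma>)"
    and "finite A" "\<gamma> \<in> box g"
  shows "par l (\<lambda>i. ev (mix A t \<epsilon> \<gamma>) (P i)) (direction (mix A t \<epsilon> \<gamma>))"
  using assms(6,7)
proof (induction A arbitrary: \<gamma> rule: finite_induct)
  case empty
  then show ?case using par_grid[of \<gamma>] by (simp add: mix_def[abs_def])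
next
  case (insert j A)
  let ?z = "mix (insert j A) t \<epsilon> \<gamma>"
  let ?S = "(\<lambda>b. \<epsilon> * of_nat b - t j) ` {..<g}"
  obtain c where c: "line_syzygy (pt ?z) (dir j) c" using ex_line_syzygy by blast
  have good_z: "good (pt ?z) (dir j)" using reg[OF insert.prems] by (simp add: regular_def)
  have "par l (\<lambda>i. ev ?z (P i)) (\<lambda>i. coeff (c i) 0)"
  proof (rule spread_along_coordinate_line[OF pt_coordinate_line P_low _ _ _ good_z c])
    show "finite ?S" by simp
    have "inj_on (\<lambda>b. \<epsilon> * of_nat b - t j) {..<g}" using \<epsilon> by (auto simp: inj_on_def)
    then show "M + m \<le> card ?S" using g by (simp add: card_image)
    fix s assume "s \<in> ?S"
    then obtain b where b: "b < g" "s = \<epsilon> * of_nat b - t j" by auto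
    let ?\<gamma> = "\<gamma>(j := b)"
    have \<gamma>: "?\<gamma> \<in> box g" using insert.prems b by (simp add: mem_box)
    have eq: "(\<lambda>i. ?z i + s * (if i = j then 1 else 0)) = mix A t \<epsilon> ?\<gamma>"
      using insert.hyps by (auto simp: mix_def b fun_eq_iff)
    have pt_eq: "(\<lambda>i. pt ?z i + s * dir j i) = pt (mix A t \<epsilon> ?\<gamma>)"
      using pt_coordinate_line[of ?z s j] unfolding eq by (rule sym)
    obtain c' where c': "line_syzygy (pt (mix A t \<epsilon> ?\<gamma>)) (dir j) c'" using ex_line_syzygy by blast
    have regA: "regular (mix A t \<epsilon> ?\<gamma>)" by (rule reg[OF \<gamma>])
    obtain k where k: "k \<le> l" "direction (mix A t \<epsilon> ?\<gamma>) k \<noteq> 0" using direction_nz[OF regA] by blast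
    have "par l (\<lambda>i. ev (mix A t \<epsilon> ?\<gamma>) (P i)) (\<lambda>i. coeff (c' i) 0)"
      by (rule par_trans[OF insert.IH[OF \<gamma>] par_sym[OF direction_par[OF regA c']] k])
    moreover have "\<exists>k\<le>l. coeff (c' k) 0 \<noteq> 0"
      using line_syzygy_nonvanishing[OF _ c'] regA by (simp add: regular_def)
    ultimately show "\<exists>c. (\<exists>k\<le>l. coeff (c k) 0 \<noteq> 0) \<and> line_syzygy (\<lambda>i. pt ?z i + s * dir j i) (dir j) c \<and>
        par l (\<lambda>i. ev (\<lambda>i. ?z i + s * (if i = j then 1 else 0)) (P i)) (\<lambda>i. coeff (c i) 0)"
      unfolding eq pt_eq using c' by blast
  qed
  moreover obtain k where "k \<le> l" "coeff (c k) 0 \<noteq> 0"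
    using line_syzygy_nonvanishing[OF good_z c] by blast
  ultimately show ?case
    using par_trans direction_par[OF reg[OF insert.prems] c] by blast
qed

text \<open>
  The interpolation argument. The mesh \<open>\<epsilon>\<close> is chosen so that all grid points are regular, which is
  possible because the origin is. Being proportional to a vector whose entry \<open>k\<close> is nonzero
  amounts to \<open>l\<close> linear conditions, so a nonzero solution exists by counting. It satisfies
  \<open>F t = 0\<close> at every \<open>t\<close> all of whose mixed points are regular. On the line through the origin in any direction
  \<open>d\<close> this applies to all but finitely many points, because at the origin the mixed points are grid
  points; so \<open>F\<close> vanishes identically.
\<close>

lemma not_mpoly_syzygy_free:
  assumes M: "CARD('n) * m * Suc l \<le> M"
  shows "\<not> mpoly_syzygy_free (Suc l) (CARD('n) * M) h"
proof
  assume free: "mpoly_syzygy_free (Suc l) (CARD('n) * M) h"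
  define g where "g = M + m"
  have "0 < g" using m_pos by (simp add: g_def)
  define pnt where "pnt \<epsilon> \<gamma> = (\<lambda>j. \<epsilon> * of_nat (\<gamma> j) :: 'k)" for \<epsilon> and \<gamma> :: "'n \<Rightarrow> nat"
  have "finite {\<epsilon>. \<not> regular (pnt \<epsilon> \<gamma>)}" for \<gamma>
    using regular_open[of "\<lambda>_. 0" 0 "\<lambda>j. of_nat (\<gamma> j)"] regular_0 by (simp add: pnt_def)
  then have "finite ((\<Union>\<gamma>\<in>box g. {\<epsilon>. \<not> regular (pnt \<epsilon> \<gamma>)}) \<union> {0})" (is "finite ?B") by simp
  then obtain \<epsilon> where "\<epsilon> \<notin> ?B" using ex_new_if_finite[OF infinite_UNIV_char_0] by blast
  then have \<epsilon>: "\<epsilon> \<noteq> 0" and reg_grid: "\<And>\<gamma>. \<gamma> \<in> box g \<Longrightarrow> regular (pnt \<epsilon> \<gamma>)" by auto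
  define k where "k \<gamma> = (SOME k. k \<le> l \<and> direction (pnt \<epsilon> \<gamma>) k \<noteq> 0)" for \<gamma>
  have k: "k \<gamma> \<le> l \<and> direction (pnt \<epsilon> \<gamma>) (k \<gamma>) \<noteq> 0" if "\<gamma> \<in> box g" for \<gamma>
    unfolding k_def using direction_nz[OF reg_grid[OF that]] by (rule someI_ex)
  define E where "E = (SIGMA \<gamma>:box g. {..l} - {k \<gamma>})"
  define J where "J = {..l} \<times> (box (Suc M) :: ('n \<Rightarrow> nat) set)"
  \<comment> \<open>Condition \<open>(\<gamma>, i)\<close> reads \<open>P\<^sub>i d\<^sub>k - P\<^sub>k d\<^sub>i = 0\<close> at the grid point \<open>\<gamma>\<close>, with \<open>d\<close> the direction there.\<close>
  define C where "C = (\<lambda>(\<gamma>, i) (i', \<mu>). ((if i' = i then direction (pnt \<epsilon> \<gamma>) (k \<gamma>) else 0)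
      - (if i' = k \<gamma> then direction (pnt \<epsilon> \<gamma>) i else 0)) * (\<Prod>j\<in>UNIV. pnt \<epsilon> \<gamma> j ^ \<mu> j))"
  have "card E = (\<Sum>\<gamma>\<in>box g. card ({..l} - {k \<gamma>}))"
    unfolding E_def by (rule card_SigmaI) simp_all
  also have "\<dots> = (\<Sum>\<gamma>\<in>(box g :: ('n \<Rightarrow> nat) set). l)"
    using k by (intro sum.cong) (simp_all add: card_Diff_singleton)
  finally have "card E = l * g ^ CARD('n)" by (simp add: card_box)
  also have "\<dots> = l * (Suc M + (m - 1)) ^ CARD('n)" using m_pos by (simp add: g_def)
  also have "\<dots> < Suc l * Suc M ^ CARD('n)"
  proof (rule more_coefficients_than_conditions)
    have "CARD('n) * (m - 1) * Suc l \<le> CARD('n) * m * Suc l" by (intro mult_le_mono) simp_all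
    then show "CARD('n) * (m - 1) * Suc l < Suc M + (m - 1)" using M by linarith
  qed simp
  also have "\<dots> = card J" by (simp add: J_def card_cartesian_product card_box)
  finally have less: "card E < card J" .
  have "finite E" "finite J" by (simp_all add: E_def J_def)
  from underdetermined_system[OF this less, of C] obtain a where
    a_nz: "\<exists>j\<in>J. a j \<noteq> 0" and a: "\<And>e. e \<in> E \<Longrightarrow> (\<Sum>j\<in>J. a j * C e j) = 0" by blast
  define P where "P i = (box_poly M (\<lambda>\<mu>. a (i, \<mu>)) :: ('n, 'k) mpoly)" for i
  have par_grid: "par l (\<lambda>i. ev (pnt \<epsilon> \<gamma>) (P i)) (direction (pnt \<epsilon> \<gamma>))" if \<gamma>: "\<gamma> \<in> box g" for \<gamma>
  proof (rule par_if_pivot)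
    show "direction (pnt \<epsilon> \<gamma>) (k \<gamma>) \<noteq> 0" using k[OF \<gamma>] by simp
    fix i assume i: "i \<le> l"
    show "ev (pnt \<epsilon> \<gamma>) (P i) * direction (pnt \<epsilon> \<gamma>) (k \<gamma>) = ev (pnt \<epsilon> \<gamma>) (P (k \<gamma>)) * direction (pnt \<epsilon> \<gamma>) i"
    proof (cases "i = k \<gamma>")
      case False
      let ?u = "direction (pnt \<epsilon> \<gamma>) (k \<gamma>)" and ?v = "direction (pnt \<epsilon> \<gamma>) i"
      let ?mon = "\<lambda>\<mu>. \<Prod>j\<in>UNIV. pnt \<epsilon> \<gamma> j ^ \<mu> j"
      have evP: "(\<Sum>\<mu>\<in>box (Suc M). a (i', \<mu>) * ?mon \<mu>) = ev (pnt \<epsilon> \<gamma>) (P i')" for i'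
        by (simp only: P_def ev_box_poly)
      have "0 = (\<Sum>j\<in>J. a j * C (\<gamma>, i) j)"
        using a[of "(\<gamma>, i)"] \<gamma> i False by (simp add: E_def)
      also have "\<dots> = (\<Sum>i'\<le>l. \<Sum>\<mu>\<in>box (Suc M). a (i', \<mu>) * C (\<gamma>, i) (i', \<mu>))"
        unfolding J_def by (subst sum.cartesian_product) (simp only: case_prod_beta' prod.collapse)
      also have "\<dots> = (\<Sum>i'\<le>l. ((if i' = i then ?u else 0) - (if i' = k \<gamma> then ?v else 0)) * ev (pnt \<epsilon> \<gamma>) (P i'))"
        unfolding evP[symmetric] sum_distrib_left C_def prod.case by (simp only: mult.left_commute)
      also have "\<dots> = (\<Sum>i'\<le>l. if i' = i then ?u * ev (pnt \<epsilon> \<gamma>) (P i') else 0)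
          - (\<Sum>i'\<le>l. if i' = k \<gamma> then ?v * ev (pnt \<epsilon> \<gamma>) (P i') else 0)"
        unfolding sum_subtractf[symmetric] by (rule sum.cong) (auto simp: left_diff_distrib)
      also have "\<dots> = ?u * ev (pnt \<epsilon> \<gamma>) (P i) - ?v * ev (pnt \<epsilon> \<gamma>) (P (k \<gamma>))"
        using i k[OF \<gamma>] by simp
      finally show ?thesis by (simp only: mult.commute) simp
    qed simp
  qed
  define F where "F t = (\<Sum>i\<le>l. ev t (P i) * ev (pt t) (h i))" for t
  have F0: "F t = 0" if reg: "\<And>A \<gamma>. \<gamma> \<in> box g \<Longrightarrow> regular (mix A t \<epsilon> \<gamma>)" for t
  proof -
    have zero: "(\<lambda>_. 0) \<in> (box g :: ('n \<Rightarrow> nat) set)" using \<open>0 < g\<close> by (simp add: mem_box)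
    have mix_UNIV: "mix UNIV t \<epsilon> (\<lambda>_. 0) = t" by (simp add: mix_def[abs_def])
    have "par l (\<lambda>i. ev t (P i)) (direction t)"
    proof -
      have "par l (\<lambda>i. ev (mix UNIV t \<epsilon> (\<lambda>_. 0)) (P i)) (direction (mix UNIV t \<epsilon> (\<lambda>_. 0)))"
      proof (rule par_at_mixed_points[OF \<epsilon> _ _ _ reg _ zero])
        show "M + m \<le> g" by (simp add: g_def)
        show "low (Suc M) (on_line t (\<lambda>i. if i = j then 1 else 0) (P i))" for i t j
          unfolding P_def by (rule low_box_poly)
        show "par l (\<lambda>i. ev (\<lambda>j. \<epsilon> * of_nat (\<gamma> j)) (P i)) (direction (\<lambda>j. \<epsilon> * of_nat (\<gamma> j)))"
          if "\<gamma> \<in> box g" for \<gamma>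
          using par_grid[OF that] unfolding pnt_def .
      qed simp_all
      then show ?thesis unfolding mix_UNIV .
    qed
    moreover obtain k where k: "k \<le> l" "direction t k \<noteq> 0"
      using direction_nz reg[OF zero, of UNIV] unfolding mix_UNIV by blast
    ultimately have "ev t (P i) * direction t k = ev t (P k) * direction t i" if "i \<le> l" for i
      using that by (simp add: par_def)
    then have "direction t k * F t = ev t (P k) * (\<Sum>i\<le>l. direction t i * ev (pt t) (h i))"
      unfolding F_def sum_distrib_left
      by (intro sum.cong refl)
        (simp only: atMost_iff mult.assoc[symmetric] mult.commute[of "direction t k" "ev t _"])
    then have "direction t k * F t = 0" unfolding direction_syzygy by simp
    then show "F t = 0" using k(2) by simp
  qed
  have F: "F d = 0" for d
  proof -
    define W where "W = (\<Sum>i\<le>l. on_line (\<lambda>_. 0) d (P i) * on_line p0 (\<lambda>i. \<Sum>j\<in>UNIV. d j * dir j i) (h i))"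
    have pt_T: "pt (\<lambda>j. 0 + T * d j) = (\<lambda>i. p0 i + T * (\<Sum>j\<in>UNIV. d j * dir j i))" for T
      unfolding pt_line by (simp add: pt_def)
    have W: "poly W T = F (\<lambda>j. 0 + T * d j)" for T
      unfolding W_def F_def pt_T by (simp add: poly_sum poly_on_line)
    have "finite {T. \<not> regular (mix A (\<lambda>j. 0 + T * d j) \<epsilon> \<gamma>)}" if \<gamma>: "\<gamma> \<in> box g" for A \<gamma>
    proof -
      \<comment> \<open>At \<open>T = 0\<close> the coordinates in \<open>A\<close> are \<open>0\<close>, which are coordinates of grid points.\<close>
      let ?\<gamma> = "\<lambda>j. if j \<in> A then 0 else \<gamma> j" and ?d = "\<lambda>j. if j \<in> A then d j else 0"
      have eq: "mix A (\<lambda>j. 0 + T * d j) \<epsilon> \<gamma> = (\<lambda>j. pnt \<epsilon> ?\<gamma> j + T * ?d j)" for T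
        by (auto simp: mix_def pnt_def)
      have "?\<gamma> \<in> box g" using \<gamma> \<open>0 < g\<close> by (auto simp: mem_box)
      from reg_grid[OF this] have "regular (\<lambda>j. pnt \<epsilon> ?\<gamma> j + 0 * ?d j)" by simp
      then show ?thesis unfolding eq by (rule regular_open)
    qed
    then have "finite (\<Union>A. \<Union>\<gamma>\<in>box g. {T. \<not> regular (mix A (\<lambda>j. 0 + T * d j) \<epsilon> \<gamma>)})" (is "finite ?B")
      by (intro finite_UN_I) simp_all
    moreover have "UNIV - ?B \<subseteq> {T. poly W T = 0}"
      unfolding W using F0 by blast
    ultimately have "infinite {T. poly W T = 0}"
      using Diff_infinite_finite[OF _ infinite_UNIV_char_0] finite_subset by blast
    then have "W = 0" using poly_roots_finite by blast
    then show "F d = 0" using W[of 1] by simp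
  qed
  define Q where "Q i = psubst cst coord (P i)" for i
  have ev_Q: "ev x (Q i) = ev (\<lambda>j. ev x (coord j)) (P i)" for x i
    unfolding Q_def
    by (rule rhom_eqI[OF rhom_comp[OF rhom_ev rhom_psubst[OF rhom_cst]] rhom_ev])
      (simp_all add: psubst_cst psubst_X rhom_cst)
  have "(\<Sum>i<Suc l. Q i * h i) = 0"
  proof (rule ev_eq_0_imp_eq_0)
    fix x
    have "F (\<lambda>j. ev x (coord j)) = 0" by (rule F)
    then show "ev x (\<Sum>i<Suc l. Q i * h i) = 0"
      unfolding F_def pt_coord lessThan_Suc_atMost by (simp add: ev_Q)
  qed
  moreover have "tdeg_le (CARD('n) * M) (Q i)" for i
    unfolding Q_def P_def by (intro tdeg_le_psubst tdeg_box_poly tdeg_coord)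
  ultimately have "Q i = 0" if "i < Suc l" for i
    using free that by (auto simp: mpoly_syzygy_free_def)
  then have "ev t (P i) = 0" if "i \<le> l" for i t
    using that ev_Q[of "pt t" i] by (simp add: coord_pt)
  then have "a (i, \<mu>) = 0" if "i \<le> l" "\<mu> \<in> box (Suc M)" for i \<mu>
    using box_poly_eq_0[of M "\<lambda>\<mu>. a (i, \<mu>)" \<mu>] that by (simp add: P_def)
  then show False using a_nz by (auto simp: J_def)
qed

end

text \<open>
  For the step, \<open>D\<close> must serve the induction hypothesis with the bound \<open>3 m\<close> and the interpolation
  argument. The minimal \<open>m\<^sub>0\<close> for which all lines fail depends on \<open>h\<close>, but \<open>m\<^sub>0 \<le> m\<close>, and both
  requirements only become weaker when \<open>m\<close> is replaced by \<open>m\<^sub>0\<close>.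
\<close>

theorem ex_syzygy_free_line:
  "\<exists>D. \<forall>h :: nat \<Rightarrow> ('n::finite, 'k::field_char_0) mpoly.
     mpoly_syzygy_free l D h \<longrightarrow> (\<exists>p q. syzygy_free l m (\<lambda>i. on_line p q (h i)))"
proof (induction l arbitrary: m)
  case 0
  then show ?case by (simp add: syzygy_free_def)
next
  case (Suc l)
  obtain D1 where D1: "\<And>h :: nat \<Rightarrow> ('n, 'k) mpoly. mpoly_syzygy_free l D1 h \<Longrightarrow>
      \<exists>p q. syzygy_free l (3 * m) (\<lambda>i. on_line p q (h i))" using Suc[of "3 * m"] by blast
  define M where "M = CARD('n) * m * Suc l"
  show ?case
  proof (intro exI[of _ "max D1 (CARD('n) * M)"] allI impI)
    fix h :: "nat \<Rightarrow> ('n, 'k) mpoly"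
    assume free: "mpoly_syzygy_free (Suc l) (max D1 (CARD('n) * M)) h"
    show "\<exists>p q. syzygy_free (Suc l) m (\<lambda>i. on_line p q (h i))"
    proof (rule ccontr)
      let ?bad = "\<lambda>m. \<forall>p q. \<not> syzygy_free (Suc l) m (\<lambda>i. on_line p q (h i))"
      assume "\<not> ?thesis"
      then have bad: "?bad m" by blast
      define m0 where "m0 = (LEAST m. ?bad m)"
      have m0: "?bad m0" "m0 \<le> m" unfolding m0_def using bad by (rule LeastI, rule Least_le)
      have "\<not> ?bad 0" by (auto simp: syzygy_free_def syzygy_def low_0_iff)
      then have "m0 \<noteq> 0" using m0(1) by metis
      then have less: "\<not> ?bad (m0 - 1)" unfolding m0_def by (intro not_less_Least) simp
      have "mpoly_syzygy_free l D1 h"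
        unfolding mpoly_syzygy_free_def
      proof (intro allI impI)
        fix c i assume c: "(\<forall>i<l. tdeg_le D1 (c i)) \<and> (\<Sum>i<l. c i * h i) = 0" and i: "i < l"
        define c' where "c' i = (if i < l then c i else 0)" for i
        have "(\<Sum>i<Suc l. c' i * h i) = (\<Sum>i<l. c i * h i)" by (simp add: c'_def)
        moreover have "tdeg_le (max D1 (CARD('n) * M)) (c' i)" for i
          using c tdeg_le_mono[of D1 "c i"] by (simp add: c'_def)
        ultimately have "c' i = 0" using free c i by (simp add: mpoly_syzygy_free_def)
        then show "c i = 0" using i by (simp add: c'_def)
      qed
      then obtain p q where "syzygy_free l (3 * m) (\<lambda>i. on_line p q (h i))" using D1 by blast
      then have "syzygy_free l (3 * m0) (\<lambda>i. on_line p q (h i))"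
        by (rule syzygy_free_mono) (use m0 in simp)
      then interpret every_line_has_syzygy h l m0
        using m0(1) less \<open>m0 \<noteq> 0\<close> by unfold_locales blast+
      obtain p0 q0 w where "w \<noteq> 0" "w + sum q0 UNIV \<noteq> 0"
        "\<forall>j. good p0 (\<lambda>i. q0 i + w * (if i = j then 1 else 0))" using ex_good_frame by blast
      then interpret good_frame h l m0 p0 q0 w by unfold_locales auto
      have "CARD('n) * m0 * Suc l \<le> M" unfolding M_def using m0(2) by (intro mult_le_mono) simp_all
      from not_mpoly_syzygy_free[OF this]
      show False using free tdeg_le_mono unfolding mpoly_syzygy_free_def by (meson max.cobounded2)
    qed
  qed
qed

section \<open>Restriction to linear subspaces\<close>

text \<open>
  Nonvanishing at two points is tested on the line that joins them.
\<close>

lemma mpoly_no_zero_divisors: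
  fixes p q :: "('n::finite, 'k::field_char_0) mpoly"
  assumes "p * q = 0" "p \<noteq> 0" shows "q = 0"
proof (rule ccontr)
  assume "q \<noteq> 0"
  then obtain x y where x: "ev x p \<noteq> 0" and y: "ev y q \<noteq> 0"
    using assms(2) ev_eq_0_imp_eq_0 by metis
  let ?r = "on_line x (\<lambda>j. y j - x j)"
  have "poly (?r p) 0 \<noteq> 0" "poly (?r q) 1 \<noteq> 0" using x y by (simp_all add: poly_on_line)
  then have "?r p \<noteq> 0" "?r q \<noteq> 0" by auto
  moreover have "?r p * ?r q = 0"
    using assms(1) by (simp flip: rhom_mult[OF rhom_on_line] add: rhom_zero[OF rhom_on_line])
  ultimately show False by simp
qed

text \<open>
  The line should miss the origin and involve the coordinates \<open>u\<close> and \<open>v\<close> independently, so that these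
  two can serve as coordinates on the plane it spans. Both conditions are open, and the second one
  holds for the line through the unit vector \<open>e\<^sub>u\<close> in the direction \<open>e\<^sub>v\<close>.
\<close>

lemma ex_independent_free_line:
  fixes h :: "nat \<Rightarrow> ('n::finite, 'k::field_char_0) mpoly"
  assumes "syzygy_free l m (\<lambda>i. on_line p q (h i))" "u \<noteq> v"
  shows "\<exists>p q. syzygy_free l m (\<lambda>i. on_line p q (h i)) \<and> p u * q v - p v * q u \<noteq> 0"
proof -
  define a b where "a j = (if j = u then 1 else 0) - p j" and "b j = (if j = v then 1 else 0) - q j" for j
  define W where "W = [:p u, a u:] * [:q v, b v:] - [:p v, a v:] * [:q u, b u:]"
  have poly_W: "poly W T = (p u + T * a u) * (q v + T * b v) - (p v + T * a v) * (q u + T * b u)" for T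
    by (simp only: W_def poly_diff poly_mult poly_pCons poly_0 mult_zero_right add_0_right)
  have "p u + 1 * a u = 1" "q v + 1 * b v = 1" "p v + 1 * a v = 0"
    using assms(2) by (simp_all add: a_def b_def)
  then have "poly W 1 = 1" unfolding poly_W by simp
  then have "W \<noteq> 0" by auto
  have "finite {T. \<not> syzygy_free l m (\<lambda>i. on_line (\<lambda>j. p j + T * a j) (\<lambda>j. q j + T * b j) (h i))}"
    by (rule syzygy_free_line_open[of _ _ _ 0]) (use assms in simp)
  then have "finite ({T. \<not> syzygy_free l m (\<lambda>i. on_line (\<lambda>j. p j + T * a j) (\<lambda>j. q j + T * b j) (h i))}
      \<union> {T. poly W T = 0})" (is "finite ?B") using poly_roots_finite[OF \<open>W \<noteq> 0\<close>] by (rule finite_UnI)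
  then obtain T where "T \<notin> ?B" using ex_new_if_finite[OF infinite_UNIV_char_0] by blast
  then have "syzygy_free l m (\<lambda>i. on_line (\<lambda>j. p j + T * a j) (\<lambda>j. q j + T * b j) (h i))"
    "poly W T \<noteq> 0" by simp_all
  then show ?thesis
    by (intro exI[of _ "\<lambda>j. p j + T * a j"] exI[of _ "\<lambda>j. q j + T * b j"]) (simp only: poly_W simp_thms)
qed

text \<open>
  A plane on which \<open>x\<^sub>u\<close> and \<open>x\<^sub>v\<close> are coordinates: there \<open>x\<^sub>j = lam j x\<^sub>u + mu j x\<^sub>v\<close> for all
  other \<open>j\<close>. For a set \<open>B\<close> of other indices, imposing these equations for \<open>j \<in> B\<close> gives a larger
  subspace; \<open>sub B\<close> is restriction to it, and \<open>proj B\<close> is a projection onto it.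
\<close>

locale plane_coordinates =
  fixes u v :: "'n::finite" and lam mu :: "'n \<Rightarrow> 'k::field_char_0"
begin

definition flin :: "'n \<Rightarrow> ('n, 'k) mpoly" where
  "flin j = X j - (cst (lam j) * X u + cst (mu j) * X v)"

definition sub :: "'n set \<Rightarrow> ('n, 'k) mpoly \<Rightarrow> ('n, 'k) mpoly" where
  "sub B = psubst cst (\<lambda>j. if j \<in> B then cst (lam j) * X u + cst (mu j) * X v else X j)"

lemma rhom_sub: "rhom (sub B)"
  unfolding sub_def by (rule rhom_psubst[OF rhom_cst])

lemma sub_cst: "sub B (cst c) = cst c"
  and sub_X: "sub B (X j) = (if j \<in> B then cst (lam j) * X u + cst (mu j) * X v else X j)"
  by (simp_all add: sub_def psubst_cst psubst_X rhom_cst)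

definition proj :: "'n set \<Rightarrow> ('n \<Rightarrow> 'k) \<Rightarrow> 'n \<Rightarrow> 'k" where
  "proj B x j = (if j \<in> B then lam j * x u + mu j * x v else x j)"

lemma ev_sub: "ev x (sub B p) = ev (proj B x) p"
  by (rule rhom_eqI[OF rhom_comp[OF rhom_ev rhom_sub] rhom_ev]) (simp_all add: sub_cst sub_X proj_def)

lemma sub_flin_outside: "u \<notin> B \<Longrightarrow> v \<notin> B \<Longrightarrow> j \<notin> B \<Longrightarrow> sub B (flin j) = flin j"
  by (simp add: flin_def rhom_simps[OF rhom_sub] sub_cst sub_X)

lemma sub_flin_inside: "u \<notin> B \<Longrightarrow> v \<notin> B \<Longrightarrow> j \<in> B \<Longrightarrow> sub B (flin j) = 0"
  by (simp add: flin_def rhom_simps[OF rhom_sub] sub_cst sub_X)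

lemma diff_sub_mem: "p - sub B p \<in> ideal_gen (flin ` B)"
proof (induction p rule: mpoly_induct)
  case (cst c)
  then show ?case by (simp add: sub_cst ideal.span_zero)
next
  case (X j)
  have "flin j \<in> ideal_gen (flin ` B)" if "j \<in> B" using that by (intro ideal.span_base) simp
  then show ?case by (simp add: sub_X flin_def[symmetric] ideal.span_zero)
next
  case (add p q)
  have "(p - sub B p) + (q - sub B q) \<in> ideal_gen (flin ` B)" by (rule ideal.span_add[OF add])
  then show ?case by (simp add: rhom_add[OF rhom_sub] algebra_simps)
next
  case (mult p q)
  have "p * (q - sub B q) + sub B q * (p - sub B p) \<in> ideal_gen (flin ` B)"
    by (intro ideal.span_add ideal.span_scale mult)
  moreover have "p * (q - sub B q) + sub B q * (p - sub B p) = p * q - sub B p * sub B q"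
    by (simp add: algebra_simps)
  ultimately show ?case by (simp add: rhom_mult[OF rhom_sub])
qed

text \<open>
  Membership in an ideal generated by these linear forms becomes the equation \<open>sub B p = 0\<close>. In
  particular, the quotient by the ideal is a domain.
\<close>

lemma ideal_flin_eq:
  assumes "u \<notin> B" "v \<notin> B" shows "ideal_gen (flin ` B) = {p. sub B p = 0}"
proof
  show "ideal_gen (flin ` B) \<subseteq> {p. sub B p = 0}"
  proof (rule ideal.span_minimal)
    show "flin ` B \<subseteq> {p. sub B p = 0}" using sub_flin_inside[OF assms] by auto
    show "ideal.subspace {p. sub B p = 0}"
      by (simp add: ideal.subspace_def rhom_simps[OF rhom_sub])
  qed
  show "{p. sub B p = 0} \<subseteq> ideal_gen (flin ` B)"
  proof
    fix p assume "p \<in> {p. sub B p = 0}"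
    then show "p \<in> ideal_gen (flin ` B)" using diff_sub_mem[of p B] by simp
  qed
qed

text \<open>
  Given a point \<open>y\<close> of the subspace, the line is moved inside the subspace until it starts at \<open>y\<close>.
  For all but finitely many positions on the way it stays free of syzygies, so \<open>c\<^sub>i\<close> vanishes at all but
  finitely many points of the line through \<open>p\<close> and \<open>y\<close>, and therefore at \<open>y\<close>.
\<close>

lemma syzygy_free_on_subspace:
  fixes h :: "nat \<Rightarrow> ('n, 'k) mpoly"
  assumes free: "syzygy_free l (Suc d) (\<lambda>i. on_line p q (h i))"
    and B: "u \<notin> B" "v \<notin> B" "proj B p = p" "proj B q = q"
    and c: "\<And>i. i < l \<Longrightarrow> tdeg_le d (c i)" "sub B (\<Sum>i<l. c i * h i) = 0" "i < l"
  shows "sub B (c i) = 0"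
proof (rule ev_eq_0_imp_eq_0)
  fix x
  define y where "y = proj B x"
  define a where "a j = y j - p j" for j
  have proj_line: "proj B (\<lambda>j. (p j + T * a j) + s * q j) = (\<lambda>j. (p j + T * a j) + s * q j)" for T s
  proof
    fix j
    show "proj B (\<lambda>j. (p j + T * a j) + s * q j) j = (p j + T * a j) + s * q j"
    proof (cases "j \<in> B")
      case True
      have pj: "p j = lam j * p u + mu j * p v" and qj: "q j = lam j * q u + mu j * q v"
        using fun_cong[OF B(3), of j] fun_cong[OF B(4), of j] True by (simp_all add: proj_def)
      have aj: "a j = lam j * a u + mu j * a v"
      proof -
        have "y j = lam j * x u + mu j * x v" "y u = x u" "y v = x v"
          using True B(1,2) by (simp_all add: y_def proj_def)
        then show ?thesis by (simp only: a_def pj right_diff_distrib add_diff_add)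
      qed
      show ?thesis
        using True by (simp only: proj_def if_True pj qj aj distrib_left mult.left_commute add_ac)
    qed (simp add: proj_def)
  qed
  have "ev (\<lambda>j. p j + T * a j) (c i) = 0"
    if "syzygy_free l (Suc d) (\<lambda>i. on_line (\<lambda>j. p j + T * a j) q (h i))" for T
  proof -
    let ?r = "on_line (\<lambda>j. p j + T * a j) q"
    have "poly (?r (\<Sum>i<l. c i * h i)) s = 0" for s
      using ev_sub[of "\<lambda>j. (p j + T * a j) + s * q j" B "\<Sum>i<l. c i * h i"] c(2)
      unfolding proj_line poly_on_line by simp
    then have "?r (\<Sum>i<l. c i * h i) = 0" using poly_all_0_iff_0 by blast
    then have "syzygy l (Suc d) (\<lambda>i. ?r (h i)) (\<lambda>i. ?r (c i))"
      using c(1) by (simp add: syzygy_def low_on_line rhom_simps[OF rhom_on_line])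
    then have "?r (c i) = 0" using syzygy_freeD[OF that] c(3) by blast
    then have "coeff (?r (c i)) 0 = 0" by simp
    then show ?thesis by (simp add: coeff_0_on_line)
  qed
  then have "- {T. \<not> syzygy_free l (Suc d) (\<lambda>i. on_line (\<lambda>j. p j + T * a j) q (h i))}
      \<subseteq> {T. poly (on_line p a (c i)) T = 0}"
    unfolding poly_on_line by blast
  moreover have "finite {T. \<not> syzygy_free l (Suc d) (\<lambda>i. on_line (\<lambda>j. p j + T * a j) q (h i))}"
    using syzygy_free_line_open[of l "Suc d" p 0 a q "\<lambda>_. 0" h] free by simp
  then have "infinite (- {T. \<not> syzygy_free l (Suc d) (\<lambda>i. on_line (\<lambda>j. p j + T * a j) q (h i))})"
    unfolding Compl_eq_Diff_UNIV by (rule Diff_infinite_finite[OF _ infinite_UNIV_char_0])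
  ultimately have "infinite {T. poly (on_line p a (c i)) T = 0}" by (rule infinite_super)
  then have "on_line p a (c i) = 0" using poly_roots_finite by blast
  then have "poly (on_line p a (c i)) 1 = 0" by simp
  then show "ev x (sub B (c i)) = 0" unfolding ev_sub poly_on_line by (simp add: a_def y_def)
qed

end

section \<open>Homogeneous components\<close>

definition mdeg :: "('n::finite \<Rightarrow>\<^sub>0 nat) \<Rightarrow> nat" where
  "mdeg e = (\<Sum>x\<in>UNIV. Poly_Mapping.lookup e x)"

lemma mdeg_add: "mdeg (e + e') = mdeg e + mdeg e'"
  by (simp add: mdeg_def lookup_add sum.distrib)

lemma mem_forms: "p \<in> forms d \<longleftrightarrow> (\<forall>e\<in>Poly_Mapping.keys p. mdeg e = d)"
  by (simp add: forms_def mdeg_def)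

lemma forms_0 [simp]: "0 \<in> forms d"
  by (simp add: mem_forms)

lemma forms_add: "p \<in> forms d \<Longrightarrow> q \<in> forms d \<Longrightarrow> p + q \<in> forms d"
  unfolding mem_forms using keys_add[of p q] by blast

lemma forms_diff: "p \<in> forms d \<Longrightarrow> q \<in> forms d \<Longrightarrow> p - q \<in> forms d"
  using forms_add[of p d "- q"] by (simp add: mem_forms in_keys_iff)

lemma forms_mult: "p \<in> forms d \<Longrightarrow> q \<in> forms d' \<Longrightarrow> p * q \<in> forms (d + d')"
  unfolding mem_forms using keys_mult[of p q] by (fastforce simp: mdeg_add)

lemma forms_tdeg_le: "p \<in> forms d \<Longrightarrow> tdeg_le d p"
  by (simp add: mem_forms tdeg_le_def mdeg_def)

lemma X_form: "X j \<in> forms 1"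
  by (simp add: mem_forms X_def mdeg_def lookup_single when_def)

lemma cst_form: "cst c \<in> forms 0"
  by (simp add: mem_forms cst_def mdeg_def)

definition hcomp :: "nat \<Rightarrow> ('n::finite, 'k::field) mpoly \<Rightarrow> ('n, 'k) mpoly" where
  "hcomp d p = (\<Sum>e\<in>{e\<in>Poly_Mapping.keys p. mdeg e = d}. Poly_Mapping.single e (Poly_Mapping.lookup p e))"

lemma lookup_hcomp: "Poly_Mapping.lookup (hcomp d p) e = (if mdeg e = d then Poly_Mapping.lookup p e else 0)"
  by (auto simp: hcomp_def lookup_sum lookup_single when_def in_keys_iff)

lemma hcomp_form: "hcomp d p \<in> forms d"
  by (auto simp: mem_forms in_keys_iff lookup_hcomp split: if_splits)

lemma hcomp_add: "hcomp d (p + q) = hcomp d p + hcomp d q"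
  by (rule poly_mapping_eqI) (simp add: lookup_hcomp lookup_add)

lemma hcomp_0 [simp]: "hcomp d 0 = 0"
  by (rule poly_mapping_eqI) (simp add: lookup_hcomp)

lemma hcomp_sum: "hcomp d (sum f A) = (\<Sum>x\<in>A. hcomp d (f x))"
  by (induction A rule: infinite_finite_induct) (simp_all add: hcomp_add)

lemma hcomp_of_form: "p \<in> forms d' \<Longrightarrow> hcomp d p = (if d = d' then p else 0)"
  by (rule poly_mapping_eqI) (auto simp: lookup_hcomp mem_forms in_keys_iff)

lemma sum_hcomp: "p = (\<Sum>d\<in>mdeg ` Poly_Mapping.keys p. hcomp d p)"
proof (rule poly_mapping_eqI)
  fix e
  have "Poly_Mapping.lookup p e = (\<Sum>d\<in>mdeg ` Poly_Mapping.keys p. if d = mdeg e then Poly_Mapping.lookup p e else 0)"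
    by (auto simp: in_keys_iff)
  also have "\<dots> = Poly_Mapping.lookup (\<Sum>d\<in>mdeg ` Poly_Mapping.keys p. hcomp d p) e"
    unfolding lookup_sum by (rule sum.cong) (auto simp: lookup_hcomp)
  finally show "Poly_Mapping.lookup p e = Poly_Mapping.lookup (\<Sum>d\<in>mdeg ` Poly_Mapping.keys p. hcomp d p) e" .
qed

text \<open>
  Passing to homogeneous components turns a relation with forms into one with coefficients of known
  degree.
\<close>

lemma hcomp_mult_form:
  assumes "g \<in> forms d'"
  shows "hcomp d (p * g) = (if d' \<le> d then hcomp (d - d') p * g else 0)"
proof -
  let ?K = "mdeg ` Poly_Mapping.keys p"
  have "hcomp d (p * g) = hcomp d ((\<Sum>k\<in>?K. hcomp k p) * g)" by (simp flip: sum_hcomp)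
  also have "\<dots> = (\<Sum>k\<in>?K. hcomp d (hcomp k p * g))" by (simp add: sum_distrib_right hcomp_sum)
  also have "\<dots> = (\<Sum>k\<in>?K. if d = k + d' then hcomp k p * g else 0)"
    using hcomp_of_form[OF forms_mult[OF hcomp_form assms]] by simp
  also have "\<dots> = (if d' \<le> d then hcomp (d - d') p * g else 0)"
  proof (cases "d' \<le> d")
    case True
    have "(\<Sum>k\<in>?K. if d = k + d' then hcomp k p * g else 0) = (\<Sum>k\<in>?K. if k = d - d' then hcomp (d - d') p * g else 0)"
      using True by (intro sum.cong) auto
    moreover have "hcomp (d - d') p = 0" if "d - d' \<notin> ?K"
    proof (rule poly_mapping_eqI)
      fix e
      show "Poly_Mapping.lookup (hcomp (d - d') p) e = Poly_Mapping.lookup 0 e"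
      proof (cases "mdeg e = d - d'")
        case True
        then have "e \<notin> Poly_Mapping.keys p" using that by (metis imageI)
        then show ?thesis by (simp add: lookup_hcomp in_keys_iff)
      qed (simp add: lookup_hcomp)
    qed
    ultimately show ?thesis using True by simp
  next
    case False
    then show ?thesis by (auto intro!: sum.neutral)
  qed
  finally show ?thesis .
qed

lemma hcomp_0_eq_cst:
  fixes p :: "('n::finite, 'k::field) mpoly"
  shows "hcomp 0 p = cst (Poly_Mapping.lookup p 0)"
proof (rule poly_mapping_eqI)
  fix m :: "'n \<Rightarrow>\<^sub>0 nat"
  have "mdeg m = 0 \<longleftrightarrow> m = 0" by (auto simp: mdeg_def poly_mapping_eq_iff fun_eq_iff)
  then show "Poly_Mapping.lookup (hcomp 0 p) m = Poly_Mapping.lookup (cst (Poly_Mapping.lookup p 0)) m"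
    by (simp add: lookup_hcomp cst_def lookup_single when_def)
qed

section \<open>Regular sequences of forms\<close>

lemma mem_ideal_gen_image:
  fixes g :: "'i \<Rightarrow> 'a::comm_ring_1"
  assumes "finite I" shows "p \<in> ideal_gen (g ` I) \<longleftrightarrow> (\<exists>c. p = (\<Sum>i\<in>I. c i * g i))"
proof
  have "ideal_gen (g ` I) \<subseteq> {p. \<exists>c. p = (\<Sum>i\<in>I. c i * g i)}"
  proof (rule ideal.span_minimal)
    show "g ` I \<subseteq> {p. \<exists>c. p = (\<Sum>i\<in>I. c i * g i)}"
    proof
      fix p assume "p \<in> g ` I"
      then obtain j where j: "j \<in> I" "p = g j" by blast
      have "(\<Sum>i\<in>I. (if i = j then 1 else 0) * g i) = (\<Sum>i\<in>I. if i = j then g i else 0)"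
        by (rule sum.cong) auto
      also have "\<dots> = p" using j assms by simp
      finally show "p \<in> {p. \<exists>c. p = (\<Sum>i\<in>I. c i * g i)}"
        by (intro CollectI exI[of _ "\<lambda>i. if i = j then 1 else 0"]) (rule sym)
    qed
    show "ideal.subspace {p. \<exists>c. p = (\<Sum>i\<in>I. c i * g i)}"
      unfolding ideal.subspace_def
    proof (intro conjI ballI allI)
      show "0 \<in> {p. \<exists>c. p = (\<Sum>i\<in>I. c i * g i)}" by (auto intro!: exI[of _ "\<lambda>_. 0"])
    next
      fix p q assume "p \<in> {p. \<exists>c. p = (\<Sum>i\<in>I. c i * g i)}" "q \<in> {p. \<exists>c. p = (\<Sum>i\<in>I. c i * g i)}"
      then obtain c d where "p = (\<Sum>i\<in>I. c i * g i)" "q = (\<Sum>i\<in>I. d i * g i)" by blast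
      then have "p + q = (\<Sum>i\<in>I. (c i + d i) * g i)" by (simp add: distrib_right sum.distrib)
      then show "p + q \<in> {p. \<exists>c. p = (\<Sum>i\<in>I. c i * g i)}"
        by (intro CollectI exI[of _ "\<lambda>i. c i + d i"])
    next
      fix r p assume "p \<in> {p. \<exists>c. p = (\<Sum>i\<in>I. c i * g i)}"
      then obtain c where "p = (\<Sum>i\<in>I. c i * g i)" by blast
      then have "r * p = (\<Sum>i\<in>I. (r * c i) * g i)" by (simp only: sum_distrib_left mult.assoc)
      then show "r * p \<in> {p. \<exists>c. p = (\<Sum>i\<in>I. c i * g i)}"
        by (intro CollectI exI[of _ "\<lambda>i. r * c i"])
    qed
  qed
  from subsetD[OF this] show "p \<in> ideal_gen (g ` I) \<Longrightarrow> \<exists>c. p = (\<Sum>i\<in>I. c i * g i)"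
    by (rule CollectD)
  assume "\<exists>c. p = (\<Sum>i\<in>I. c i * g i)"
  then obtain c where "p = (\<Sum>i\<in>I. c i * g i)" ..
  then show "p \<in> ideal_gen (g ` I)"
    by (simp only:) (intro ideal.span_sum ideal.span_scale ideal.span_base imageI)
qed

lemma set_take_image: "k \<le> length hs \<Longrightarrow> set (take k hs) = (!) hs ` {..<k}"
  using nth_image[of k hs] by (simp only: atLeast0LessThan)

lemma set_image: "set hs = (!) hs ` {..<length hs}"
  using set_take_image[of "length hs" hs] by simp

text \<open>
  The last coefficient lies in the ideal by regularity; expressing it through the earlier
  generators turns the relation into a shorter one.
\<close>

lemma regular_seq_syzygy_prefix:
  assumes "regular_seq hs" "k \<le> length hs" "(\<Sum>i<k. c i * hs ! i) = 0" "i < k"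
  shows "c i \<in> ideal_gen (set (take k hs))"
  using assms(2-)
proof (induction k arbitrary: c i)
  case 0
  then show ?case by simp
next
  case (Suc k)
  have mono: "ideal_gen (set (take k hs)) \<subseteq> ideal_gen (set (take (Suc k) hs))"
    by (rule ideal.span_mono) (simp add: set_take_subset_set_take)
  have "hs ! k * (- c k) = (\<Sum>i<k. c i * hs ! i)"
    using Suc.prems(2) by (simp add: add_eq_0_iff mult.commute)
  also have "\<dots> \<in> ideal_gen (set (take k hs))"
    using mem_ideal_gen_image[of "{..<k}" _ "(!) hs"] Suc.prems(1) by (auto simp: set_take_image)
  finally have "- c k \<in> ideal_gen (set (take k hs))"
    using assms(1) Suc.prems(1) by (auto simp: regular_seq_def)
  from ideal.span_neg[OF this] have ck: "c k \<in> ideal_gen (set (take k hs))" by simp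
  then obtain d where d: "c k = (\<Sum>i<k. d i * hs ! i)"
    using mem_ideal_gen_image[of "{..<k}" _ "(!) hs"] Suc.prems(1) by (auto simp: set_take_image)
  show ?case
  proof (cases "i = k")
    case True
    then show ?thesis using ck mono by blast
  next
    case False
    then have i: "i < k" using Suc.prems by simp
    have "(\<Sum>i<k. (c i + d i * hs ! k) * hs ! i) = (\<Sum>i<k. c i * hs ! i) + c k * hs ! k"
      unfolding d sum_distrib_right sum.distrib[symmetric]
      by (intro sum.cong refl) (simp only: distrib_right mult.assoc mult.commute[of "hs ! k"])
    also have "\<dots> = 0" using Suc.prems(2) by simp
    finally have "c i + d i * hs ! k \<in> ideal_gen (set (take k hs))"
      using Suc.IH[of "\<lambda>i. c i + d i * hs ! k"] Suc.prems(1) i by simp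
    moreover have "d i * hs ! k \<in> ideal_gen (set (take (Suc k) hs))"
      using Suc.prems(1) by (intro ideal.span_scale ideal.span_base) (simp add: take_Suc_conv_app_nth)
    ultimately have "(c i + d i * hs ! k) - d i * hs ! k \<in> ideal_gen (set (take (Suc k) hs))"
      using mono by (intro ideal.span_diff) auto
    then show ?thesis by simp
  qed
qed

lemma one_notin_regular: "regular_seq hs \<Longrightarrow> 1 \<notin> ideal_gen (set hs)"
proof
  assume hs: "regular_seq hs" and one: "1 \<in> ideal_gen (set hs)"
  have "p \<in> ideal_gen (set hs)" for p using ideal.span_scale[OF one, of p] by simp
  then have "ideal_gen (set hs) = UNIV" by blast
  then show False using hs by (simp add: regular_seq_def)
qed

text \<open>
  A homogeneous complete intersection with chosen degrees of its generators.
\<close>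

locale regular_forms =
  fixes hs :: "('n::finite, 'k::field_char_0) mpoly list" and deg :: "nat \<Rightarrow> nat"
  assumes regular: "regular_seq hs"
    and form: "i < length hs \<Longrightarrow> hs ! i \<in> forms (deg i)"
begin

abbreviation I :: "('n, 'k) mpoly set" where "I \<equiv> ideal_gen (set hs)"

lemma syzygy_mem: "(\<Sum>i<length hs. c i * hs ! i) = 0 \<Longrightarrow> i < length hs \<Longrightarrow> c i \<in> I"
  using regular_seq_syzygy_prefix[OF regular, of "length hs" c i] by simp

lemma cst_mem: assumes "cst a \<in> I" shows "a = 0"
proof (rule ccontr)
  assume "a \<noteq> 0"
  then have "cst (1 / a) * cst a = (1 :: ('n, 'k) mpoly)"
    by (simp add: rhom_one[OF rhom_cst] flip: rhom_mult[OF rhom_cst])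
  then have "1 \<in> I" using ideal.span_scale[OF assms, of "cst (1 / a)"] by simp
  then show False using one_notin_regular[OF regular] by blast
qed

lemma mem_I: "p \<in> I \<longleftrightarrow> (\<exists>c. p = (\<Sum>i<length hs. c i * hs ! i))"
  unfolding set_image[of hs] by (rule mem_ideal_gen_image) simp

text \<open>
  If a generator could be omitted, it would occur with a unit coefficient in a relation.
\<close>

lemma minimal: "minimal_generating_set I (set hs)"
  unfolding minimal_generating_set_def
proof (intro conjI allI impI)
  show "set hs \<subseteq> (\<Union>d. forms d)"
  proof
    fix p assume "p \<in> set hs"
    then obtain i where "i < length hs" "p = hs ! i" by (auto simp: in_set_conv_nth)
    then show "p \<in> (\<Union>d. forms d)" using form[of i] by blast
  qed
  fix H assume "H \<subset> set hs"
  then obtain p where "p \<in> set hs" "p \<notin> H" by blast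
  then obtain i where i: "i < length hs" "hs ! i \<notin> H" by (auto simp: in_set_conv_nth)
  let ?J = "{..<length hs} - {i}"
  have "H \<subseteq> (!) hs ` ?J"
  proof
    fix p assume p: "p \<in> H"
    then have "p \<in> set hs" using \<open>H \<subset> set hs\<close> by blast
    then obtain j where "j < length hs" "p = hs ! j" by (auto simp: in_set_conv_nth)
    then show "p \<in> (!) hs ` ?J" using p i(2) by auto
  qed
  show "ideal_gen H \<noteq> I"
  proof
    assume "ideal_gen H = I"
    moreover have "hs ! i \<in> I" using i by (intro ideal.span_base) simp
    ultimately have "hs ! i \<in> ideal_gen ((!) hs ` ?J)"
      using ideal.span_mono[OF \<open>H \<subseteq> _\<close>] by blast
    then obtain c where c: "hs ! i = (\<Sum>j\<in>?J. c j * hs ! j)"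
      using mem_ideal_gen_image[of ?J] by blast
    define d where "d j = (if j = i then - 1 else c j)" for j
    have "(\<Sum>j\<in>?J. d j * hs ! j) = hs ! i"
      unfolding c by (rule sum.cong) (auto simp: d_def)
    then have "(\<Sum>j<length hs. d j * hs ! j) = 0"
      using i by (simp add: sum.remove[of "{..<length hs}" i] d_def)
    from syzygy_mem[OF this i(1)] have "- 1 \<in> I" by (simp add: d_def)
    from ideal.span_neg[OF this] have "1 \<in> I" by simp
    then show False using one_notin_regular[OF regular] by blast
  qed
qed simp_all

lemma alpha_le:
  assumes "i < length hs" shows "alpha I \<le> deg i"
proof -
  have "hs ! i \<in> set hs \<inter> forms (deg i)" using form[OF assms] assms by simp
  then have "set hs \<inter> forms (deg i) \<noteq> {}" by blast
  then show ?thesis unfolding alpha_def using minimal by (intro Least_le) blast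
qed

lemma I_low_degree:
  assumes "p \<in> I" "tdeg_le d p" "d < alpha I" shows "p = 0"
proof -
  have "I \<subseteq> {p. \<forall>e\<in>Poly_Mapping.keys p. alpha I \<le> mdeg e}" (is "_ \<subseteq> ?S")
  proof (rule ideal.span_minimal)
    show "set hs \<subseteq> ?S"
      using form alpha_le by (fastforce simp: in_set_conv_nth mem_forms)
    show "ideal.subspace ?S"
      unfolding ideal.subspace_def
    proof (intro conjI ballI allI)
      show "0 \<in> ?S" by simp
      show "p + q \<in> ?S" if "p \<in> ?S" "q \<in> ?S" for p q using that keys_add[of p q] by blast
      show "r * p \<in> ?S" if "p \<in> ?S" for r p
        using that keys_mult[of r p] by (fastforce simp: mdeg_add)
    qed
  qed
  then have "Poly_Mapping.keys p = {}"
    using assms by (fastforce simp: tdeg_le_def mdeg_def)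
  then show ?thesis by simp
qed

text \<open>
  A syzygy has its coefficients in the ideal, which contains nothing nonzero of degree below
  \<open>alpha I\<close>.
\<close>

lemma mpoly_syzygy_free_sublist:
  assumes "inj_on \<phi> {..<r}" "\<phi> ` {..<r} \<subseteq> {..<length hs}" "d < alpha I"
  shows "mpoly_syzygy_free r d (\<lambda>k. hs ! \<phi> k)"
  unfolding mpoly_syzygy_free_def
proof (intro allI impI)
  fix c k assume c: "(\<forall>k<r. tdeg_le d (c k)) \<and> (\<Sum>k<r. c k * hs ! \<phi> k) = 0" and k: "k < r"
  define c' where "c' i = (if i \<in> \<phi> ` {..<r} then c (the_inv_into {..<r} \<phi> i) else 0)" for i
  have c'_\<phi>: "c' (\<phi> k) = c k" if "k < r" for k
    using that by (simp add: c'_def the_inv_into_f_f[OF assms(1)])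
  have "(\<Sum>i<length hs. c' i * hs ! i) = (\<Sum>i\<in>\<phi> ` {..<r}. c' i * hs ! i)"
    using assms(2) by (intro sum.mono_neutral_right) (auto simp: c'_def)
  also have "\<dots> = (\<Sum>k<r. c k * hs ! \<phi> k)"
    by (simp add: sum.reindex[OF assms(1)] c'_\<phi>)
  finally have "c' (\<phi> k) \<in> I"
    using c k assms(2) by (intro syzygy_mem) auto
  then show "c k = 0" using I_low_degree[OF _ _ assms(3)] c k by (simp add: c'_\<phi>)
qed

text \<open>
  One half of the independence of this number from the generating set. Modulo the generators \<open>hs ! i\<close> of smaller degree, each
  \<open>hs ! i\<close> of degree \<open>e\<close> is a combination, with constant coefficients, of the elements of \<open>G\<close> of degree
  \<open>e\<close>. If there were more of the former than of the latter, a nontrivial combination of the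
  former would lie in the ideal of the generators of smaller degree, giving a relation with a
  nonzero constant coefficient.
\<close>

lemma card_degree_le:
  assumes G: "minimal_generating_set I G"
  shows "card {i. i < length hs \<and> deg i = e} \<le> card (G \<inter> forms e)"
proof (rule ccontr)
  let ?R = "{i. i < length hs \<and> deg i = e}" and ?E = "G \<inter> forms e"
  let ?L = "ideal_gen ((!) hs ` {i. i < length hs \<and> deg i < e})"
  assume "\<not> ?thesis"
  then have less: "card ?E < card ?R" by simp
  have fin: "finite G" and GI: "ideal_gen G = I" and G_forms: "G \<subseteq> (\<Union>d. forms d)"
    using G by (auto simp: minimal_generating_set_def)
  have low_mem: "hcomp d g \<in> ?L" if "g \<in> I" "d < e" for g d
  proof -
    obtain c where "g = (\<Sum>i<length hs. c i * hs ! i)" using \<open>g \<in> I\<close> mem_I by blast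
    then have "hcomp d g = (\<Sum>i<length hs. if deg i \<le> d then hcomp (d - deg i) (c i) * hs ! i else 0)"
      by (simp add: hcomp_sum hcomp_mult_form[OF form])
    also have "\<dots> \<in> ?L"
    proof (rule ideal.span_sum)
      fix i assume i: "i \<in> {..<length hs}"
      have "hs ! i \<in> ?L" if "deg i \<le> d"
        using that i \<open>d < e\<close> by (intro ideal.span_base) auto
      then show "(if deg i \<le> d then hcomp (d - deg i) (c i) * hs ! i else 0) \<in> ?L"
        by (simp add: ideal.span_scale ideal.span_zero)
    qed
    finally show ?thesis .
  qed
  have "\<exists>A. hs ! i - (\<Sum>g\<in>?E. cst (A g) * g) \<in> ?L" if i: "i \<in> ?R" for i
  proof -
    have "hs ! i \<in> ideal_gen ((\<lambda>g. g) ` G)" using i by (simp add: GI ideal.span_base)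
    from iffD1[OF mem_ideal_gen_image[OF fin] this]
    obtain C where C: "hs ! i = (\<Sum>g\<in>G. C g * g)" ..
    have "hs ! i = hcomp e (hs ! i)" using hcomp_of_form[OF form, of i e] i by simp
    also have "\<dots> = (\<Sum>g\<in>G. hcomp e (C g * g))" unfolding C by (rule hcomp_sum)
    also have "\<dots> = (\<Sum>g\<in>G - ?E. hcomp e (C g * g)) + (\<Sum>g\<in>?E. hcomp e (C g * g))"
      by (rule sum.subset_diff[OF _ fin]) blast
    also have "(\<Sum>g\<in>?E. hcomp e (C g * g)) = (\<Sum>g\<in>?E. cst (Poly_Mapping.lookup (C g) 0) * g)"
    proof (rule sum.cong[OF refl])
      fix g assume "g \<in> ?E"
      then have "g \<in> forms e" by blast
      then have "hcomp e (C g * g) = hcomp 0 (C g) * g"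
        by (simp only: hcomp_mult_form order_refl if_True diff_self_eq_0)
      then show "hcomp e (C g * g) = cst (Poly_Mapping.lookup (C g) 0) * g"
        by (simp only: hcomp_0_eq_cst)
    qed
    finally have eq: "hs ! i - (\<Sum>g\<in>?E. cst (Poly_Mapping.lookup (C g) 0) * g) = (\<Sum>g\<in>G - ?E. hcomp e (C g * g))"
      by (simp only: add_diff_cancel_right')
    have "(\<Sum>g\<in>G - ?E. hcomp e (C g * g)) \<in> ?L"
    proof (rule ideal.span_sum)
      fix g assume g: "g \<in> G - ?E"
      then obtain d where d: "g \<in> forms d" "d \<noteq> e" using G_forms by auto
      have "g \<in> ideal_gen G" using g by (intro ideal.span_base) simp
      then have "g \<in> I" by (simp only: GI)
      from low_mem[OF this, of d] have "g \<in> ?L" if "d < e"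
        using that by (simp add: hcomp_of_form[OF d(1)])
      then show "hcomp e (C g * g) \<in> ?L"
        using d(2) unfolding hcomp_mult_form[OF d(1)]
        by (cases "d < e") (simp_all add: ideal.span_scale ideal.span_zero)
    qed
    then show ?thesis
      by (intro exI[of _ "\<lambda>g. Poly_Mapping.lookup (C g) 0"]) (simp only: eq)
  qed
  then have "\<forall>i\<in>?R. \<exists>A. hs ! i - (\<Sum>g\<in>?E. cst (A g) * g) \<in> ?L" by (rule ballI)
  from bchoice[OF this] obtain A where A: "\<forall>i\<in>?R. hs ! i - (\<Sum>g\<in>?E. cst (A i g) * g) \<in> ?L" ..
  have "finite ?E" "finite ?R" using fin by simp_all
  from underdetermined_system[OF this less, of "\<lambda>g i. A i g"] obtain a where
    a_nz: "\<exists>i\<in>?R. a i \<noteq> 0" and a: "\<And>g. g \<in> ?E \<Longrightarrow> (\<Sum>i\<in>?R. a i * A i g) = 0" by (elim exE conjE) simp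
  have "(\<Sum>i\<in>?R. \<Sum>g\<in>?E. cst (a i * A i g) * g) = (\<Sum>g\<in>?E. \<Sum>i\<in>?R. cst (a i * A i g) * g)"
    by (rule sum.swap)
  also have "\<dots> = (\<Sum>g\<in>?E. cst (\<Sum>i\<in>?R. a i * A i g) * g)"
    by (simp only: rhom_sum[OF rhom_cst] sum_distrib_right)
  also have "\<dots> = 0" by (intro sum.neutral ballI) (simp add: a rhom_zero[OF rhom_cst])
  finally have cancel: "(\<Sum>i\<in>?R. \<Sum>g\<in>?E. cst (a i * A i g) * g) = 0" .
  have "(\<Sum>i\<in>?R. cst (a i) * hs ! i) = (\<Sum>i\<in>?R. cst (a i) * (hs ! i - (\<Sum>g\<in>?E. cst (A i g) * g)))
      + (\<Sum>i\<in>?R. \<Sum>g\<in>?E. cst (a i * A i g) * g)"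
    unfolding sum.distrib[symmetric]
  proof (intro sum.cong refl)
    fix i
    have "(\<Sum>g\<in>?E. cst (a i * A i g) * g) = cst (a i) * (\<Sum>g\<in>?E. cst (A i g) * g)"
      by (simp only: rhom_mult[OF rhom_cst] sum_distrib_left mult.assoc)
    then show "cst (a i) * hs ! i = cst (a i) * (hs ! i - (\<Sum>g\<in>?E. cst (A i g) * g))
        + (\<Sum>g\<in>?E. cst (a i * A i g) * g)"
      by (simp only: right_diff_distrib diff_add_cancel)
  qed
  also have "\<dots> \<in> ?L"
    unfolding cancel add_0_right using A by (intro ideal.span_sum ideal.span_scale) blast
  finally have "(\<Sum>i\<in>?R. cst (a i) * hs ! i) \<in> ?L" .
  moreover have "finite {i. i < length hs \<and> deg i < e}" by simp
  ultimately have "\<exists>b. (\<Sum>i\<in>?R. cst (a i) * hs ! i) = (\<Sum>i | i < length hs \<and> deg i < e. b i * hs ! i)"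
    by (simp only: mem_ideal_gen_image)
  then obtain b where b: "(\<Sum>i\<in>?R. cst (a i) * hs ! i) = (\<Sum>i | i < length hs \<and> deg i < e. b i * hs ! i)" ..
  define c where "c i = (if deg i = e then cst (a i) else if deg i < e then - b i else 0)" for i
  have "(\<Sum>i<length hs. c i * hs ! i) = (\<Sum>i<length hs. (if deg i = e then cst (a i) * hs ! i else 0)
      - (if deg i < e then b i * hs ! i else 0))"
    by (rule sum.cong) (auto simp: c_def)
  also have "\<dots> = (\<Sum>i\<in>?R. cst (a i) * hs ! i) - (\<Sum>i | i < length hs \<and> deg i < e. b i * hs ! i)"
  proof -
    have "{i\<in>{..<length hs}. deg i = e} = ?R" "{i\<in>{..<length hs}. deg i < e} = {i. i < length hs \<and> deg i < e}"
      by auto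
    then show ?thesis by (simp only: sum_subtractf flip: sum.inter_filter[OF finite_lessThan])
  qed
  also have "\<dots> = 0" using b by simp
  finally have c0: "(\<Sum>i<length hs. c i * hs ! i) = 0" .
  obtain i where i: "i \<in> ?R" "a i \<noteq> 0" using a_nz by blast
  with syzygy_mem[OF c0, of i] have "cst (a i) \<in> I" by (simp add: c_def)
  with i(2) cst_mem show False by blast
qed

end

section \<open>Multiplication by a linear form on the quotient\<close>

context plane_coordinates
begin

lemma flin_form: "flin j \<in> forms 1"
proof -
  have "cst c * X j' \<in> forms (0 + 1)" for c :: 'k and j' :: 'n
    by (rule forms_mult[OF cst_form X_form])
  then show ?thesis unfolding flin_def by (intro forms_diff forms_add X_form) simp_all
qed

lemma ev_flin_unit:
  assumes "w \<noteq> u" "w \<noteq> v"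
  shows "ev (\<lambda>i. if i = w then 1 else 0) (flin j) = (if j = w then 1 else 0)"
  using assms by (simp add: flin_def)

lemma inj_on_flin: "u \<notin> B \<Longrightarrow> v \<notin> B \<Longrightarrow> inj_on flin B"
proof (rule inj_onI)
  fix i j assume B: "u \<notin> B" "v \<notin> B" "i \<in> B" "j \<in> B" and eq: "flin i = flin j"
  then have "i \<noteq> u" "i \<noteq> v" by blast+
  from ev_flin_unit[OF this, of i] ev_flin_unit[OF this, of j] eq show "i = j"
    by (cases "i = j") simp_all
qed

lemma independent_flin:
  assumes "u \<notin> B" "v \<notin> B" shows "\<not> poly_dependent (flin ` B)"
proof
  have fin: "finite (flin ` B)" by simp
  assume "poly_dependent (flin ` B)"
  then obtain c where c: "\<exists>x\<in>flin ` B. c x \<noteq> 0" "(\<Sum>x\<in>flin ` B. poly_scale (c x) x) = 0"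
    unfolding poly_vs.dependent_finite[OF fin] by (elim exE conjE) simp
  then obtain j where j: "j \<in> B" "c (flin j) \<noteq> 0" by blast
  have "j \<noteq> u" "j \<noteq> v" using assms j by blast+
  have "(\<Sum>i\<in>B. cst (c (flin i)) * flin i) = 0"
    using c(2) by (simp add: sum.reindex[OF inj_on_flin[OF assms]] poly_scale_def cst_def)
  then have "ev (\<lambda>i. if i = j then 1 else 0) (\<Sum>i\<in>B. cst (c (flin i)) * flin i) = 0" by simp
  then have "(\<Sum>i\<in>B. c (flin i) * (if i = j then 1 else 0)) = 0"
    using ev_flin_unit[OF \<open>j \<noteq> u\<close> \<open>j \<noteq> v\<close>] by simp
  then have "(\<Sum>i\<in>B. if i = j then c (flin i) else 0) = 0"
    by (simp add: if_distrib[of "\<lambda>z. _ * z"] cong: if_cong)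
  then show False using j by simp
qed

lemma hcomp_mem_ideal_flin:
  assumes "y \<in> ideal_gen (flin ` B)" shows "hcomp (Suc d) y \<in> ideal_gen (flin ` B)"
proof -
  have "finite B" by simp
  from assms obtain b where b: "y = (\<Sum>j\<in>B. b j * flin j)"
    unfolding mem_ideal_gen_image[OF \<open>finite B\<close>] ..
  have "hcomp (Suc d) y = (\<Sum>j\<in>B. hcomp (Suc d - 1) (b j) * flin j)"
    unfolding b hcomp_sum hcomp_mult_form[OF flin_form] by simp
  then show ?thesis unfolding mem_ideal_gen_image[OF \<open>finite B\<close>]
    by (intro exI[of _ "\<lambda>j. hcomp (Suc d - 1) (b j)"])
qed

text \<open>
  After taking components of degree \<open>d + 1\<close>, the coefficients \<open>c'\<close> of \<open>flin w * g\<close> have degree at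
  most \<open>t\<close>, since every generator has degree at least \<open>alpha I\<close>, and only the generators listed by \<open>\<phi>\<close>
  occur. On the subspace where \<open>flin w\<close> vanishes as well they form a syzygy, so they vanish there,
  and each of them is a multiple of \<open>flin w\<close> modulo the ideal of the subspace. Then \<open>flin w\<close> can be
  cancelled, because the quotient by that ideal is a domain.
\<close>

lemma multiplication_injective:
  assumes "regular_forms hs deg"
    and \<phi>: "bij_betw \<phi> {..<r} {i. i < length hs \<and> deg i \<le> alpha (ideal_gen (set hs)) + t}"
    and free: "syzygy_free r (Suc t) (\<lambda>k. on_line p q (hs ! \<phi> k))"
    and pq: "\<And>j. j \<noteq> u \<Longrightarrow> j \<noteq> v \<Longrightarrow> p j = lam j * p u + mu j * p v"
      "\<And>j. j \<noteq> u \<Longrightarrow> j \<noteq> v \<Longrightarrow> q j = lam j * q u + mu j * q v"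
    and B: "u \<notin> B" "v \<notin> B" and w: "w \<notin> B" "w \<noteq> u" "w \<noteq> v"
    and d: "d + 1 \<le> alpha (ideal_gen (set hs)) + t" and g: "g \<in> forms d"
    and prod_mem: "flin w * g \<in> ideal_gen (set hs \<union> flin ` B)"
  shows "g \<in> ideal_gen (set hs \<union> flin ` B)"
proof -
  interpret regular_forms hs deg by (rule assms(1))
  let ?L = "ideal_gen (flin ` B)" and ?B' = "insert w B"
  let ?R = "{i. i < length hs \<and> deg i \<le> alpha I + t}"
  have B': "u \<notin> ?B'" "v \<notin> ?B'" using B w by auto
  obtain x y where xy: "flin w * g = x + y" "x \<in> I" "y \<in> ?L"
    using prod_mem unfolding ideal.span_Un by blast
  obtain c where c: "x = (\<Sum>i<length hs. c i * hs ! i)" using xy(2) unfolding mem_I ..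
  define c' where "c' i = (if deg i \<le> Suc d then hcomp (Suc d - deg i) (c i) else 0)" for i
  have "hcomp (Suc d) x = (\<Sum>i<length hs. c' i * hs ! i)"
    unfolding c hcomp_sum
  proof (rule sum.cong[OF refl])
    fix i assume "i \<in> {..<length hs}"
    then have "hs ! i \<in> forms (deg i)" using form by simp
    then show "hcomp (Suc d) (c i * hs ! i) = c' i * hs ! i"
      by (simp add: hcomp_mult_form c'_def)
  qed
  also have "\<dots> = (\<Sum>i\<in>?R. c' i * hs ! i)"
  proof (rule sum.mono_neutral_right)
    show "\<forall>i\<in>{..<length hs} - ?R. c' i * hs ! i = 0" using d by (auto simp: c'_def)
  qed auto
  also have "\<dots> = (\<Sum>k<r. c' (\<phi> k) * hs ! \<phi> k)"
    by (rule sum.reindex_bij_betw[OF \<phi>, symmetric])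
  finally have x_eq: "hcomp (Suc d) x = (\<Sum>k<r. c' (\<phi> k) * hs ! \<phi> k)" .
  define y' where "y' = hcomp (Suc d) y"
  have y': "y' \<in> ?L" unfolding y'_def by (rule hcomp_mem_ideal_flin[OF xy(3)])
  have "flin w * g \<in> forms (Suc d)" using forms_mult[OF flin_form g, of w] by simp
  then have "flin w * g = hcomp (Suc d) (flin w * g)" by (simp add: hcomp_of_form)
  also have "\<dots> = (\<Sum>k<r. c' (\<phi> k) * hs ! \<phi> k) + y'"
    unfolding xy(1) hcomp_add x_eq y'_def ..
  finally have fg: "flin w * g = (\<Sum>k<r. c' (\<phi> k) * hs ! \<phi> k) + y'" .
  have c'_deg: "tdeg_le t (c' (\<phi> k))" if "k < r" for k
  proof (cases "deg (\<phi> k) \<le> Suc d")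
    case True
    have "\<phi> k \<in> ?R" using \<phi> that by (auto simp: bij_betw_def)
    then have "alpha I \<le> deg (\<phi> k)" using alpha_le by simp
    then have "Suc d - deg (\<phi> k) \<le> t" using d by simp
    from tdeg_le_mono[OF forms_tdeg_le[OF hcomp_form] this] show ?thesis
      unfolding c'_def using True by simp
  qed (simp add: c'_def)
  have "y' \<in> ideal_gen (flin ` ?B')"
    using y' ideal.span_mono[of "flin ` B" "flin ` ?B'"] by auto
  then have "sub ?B' y' = 0" unfolding ideal_flin_eq[OF B'] by simp
  moreover have "sub ?B' (flin w * g) = 0"
    using sub_flin_inside[OF B', of w] by (simp add: rhom_mult[OF rhom_sub])
  ultimately have "sub ?B' (\<Sum>k<r. c' (\<phi> k) * hs ! \<phi> k) = 0"
    unfolding fg rhom_add[OF rhom_sub] by simp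
  moreover have proj_eq: "proj ?B' z = z"
    if z: "\<And>j. j \<noteq> u \<Longrightarrow> j \<noteq> v \<Longrightarrow> z j = lam j * z u + mu j * z v" for z
  proof
    fix j
    show "proj ?B' z j = z j"
    proof (cases "j \<in> ?B'")
      case True
      then have "j \<noteq> u" "j \<noteq> v" using B' by blast+
      from z[OF this] show ?thesis using True by (simp only: proj_def if_True)
    qed (simp only: proj_def if_False)
  qed
  ultimately have "sub ?B' (c' (\<phi> k)) = 0" if "k < r" for k
    using syzygy_free_on_subspace[OF free B' proj_eq[of p, OF pq(1)] proj_eq[of q, OF pq(2)],
        of "\<lambda>k. c' (\<phi> k)" k] c'_deg that by blast
  then have "c' (\<phi> k) \<in> ideal_gen (insert (flin w) (flin ` B))" if "k < r" for k
    using that ideal_flin_eq[OF B'] by simp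
  then have "\<forall>k\<in>{..<r}. \<exists>s. c' (\<phi> k) - s * flin w \<in> ?L"
    unfolding ideal.span_breakdown_eq by simp
  from bchoice[OF this] obtain s where s: "\<forall>k\<in>{..<r}. c' (\<phi> k) - s k * flin w \<in> ?L" ..
  define z where "z = g - (\<Sum>k<r. s k * hs ! \<phi> k)"
  have "flin w * (\<Sum>k<r. s k * hs ! \<phi> k) = (\<Sum>k<r. hs ! \<phi> k * (s k * flin w))"
    by (simp only: sum_distrib_left mult_ac)
  then have "flin w * z = (\<Sum>k<r. hs ! \<phi> k * c' (\<phi> k)) + y' - (\<Sum>k<r. hs ! \<phi> k * (s k * flin w))"
    unfolding z_def right_diff_distrib fg by (simp only: mult.commute)
  also have "\<dots> = (\<Sum>k<r. hs ! \<phi> k * c' (\<phi> k)) - (\<Sum>k<r. hs ! \<phi> k * (s k * flin w)) + y'"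
    by (simp only: add_diff_eq diff_add_eq)
  also have "\<dots> = (\<Sum>k<r. hs ! \<phi> k * (c' (\<phi> k) - s k * flin w)) + y'"
    by (simp only: right_diff_distrib sum_subtractf)
  also have "\<dots> \<in> ?L"
    using s y' by (intro ideal.span_add ideal.span_sum ideal.span_scale) blast+
  finally have "sub B (flin w * z) = 0" unfolding ideal_flin_eq[OF B] by simp
  then have "flin w * sub B z = 0"
    using sub_flin_outside[OF B w(1)] by (simp add: rhom_mult[OF rhom_sub])
  moreover have "flin w \<noteq> 0"
    using ev_flin_unit[OF w(2,3), of w] by auto
  ultimately have "sub B z = 0" by (rule mpoly_no_zero_divisors)
  then have "z \<in> ?L" unfolding ideal_flin_eq[OF B] by simp
  moreover have "(\<Sum>k<r. s k * hs ! \<phi> k) \<in> I"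
  proof (intro ideal.span_sum ideal.span_scale ideal.span_base)
    fix k assume "k \<in> {..<r}"
    then have "\<phi> k \<in> ?R" using \<phi> by (auto simp: bij_betw_def)
    then show "hs ! \<phi> k \<in> set hs" by simp
  qed
  ultimately have "(\<Sum>k<r. s k * hs ! \<phi> k) + z \<in> ideal_gen (set hs \<union> flin ` B)"
    unfolding ideal.span_Un by blast
  then show ?thesis by (simp add: z_def)
qed

end

lemma residue_class_eq_iff:
  assumes Q: "Q = ideal_gen S" shows "residue_class Q p = residue_class Q q \<longleftrightarrow> p - q \<in> Q"
proof
  assume "residue_class Q p = residue_class Q q"
  moreover have "p \<in> residue_class Q p" by (simp add: residue_class_def Q ideal.span_zero)
  ultimately show "p - q \<in> Q" by (simp add: residue_class_def)
next
  assume pq: "p - q \<in> Q"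
  have "x - p \<in> Q \<longleftrightarrow> x - q \<in> Q" for x
  proof
    assume "x - p \<in> Q"
    then have "(x - p) + (p - q) \<in> Q" using pq unfolding Q by (rule ideal.span_add)
    then show "x - q \<in> Q" by simp
  next
    assume "x - q \<in> Q"
    then have "(x - q) - (p - q) \<in> Q" using pq unfolding Q by (rule ideal.span_diff)
    then show "x - p \<in> Q" by simp
  qed
  then show "residue_class Q p = residue_class Q q" unfolding residue_class_def by blast
qed

lemma quotient_mult_residue_class:
  assumes Q: "Q = ideal_gen S" shows "quotient_mult Q f (residue_class Q p) = residue_class Q (f * p)"
proof -
  have "residue_class Q (f * q) = residue_class Q (f * p)" if "q \<in> residue_class Q p" for q
  proof -
    have "q - p \<in> ideal_gen S" using that by (simp add: residue_class_def Q)
    then have "f * (q - p) \<in> ideal_gen S" by (rule ideal.span_scale)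
    then show ?thesis unfolding residue_class_eq_iff[OF Q] by (simp only: Q right_diff_distrib)
  qed
  moreover have "p \<in> residue_class Q p" by (simp add: residue_class_def Q ideal.span_zero)
  ultimately show ?thesis unfolding quotient_mult_def by blast
qed

lemma weak_lefschetz_element_if_injective:
  assumes Q: "Q = ideal_gen S"
    and inj: "\<And>g. g \<in> forms d \<Longrightarrow> f * g \<in> Q \<Longrightarrow> g \<in> Q"
  shows "weak_lefschetz_element Q f d"
  unfolding weak_lefschetz_element_def
proof (intro disjI1 inj_onI)
  fix x y assume "x \<in> quotient_part Q d" "y \<in> quotient_part Q d"
    and eq: "quotient_mult Q f x = quotient_mult Q f y"
  then obtain p q where p: "p \<in> forms d" "x = residue_class Q p"
    and q: "q \<in> forms d" "y = residue_class Q q"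
    unfolding quotient_part_def by blast
  have "f * p - f * q \<in> Q"
    using eq unfolding p(2) q(2) quotient_mult_residue_class[OF Q] residue_class_eq_iff[OF Q] .
  then have "f * (p - q) \<in> Q" by (simp only: right_diff_distrib)
  from inj[OF forms_diff[OF p(1) q(1)] this]
  show "x = y" unfolding p(2) q(2) residue_class_eq_iff[OF Q] .
qed

lemma (in regular_forms) card_relevant_le:
  assumes "\<And>j. j < length b \<Longrightarrow> has_minimal_generators I (alpha I + j) (b ! j)"
    and "length b = Suc t"
  shows "card {i. i < length hs \<and> deg i \<le> alpha I + t} \<le> sum_list b"
proof -
  have "{i. i < length hs \<and> deg i \<le> alpha I + t} \<subseteq> (\<Union>j<length b. {i. i < length hs \<and> deg i = alpha I + j})"
  proof
    fix i assume i: "i \<in> {i. i < length hs \<and> deg i \<le> alpha I + t}"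
    then have "deg i = alpha I + (deg i - alpha I)" "deg i - alpha I < length b"
      using alpha_le[of i] assms(2) by auto
    then show "i \<in> (\<Union>j<length b. {i. i < length hs \<and> deg i = alpha I + j})" using i by blast
  qed
  then have "card {i. i < length hs \<and> deg i \<le> alpha I + t}
      \<le> card (\<Union>j<length b. {i. i < length hs \<and> deg i = alpha I + j})"
    by (rule card_mono[rotated]) simp
  also have "\<dots> \<le> (\<Sum>j<length b. card {i. i < length hs \<and> deg i = alpha I + j})"
    by (rule card_UN_le) simp
  also have "\<dots> \<le> (\<Sum>j<length b. b ! j)"
  proof (rule sum_mono)
    fix j assume "j \<in> {..<length b}"
    then obtain G where "minimal_generating_set I G" "card (G \<inter> forms (alpha I + j)) = b ! j"
      using assms(1)[of j] by (auto simp: has_minimal_generators_def)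
    then show "card {i. i < length hs \<and> deg i = alpha I + j} \<le> b ! j"
      using card_degree_le by metis
  qed
  finally show ?thesis by (simp add: sum_list_sum_nth atLeast0LessThan)
qed

text \<open>
  The bound \<open>D\<close> covers all possible numbers of relevant generators. The coefficients \<open>lam\<close> and \<open>mu\<close>
  are found by Cramer's rule from the line, and the variables other than \<open>u\<close> and \<open>v\<close> are numbered
  \<open>3, \<dots>, n\<close> by \<open>e\<close>, so that \<open>f\<^sub>k\<close> is the form that expresses the variable \<open>e k\<close> on the plane and
  \<open>f\<^sub>i\<close> is the weak Lefschetz element.
\<close>

theorem theorem1p10:
  fixes a b :: "nat list" and l t :: nat
  assumes "3 \<le> CARD('n)"
    and "1 \<le> l" and "length a = l" and "length b = t + 1"
  shows "\<exists>D. \<forall>i \<in> {3..CARD('n)}. \<forall>I :: ('n::finite, 'k::field_char_0) mpoly set.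
    complete_intersection I \<and> of_minimal_type I a b \<and> D \<le> alpha I \<longrightarrow>
    (\<exists>f :: nat \<Rightarrow> ('n, 'k) mpoly.
       f ` {i + 1..CARD('n)} \<subseteq> forms 1 \<and>
       inj_on f {i + 1..CARD('n)} \<and> \<not> poly_dependent (f ` {i + 1..CARD('n)}) \<and>
       WLP_in_degrees (I + ideal_gen (f ` {i + 1..CARD('n)})) {d. d + 1 \<le> alpha I + t})"
proof -
  have "\<forall>r. \<exists>D. \<forall>h :: nat \<Rightarrow> ('n, 'k) mpoly. mpoly_syzygy_free r D h \<longrightarrow>
      (\<exists>p q. syzygy_free r (Suc t) (\<lambda>i. on_line p q (h i)))"
    using ex_syzygy_free_line by blast
  from choice[OF this] obtain D0 where D0: "\<And>r (h :: nat \<Rightarrow> ('n, 'k) mpoly). mpoly_syzygy_free r (D0 r) h \<Longrightarrow>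
      (\<exists>p q. syzygy_free r (Suc t) (\<lambda>i. on_line p q (h i)))" by blast
  define D where "D = Suc (Max (D0 ` {..sum_list b}))"
  have D: "D0 r < D" if "r \<le> sum_list b" for r
    using that by (simp add: D_def less_Suc_eq_le)
  show ?thesis
  proof (intro exI[of _ D] ballI allI impI)
    fix i and I :: "('n, 'k) mpoly set"
    assume i: "i \<in> {3..CARD('n)}"
      and I: "complete_intersection I \<and> of_minimal_type I a b \<and> D \<le> alpha I"
    obtain hs where hs: "regular_seq hs" "set hs \<subseteq> (\<Union>d. forms d)" "I = ideal_gen (set hs)"
      using I unfolding complete_intersection_def by blast
    have "\<forall>i. \<exists>d. i < length hs \<longrightarrow> hs ! i \<in> forms d" using hs(2) nth_mem by blast
    from choice[OF this] obtain deg where deg: "\<forall>i. i < length hs \<longrightarrow> hs ! i \<in> forms (deg i)" ..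
    interpret rf: regular_forms hs deg by unfold_locales (use hs(1) deg in auto)
    define R where "R = {i. i < length hs \<and> deg i \<le> alpha I + t}"
    define r where "r = card R"
    have "r \<le> sum_list b"
      unfolding r_def R_def hs(3)
    proof (rule rf.card_relevant_le)
      obtain gs where "type_witness I a b gs" using I unfolding of_minimal_type_def by blast
      then show "has_minimal_generators (ideal_gen (set hs)) (alpha (ideal_gen (set hs)) + j) (b ! j)"
        if "j < length b" for j
        using that unfolding type_witness_def hs(3) by blast
    qed (use assms in simp)
    have "finite R" by (simp add: R_def)
    then obtain \<phi> where \<phi>: "bij_betw \<phi> {..<r} R"
      using ex_bij_betw_nat_finite[of R] by (auto simp: r_def atLeast0LessThan)
    have "mpoly_syzygy_free r (D0 r) (\<lambda>k. hs ! \<phi> k)"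
    proof (rule rf.mpoly_syzygy_free_sublist)
      show "inj_on \<phi> {..<r}" "\<phi> ` {..<r} \<subseteq> {..<length hs}"
        using \<phi> by (auto simp: bij_betw_def R_def)
      show "D0 r < alpha (ideal_gen (set hs))"
        using D[OF \<open>r \<le> sum_list b\<close>] I unfolding hs(3) by linarith
    qed
    then obtain p0 q0 where free0: "syzygy_free r (Suc t) (\<lambda>k. on_line p0 q0 (hs ! \<phi> k))"
      using D0 by blast
    have "2 \<le> card (UNIV :: 'n set)" using assms(1) by simp
    then obtain u v :: 'n where uv: "u \<noteq> v"
      by (metis card_2_iff obtain_subset_with_card_n)
    obtain p q where free: "syzygy_free r (Suc t) (\<lambda>k. on_line p q (hs ! \<phi> k))"
      and det: "p u * q v - p v * q u \<noteq> 0"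
      using ex_independent_free_line[OF free0 uv] by blast
    define \<delta> where "\<delta> = p u * q v - p v * q u"
    define lam mu where "lam j = (p j * q v - q j * p v) / \<delta>" and "mu j = (q j * p u - p j * q u) / \<delta>" for j
    have "\<delta> \<noteq> 0" using det by (simp add: \<delta>_def)
    have p_eq: "p j = lam j * p u + mu j * p v" and q_eq: "q j = lam j * q u + mu j * q v" for j
    proof -
      have "(p j * q v - q j * p v) * p u + (q j * p u - p j * q u) * p v = p j * \<delta>"
        and "(p j * q v - q j * p v) * q u + (q j * p u - p j * q u) * q v = q j * \<delta>"
        unfolding \<delta>_def by (simp_all only: left_diff_distrib right_diff_distrib mult_ac) simp_all
      then show "p j = lam j * p u + mu j * p v" "q j = lam j * q u + mu j * q v"
        using \<open>\<delta> \<noteq> 0\<close> by (simp_all add: lam_def mu_def add_divide_distrib[symmetric] eq_divide_eq)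
    qed
    interpret plane_coordinates u v lam mu .
    have "card ({3..CARD('n)}) = card (UNIV - {u, v})"
      using uv assms(1) by (simp add: card_Diff_subset)
    then obtain e where e: "bij_betw e {3..CARD('n)} (UNIV - {u, v})"
      using finite_same_card_bij[of "{3..CARD('n)}" "UNIV - {u, v}"] by auto
    define B where "B = e ` {i + 1..CARD('n)}"
    have inj_e: "inj_on e {i + 1..CARD('n)}"
      by (rule inj_on_subset[OF bij_betw_imp_inj_on[OF e]]) (use i in auto)
    have e_mem: "e k \<noteq> u" "e k \<noteq> v" if "k \<in> {3..CARD('n)}" for k
      using bij_betwE[OF e] that by auto
    have "{i + 1..CARD('n)} \<subseteq> {3..CARD('n)}" using i by auto
    then have B: "u \<notin> B" "v \<notin> B" unfolding B_def using e_mem by blast+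
    have w: "e i \<notin> B"
    proof
      assume "e i \<in> B"
      then obtain k where "k \<in> {i + 1..CARD('n)}" "e i = e k" by (auto simp: B_def)
      then have "i = k" using i by (intro inj_onD[OF bij_betw_imp_inj_on[OF e]]) auto
      then show False using \<open>k \<in> _\<close> by simp
    qed
    define f where "f k = flin (e k)" for k
    have fB: "f ` {i + 1..CARD('n)} = flin ` B" by (auto simp: f_def B_def)
    define Q where "Q = I + ideal_gen (flin ` B)"
    have Q: "Q = ideal_gen (set hs \<union> flin ` B)"
      unfolding Q_def hs(3) ideal.span_Un set_plus_def by blast
    show "\<exists>f :: nat \<Rightarrow> ('n, 'k) mpoly.
       f ` {i + 1..CARD('n)} \<subseteq> forms 1 \<and>
       inj_on f {i + 1..CARD('n)} \<and> \<not> poly_dependent (f ` {i + 1..CARD('n)}) \<and>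
       WLP_in_degrees (I + ideal_gen (f ` {i + 1..CARD('n)})) {d. d + 1 \<le> alpha I + t}"
    proof (intro exI[of _ f] conjI)
      show "f ` {i + 1..CARD('n)} \<subseteq> forms 1" using flin_form by (auto simp: f_def)
      show "inj_on f {i + 1..CARD('n)}"
        unfolding f_def[abs_def]
        using comp_inj_on[OF inj_e inj_on_flin[OF B, unfolded B_def]] by (simp add: comp_def)
      show "\<not> poly_dependent (f ` {i + 1..CARD('n)})" unfolding fB by (rule independent_flin[OF B])
      show "WLP_in_degrees (I + ideal_gen (f ` {i + 1..CARD('n)})) {d. d + 1 \<le> alpha I + t}"
        unfolding WLP_in_degrees_def fB Q_def[symmetric]
      proof (intro bexI[of _ "flin (e i)"] ballI)
        show "flin (e i) \<in> forms 1" by (rule flin_form)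
        fix d assume d: "d \<in> {d. d + 1 \<le> alpha I + t}"
        show "weak_lefschetz_element Q (flin (e i)) d"
        proof (rule weak_lefschetz_element_if_injective[OF Q])
          fix g assume g: "g \<in> forms d" "flin (e i) * g \<in> Q"
          have \<phi>': "bij_betw \<phi> {..<r} {i. i < length hs \<and> deg i \<le> alpha (ideal_gen (set hs)) + t}"
            using \<phi> unfolding R_def hs(3) .
          have d': "d + 1 \<le> alpha (ideal_gen (set hs)) + t"
            using d unfolding hs(3) by (rule CollectD)
          show "g \<in> Q"
            unfolding Q
            by (rule multiplication_injective[OF rf.regular_forms_axioms \<phi>' free p_eq q_eq B w
                  e_mem[OF i] d' g(1) g(2)[unfolded Q]])
        qed
      qed
    qed
  qed
qed

end
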